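(* Let $\mathbf r=(r_i^\pm)\in\mathcal N^1_1$ be a nonspecial collection of residues, and let $(E,P_\bullet)$ be a rank 2 quasiparabolic bundle on $(\mathbb P^1,\{t_1,t_2,t_3,t_4\})$ with $\deg(E)=1$. Then the following conditions are equivalent: (1) there exists a logarithmic connection $\nabla$ on $E$, compatible with the $P_i$ and inducing the given residues $r_i^-$ on $P_i$ and $r_i^+$ on $E_{t_i}/P_i$; (2) $(E,P_\bullet)$ is an indecomposable quasiparabolic bundle; (3) $(E,P_\bullet)$ is a simple quasiparabolic bundle; (4) $E\cong B=\mathcal O\oplus\mathcal O(1)$, there is at most one index $i$ with $u_i=\infty$, and the $P_i$ for $u_i\neq\infty$ are not all contained in a single $\mathcal O\subset B$; (5) $E\cong B$, and among the points $U_i\in T_i\subset\mathbb P^2$ corresponding to the quasiparabolic structure there are three non-colinear points distinct from the origin.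
   Context: Work over $\mathbb C$; $X=\mathbb P^1$, $D=\{t_1,\dots,t_4\}$ four distinct points, with $t_i\ne\infty$. A rank 2 quasiparabolic bundle $(E,P_\bullet)$ is a rank 2 vector bundle $E$ on $X$ with lines $P_i\subset E_{t_i}$. It is simple if it has no non-scalar endomorphisms preserving all $P_i$; it is decomposable if $E=E_1\oplus E_2$ with line bundles $E_1,E_2$ such that each $P_i$ equals $(E_1)_{t_i}$ or $(E_2)_{t_i}$, and indecomposable otherwise. A logarithmic connection is $\nabla:E\to E\otimes\Omega^1_X(\log D)$; compatibility means $\mathrm{res}(\nabla,t_i)$ preserves $P_i$. $\mathcal N^1_1=\{(r_i^{\pm})_{1\le i\le4}\in\mathbb C^8:\ \sum_i(r_i^++r_i^-)+1=0\}$. $\mathbf r$ is nonspecial if $r_1^{\sigma_1}+r_2^{\sigma_2}+r_3^{\sigma_3}+r_4^{\sigma_4}\notin\mathbb Z$ for all signs $\sigma_i\in\{+,-\}$ and $r_i^+-r_i^-\notin\mathbb Z$ for all $i$. Coordinates on quasiparabolic structures on $B=\mathcal O\oplus\mathcal O(1)$: let $e$ be the unit section of $\mathcal O$ and $f$ the section of $\mathcal O(1)$ vanishing at $\infty$. Then $P_i=\langle e(t_i)+u_if(t_i)\rangle$ with $u_i\in\mathbb P^1=\mathbb C\cup\{\infty\}$, $u_i=\infty$ meaning $P_i=\langle f(t_i)\rangle=\mathcal O(1)_{t_i}$. "Contained in a single $\mathcal O\subset B$" refers to a line subbundle of $B$ isomorphic to $\mathcal O$. Projective interpretation: the $\mathbb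 P^1$-bundle $\mathbb P(B)\to\mathbb P^1$ of lines in the fibers of $B$ is the blow-up of $\mathbb P^2$ at a point (the origin), the map to $\mathbb P^1$ being projection from the origin; the fiber over $t_i$ is a line $T_i\subset\mathbb P^2$ through the origin, with the origin of $T_i$ corresponding to $u_i=\infty$, and line subbundles $\mathcal O\subset B$ corresponding to lines of $\mathbb P^2$ not through the origin. A quasiparabolic structure on $B$ is thus a quadruple of points $U_i\in T_i$. *)

theory Defs
  imports "HOL-Complex_Analysis.Complex_Analysis"
begin

section \<open>The projective line with its Zariski topology\<close>

datatype p1 = Pt complex | Infty

text \<open>The two standard affine charts, with coordinates \<open>z\<close> and \<open>w = 1/z\<close>.\<close>

definition aff_0 :: "complex \<Rightarrow> p1" where
  "aff_0 z = Pt z"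

definition aff_inf :: "complex \<Rightarrow> p1" where
  "aff_inf w = (if w = 0 then Infty else Pt (1 / w))"

definition zariski_open :: "p1 set \<Rightarrow> bool" where
  "zariski_open U \<longleftrightarrow> U = {} \<or> finite (- U)"

text \<open>Functions are total; being regular on \<open>U\<close> says nothing about values outside \<open>U\<close>.
  Regularity is the usual local one: near each point, \<open>f\<close> is a quotient of polynomials in an
  affine coordinate (a basic neighbourhood being the locus in \<open>U\<close> where the denominator does
  not vanish).\<close>

definition regular_on :: "p1 set \<Rightarrow> (p1 \<Rightarrow> complex) \<Rightarrow> bool" where
  "regular_on U f \<longleftrightarrow>
     (\<forall>c \<in> {aff_0, aff_inf}. \<forall>a. c a \<in> U \<longrightarrow>
        (\<exists>p q. poly q a \<noteq> 0 \<and>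
           (\<forall>w. c w \<in> U \<and> poly q w \<noteq> 0 \<longrightarrow> f (c w) = poly p w / poly q w)))"

definition regular_vec_on :: "p1 set \<Rightarrow> (p1 \<Rightarrow> complex ^ ('n::finite)) \<Rightarrow> bool" where
  "regular_vec_on U s \<longleftrightarrow> (\<forall>i. regular_on U (\<lambda>x. s x $ i))"

definition regular_mat_on :: "p1 set \<Rightarrow> (p1 \<Rightarrow> complex ^ ('m::finite) ^ ('n::finite)) \<Rightarrow> bool" where
  "regular_mat_on U A \<longleftrightarrow> (\<forall>i j. regular_on U (\<lambda>x. A x $ i $ j))"

text \<open>Order of vanishing at a point of a rational function (only its values on a punctured
  neighbourhood matter).\<close>

definition order_at :: "p1 \<Rightarrow> (p1 \<Rightarrow> complex) \<Rightarrow> int" where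
  "order_at x f = (case x of Pt a \<Rightarrow> zorder (\<lambda>z. f (aff_0 z)) a
                           | Infty \<Rightarrow> zorder (\<lambda>w. f (aff_inf w)) 0)"

section \<open>Algebraic vector bundles\<close>

text \<open>A vector bundle of rank \<open>CARD('n)\<close> is a family of \<open>CARD('n)\<close>-dimensional vector spaces
  \<open>E\<^sub>x\<close> together with an atlas of local trivialisations \<open>\<phi>\<^sub>x : E\<^sub>x \<rightarrow> \<complex>\<^sup>n\<close> over Zariski open
  sets, with regular transition functions.  As a bare vector space each fibre \<open>E\<^sub>x\<close> is taken to
  be \<open>\<complex>\<^sup>n\<close>, i.e. a basis of each fibre is chosen, without any regularity in \<open>x\<close>; all of the
  geometry is in the atlas.\<close>

type_synonym 'n vbundle = "(p1 set \<times> (p1 \<Rightarrow> complex ^ 'n ^ 'n)) set"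

definition vector_bundle :: "('n::finite) vbundle \<Rightarrow> bool" where
  "vector_bundle E \<longleftrightarrow>
     (\<forall>(U, \<phi>) \<in> E. zariski_open U \<and> (\<forall>x\<in>U. invertible (\<phi> x))) \<and>
     (\<Union>(U, \<phi>) \<in> E. U) = UNIV \<and>
     (\<forall>(U, \<phi>) \<in> E. \<forall>(V, \<psi>) \<in> E. regular_mat_on (U \<inter> V) (\<lambda>x. \<psi> x ** matrix_inv (\<phi> x)))"

definition is_section :: "('n::finite) vbundle \<Rightarrow> p1 set \<Rightarrow> (p1 \<Rightarrow> complex ^ 'n) \<Rightarrow> bool" where
  "is_section E U s \<longleftrightarrow> (\<forall>(V, \<phi>) \<in> E. regular_vec_on (U \<inter> V) (\<lambda>x. \<phi> x *v s x))"

definition bundle_hom ::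
    "('m::finite) vbundle \<Rightarrow> ('n::finite) vbundle \<Rightarrow> (p1 \<Rightarrow> complex ^ 'm ^ 'n) \<Rightarrow> bool" where
  "bundle_hom E F A \<longleftrightarrow>
     (\<forall>(U, \<phi>) \<in> E. \<forall>(V, \<psi>) \<in> F.
        regular_mat_on (U \<inter> V) (\<lambda>x. \<psi> x ** A x ** matrix_inv (\<phi> x)))"

definition bundle_iso ::
    "('m::finite) vbundle \<Rightarrow> ('n::finite) vbundle \<Rightarrow> (p1 \<Rightarrow> complex ^ 'm ^ 'n) \<Rightarrow> bool" where
  "bundle_iso E F A \<longleftrightarrow> bundle_hom E F A \<and>
     (\<exists>A'. bundle_hom F E A' \<and> (\<forall>x. A x ** A' x = mat 1 \<and> A' x ** A x = mat 1))"

text \<open>A line subbundle is given by its fibres; locally it is spanned by a nowhere vanishing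
  section.\<close>

definition line_subbundle :: "('n::finite) vbundle \<Rightarrow> (p1 \<Rightarrow> (complex ^ 'n) set) \<Rightarrow> bool" where
  "line_subbundle E L \<longleftrightarrow>
     (\<forall>x. \<exists>U s. zariski_open U \<and> x \<in> U \<and> is_section E U s \<and>
        (\<forall>y\<in>U. s y \<noteq> 0 \<and> L y = vec.span {s y}))"

text \<open>An isomorphism of a line bundle \<open>F\<close> with a line subbundle \<open>L\<close> of \<open>E\<close>.\<close>

definition subbundle_isomorphic ::
    "('n::finite) vbundle \<Rightarrow> (p1 \<Rightarrow> (complex ^ 'n) set) \<Rightarrow> 1 vbundle \<Rightarrow> bool" where
  "subbundle_isomorphic E L F \<longleftrightarrow>
     (\<exists>A :: p1 \<Rightarrow> complex ^ 1 ^ 'n. bundle_hom F E A \<and>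
        (\<forall>x. bij_betw (\<lambda>v. A x *v v) UNIV (L x)))"

definition internal_direct_sum ::
    "(p1 \<Rightarrow> (complex ^ ('n::finite)) set) \<Rightarrow> (p1 \<Rightarrow> (complex ^ 'n) set) \<Rightarrow> bool" where
  "internal_direct_sum L M \<longleftrightarrow>
     (\<forall>x. L x \<inter> M x = {0} \<and> {v + w | v w. v \<in> L x \<and> w \<in> M x} = UNIV)"

text \<open>\<open>E \<otimes> L\<close> for a line bundle \<open>L\<close>, with \<open>E\<^sub>x \<otimes> \<complex>\<close> identified with \<open>E\<^sub>x\<close>.\<close>

definition tensor_line :: "('n::finite) vbundle \<Rightarrow> 1 vbundle \<Rightarrow> 'n vbundle" where
  "tensor_line E L =
     {(U \<inter> V, \<lambda>x. \<chi> i j. \<psi> x $ 1 $ 1 * \<phi> x $ i $ j) | U \<phi> V \<psi>. (U, \<phi>) \<in> E \<and> (V, \<psi>) \<in> L}"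

definition line_sum :: "1 vbundle \<Rightarrow> 1 vbundle \<Rightarrow> 2 vbundle" where
  "line_sum L M =
     {(U \<inter> V, \<lambda>x. vector [vector [\<phi> x $ 1 $ 1, 0], vector [0, \<psi> x $ 1 $ 1]]) | U \<phi> V \<psi>.
        (U, \<phi>) \<in> L \<and> (V, \<psi>) \<in> M}"

subsection \<open>Degree\<close>

definition det_bundle :: "('n::finite) vbundle \<Rightarrow> 1 vbundle" where
  "det_bundle E = {(U, \<lambda>x. mat (det (\<phi> x))) | U \<phi>. (U, \<phi>) \<in> E}"

definition nonzero_rational_section :: "1 vbundle \<Rightarrow> (p1 \<Rightarrow> complex ^ 1) \<Rightarrow> bool" where
  "nonzero_rational_section L s \<longleftrightarrow>
     (\<exists>U. zariski_open U \<and> is_section L U s \<and> (\<exists>x\<in>U. s x \<noteq> 0))"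

text \<open>The order of a rational section at a point is computed in any trivialisation there.\<close>

definition section_order :: "1 vbundle \<Rightarrow> (p1 \<Rightarrow> complex ^ 1) \<Rightarrow> p1 \<Rightarrow> int" where
  "section_order L s x =
     (THE k. \<forall>(V, \<psi>) \<in> L. x \<in> V \<longrightarrow> order_at x (\<lambda>y. (\<psi> y *v s y) $ 1) = k)"

text \<open>The degree of \<open>E\<close> is that of its determinant, i.e. the degree of the divisor of any
  nonzero rational section of \<open>det E\<close>.\<close>

definition bundle_degree :: "('n::finite) vbundle \<Rightarrow> int" where
  "bundle_degree E =
     (let L = det_bundle E; s = (SOME s. nonzero_rational_section L s)
      in \<Sum>x | section_order L s x \<noteq> 0. section_order L s x)"

section \<open>Quasiparabolic bundles of rank 2\<close>

definition is_line :: "(complex ^ ('n::finite)) set \<Rightarrow> bool" where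
  "is_line l \<longleftrightarrow> vec.subspace l \<and> vec.dim l = 1"

text \<open>The four marked points are \<open>Pt (t i)\<close>; the line \<open>P i\<close> lies in the fibre there.\<close>

definition quasiparabolic_bundle :: "2 vbundle \<Rightarrow> (4 \<Rightarrow> (complex ^ 2) set) \<Rightarrow> bool" where
  "quasiparabolic_bundle E P \<longleftrightarrow> vector_bundle E \<and> (\<forall>i. is_line (P i))"

definition simple_qp ::
    "(4 \<Rightarrow> complex) \<Rightarrow> 2 vbundle \<Rightarrow> (4 \<Rightarrow> (complex ^ 2) set) \<Rightarrow> bool" where
  "simple_qp t E P \<longleftrightarrow>
     (\<forall>A. bundle_hom E E A \<and> (\<forall>i. (\<lambda>v. A (Pt (t i)) *v v) ` P i \<subseteq> P i) \<longrightarrow>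
        (\<exists>c. \<forall>x. A x = mat c))"

definition decomposable_qp ::
    "(4 \<Rightarrow> complex) \<Rightarrow> 2 vbundle \<Rightarrow> (4 \<Rightarrow> (complex ^ 2) set) \<Rightarrow> bool" where
  "decomposable_qp t E P \<longleftrightarrow>
     (\<exists>L M. line_subbundle E L \<and> line_subbundle E M \<and> internal_direct_sum L M \<and>
        (\<forall>i. P i = L (Pt (t i)) \<or> P i = M (Pt (t i))))"

section \<open>Logarithmic connections\<close>

text \<open>The line bundle \<open>\<Omega>\<^sup>1(log D)\<close> for a finite set \<open>D\<close> of finite points.  The chosen basis of
  the fibre is \<open>dz\<close> at \<open>Pt z\<close> for \<open>z \<notin> D\<close>, \<open>dz/(z - t)\<close> at \<open>Pt t\<close> for \<open>t \<in> D\<close>, and \<open>dw\<close>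
  at \<open>Infty\<close>, where \<open>w = 1/z\<close>.  Local generators are \<open>dz\<close> off \<open>D\<close> and \<open>Infty\<close>, \<open>dz/(z - t)\<close>
  near \<open>t\<close> (where \<open>dz = (z - t) \<cdot> dz/(z - t)\<close>), and \<open>dw\<close> near \<open>Infty\<close> (where
  \<open>dz = - z\<^sup>2 dw\<close>).  In particular the value of a logarithmic form at \<open>t \<in> D\<close>, in the chosen
  basis of the fibre, is its residue at \<open>t\<close>.\<close>

definition log_forms :: "complex set \<Rightarrow> 1 vbundle" where
  "log_forms D =
     {(- insert Infty (Pt ` D), \<lambda>_. mat 1)} \<union>
     {(- insert Infty (Pt ` (D - {t})),
       \<lambda>x. mat (case x of Pt z \<Rightarrow> (if z = t then 1 else z - t) | Infty \<Rightarrow> 1)) | t. t \<in> D} \<union>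
     {(- (Pt ` insert 0 D), \<lambda>x. mat (case x of Pt z \<Rightarrow> - (z ^ 2) | Infty \<Rightarrow> 1))}"

text \<open>The differential \<open>df\<close> as a section of \<open>\<Omega>\<^sup>1(log D)\<close>, in the above bases of the fibres.\<close>

definition log_d :: "complex set \<Rightarrow> (p1 \<Rightarrow> complex) \<Rightarrow> p1 \<Rightarrow> complex" where
  "log_d D f x = (case x of Pt z \<Rightarrow> (if z \<in> D then 0 else deriv (\<lambda>z. f (aff_0 z)) z)
                          | Infty \<Rightarrow> deriv (\<lambda>w. f (aff_inf w)) 0)"

text \<open>A logarithmic connection is a morphism of sheaves \<open>E \<rightarrow> E \<otimes> \<Omega>\<^sup>1(log D)\<close> satisfying the
  Leibniz rule; \<open>nab U s\<close> is only meaningful on \<open>U\<close>, for sections \<open>s\<close> over \<open>U\<close>.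
  \<open>\<complex>\<close>-linearity follows from additivity and the Leibniz rule.\<close>

definition log_connection ::
    "complex set \<Rightarrow> ('n::finite) vbundle \<Rightarrow> (p1 set \<Rightarrow> (p1 \<Rightarrow> complex ^ 'n) \<Rightarrow> p1 \<Rightarrow> complex ^ 'n) \<Rightarrow> bool"
where
  "log_connection D E nab \<longleftrightarrow>
     (\<forall>U s. zariski_open U \<and> is_section E U s \<longrightarrow>
        is_section (tensor_line E (log_forms D)) U (nab U s)) \<and>
     (\<forall>U V s s'. zariski_open U \<and> zariski_open V \<and> V \<subseteq> U \<and> is_section E U s \<and>
        is_section E V s' \<and> (\<forall>x\<in>V. s' x = s x) \<longrightarrow> (\<forall>x\<in>V. nab V s' x = nab U s x)) \<and>
     (\<forall>U s s'. zariski_open U \<and> is_section E U s \<and> is_section E U s' \<longrightarrow>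
        (\<forall>x\<in>U. nab U (\<lambda>y. s y + s' y) x = nab U s x + nab U s' x)) \<and>
     (\<forall>U f s. zariski_open U \<and> regular_on U f \<and> is_section E U s \<longrightarrow>
        (\<forall>x\<in>U. nab U (\<lambda>y. f y *s s y) x = f x *s nab U s x + log_d D f x *s s x))"

text \<open>The residue at \<open>x \<in> D\<close> is the endomorphism \<open>R\<close> of the fibre sending \<open>s(x)\<close> to the residue
  of \<open>\<nabla>s\<close> at \<open>x\<close>, which is its value at \<open>x\<close> by the choice of bases in \<^const>\<open>log_forms\<close>.\<close>

definition has_conn_residue ::
    "('n::finite) vbundle \<Rightarrow> (p1 set \<Rightarrow> (p1 \<Rightarrow> complex ^ 'n) \<Rightarrow> p1 \<Rightarrow> complex ^ 'n) \<Rightarrow> p1 \<Rightarrow>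
     complex ^ 'n ^ 'n \<Rightarrow> bool" where
  "has_conn_residue E nab x R \<longleftrightarrow>
     (\<forall>U s. zariski_open U \<and> x \<in> U \<and> is_section E U s \<longrightarrow> nab U s x = R *v s x)"

text \<open>The endomorphism \<open>R\<close> preserves the line \<open>l\<close> and induces \<open>a\<close> on \<open>l\<close> and \<open>b\<close> on the
  quotient by \<open>l\<close>.\<close>

definition induces_on_flag ::
    "complex ^ ('n::finite) ^ 'n \<Rightarrow> (complex ^ 'n) set \<Rightarrow> complex \<Rightarrow> complex \<Rightarrow> bool" where
  "induces_on_flag R l a b \<longleftrightarrow>
     (\<forall>v\<in>l. R *v v \<in> l) \<and> (\<forall>v\<in>l. R *v v = a *s v) \<and> (\<forall>v. R *v v - b *s v \<in> l)"

definition residues_N11 :: "(4 \<Rightarrow> complex) \<Rightarrow> (4 \<Rightarrow> complex) \<Rightarrow> bool" where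
  "residues_N11 rp rm \<longleftrightarrow> (\<Sum>i\<in>UNIV. rp i + rm i) + 1 = 0"

definition nonspecial :: "(4 \<Rightarrow> complex) \<Rightarrow> (4 \<Rightarrow> complex) \<Rightarrow> bool" where
  "nonspecial rp rm \<longleftrightarrow>
     (\<forall>\<sigma> :: 4 \<Rightarrow> bool. (\<Sum>i\<in>UNIV. if \<sigma> i then rp i else rm i) \<notin> \<int>) \<and>
     (\<forall>i. rp i - rm i \<notin> \<int>)"

section \<open>The bundle \<open>B = \<O> \<oplus> \<O>(1)\<close>\<close>

text \<open>\<open>\<O>(d)\<close> is generated by \<open>f\<close> off \<open>Infty\<close> and by \<open>g\<close> near \<open>Infty\<close>, with \<open>f = z\<^sup>-\<^sup>d g\<close>; the
  chosen basis of the fibre is \<open>f\<close> at finite points and \<open>g\<close> at \<open>Infty\<close>.\<close>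

definition line_O :: "int \<Rightarrow> 1 vbundle" where
  "line_O d =
     {(- {Infty}, \<lambda>_. mat 1),
      (- {Pt 0}, \<lambda>x. mat (case x of Pt z \<Rightarrow> z powi (- d) | Infty \<Rightarrow> 1))}"

definition bundle_B :: "2 vbundle" where
  "bundle_B = line_sum (line_O 0) (line_O 1)"

definition sec_e :: "p1 \<Rightarrow> complex ^ 2" where
  "sec_e x = vector [1, 0]"

definition sec_f :: "p1 \<Rightarrow> complex ^ 2" where
  "sec_f x = (case x of Pt z \<Rightarrow> vector [0, 1] | Infty \<Rightarrow> 0)"

text \<open>The line in the fibre of \<open>B\<close> at a finite point with coordinate \<open>u\<close>.\<close>

definition B_line :: "p1 \<Rightarrow> p1 \<Rightarrow> (complex ^ 2) set" where
  "B_line x u = (case u of Pt c \<Rightarrow> vec.span {sec_e x + c *s sec_f x}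
                         | Infty \<Rightarrow> vec.span {sec_f x})"

text \<open>\<open>\<P>\<^sup>2\<close> is the set of lines in \<open>\<complex>\<^sup>3\<close>, with origin \<open>[0:0:1]\<close>.  The blow-down
  \<open>\<P>(B) \<rightarrow> \<P>\<^sup>2\<close> sends the line in \<open>B\<^sub>z\<close> with coordinate \<open>u\<close> to \<open>[1:z:u]\<close>, and the line
  \<open>\<O>(1)\<^sub>z\<close> (i.e. \<open>u = \<infinity>\<close>) to the origin.  At \<open>z = \<infinity>\<close>, where \<open>g = z f\<close> replaces \<open>f\<close>, it
  extends by \<open>\<langle>a e + b g\<rangle> \<mapsto> [0:a:b]\<close>.  The fibre over \<open>z\<close> goes to the line \<open>X\<^sub>1 = z X\<^sub>0\<close>
  through the origin, and the subbundle \<open>\<O>\<close> spanned by \<open>e + (\<beta> + \<gamma>z) f\<close> to the line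
  \<open>X\<^sub>2 = \<beta> X\<^sub>0 + \<gamma> X\<^sub>1\<close>.\<close>

definition blow_down :: "p1 \<Rightarrow> (complex ^ 2) set \<Rightarrow> (complex ^ 3) set" where
  "blow_down x l =
     (\<lambda>v. case x of Pt z \<Rightarrow> vector [v $ 1, z * v $ 1, v $ 2]
                  | Infty \<Rightarrow> vector [0, v $ 1, v $ 2]) ` l"

definition P2_origin :: "(complex ^ 3) set" where
  "P2_origin = vec.span {vector [0, 0, 1]}"

definition P2_collinear :: "(complex ^ 3) set set \<Rightarrow> bool" where
  "P2_collinear S \<longleftrightarrow> (\<exists>W. vec.subspace W \<and> vec.dim W = 2 \<and> (\<forall>p\<in>S. p \<subseteq> W))"

section \<open>The conditions on a quasiparabolic bundle\<close>

definition admits_connection ::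
    "(4 \<Rightarrow> complex) \<Rightarrow> 2 vbundle \<Rightarrow> (4 \<Rightarrow> (complex ^ 2) set) \<Rightarrow> (4 \<Rightarrow> complex) \<Rightarrow> (4 \<Rightarrow> complex) \<Rightarrow> bool"
where
  "admits_connection t E P rp rm \<longleftrightarrow>
     (\<exists>nab. log_connection (range t) E nab \<and>
        (\<forall>i. \<exists>R. has_conn_residue E nab (Pt (t i)) R \<and> induces_on_flag R (P i) (rm i) (rp i)))"

text \<open>The image of the lines \<open>P i\<close> under a bundle map \<open>A\<close>.\<close>

definition transport ::
    "(4 \<Rightarrow> complex) \<Rightarrow> (p1 \<Rightarrow> complex ^ 2 ^ 2) \<Rightarrow> (4 \<Rightarrow> (complex ^ 2) set) \<Rightarrow> 4 \<Rightarrow> (complex ^ 2) set"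
where
  "transport t A P i = (\<lambda>v. A (Pt (t i)) *v v) ` P i"

text \<open>The next two conditions do not depend on the isomorphism \<open>A\<close> of \<open>E\<close> with \<open>B\<close>, because
  automorphisms of \<open>B\<close> preserve \<open>\<O>(1)\<close> and permute the subbundles \<open>\<O>\<close>.  The coordinates
  \<open>u i\<close> are determined by \<open>A\<close> and \<open>P\<close>.\<close>

definition not_in_single_O ::
    "(4 \<Rightarrow> complex) \<Rightarrow> 2 vbundle \<Rightarrow> (4 \<Rightarrow> (complex ^ 2) set) \<Rightarrow> bool" where
  "not_in_single_O t E P \<longleftrightarrow>
     (\<exists>A u. bundle_iso E bundle_B A \<and>
        (\<forall>i. transport t A P i = B_line (Pt (t i)) (u i)) \<and>
        card {i. u i = Infty} \<le> 1 \<and>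
        \<not> (\<exists>L. line_subbundle bundle_B L \<and> subbundle_isomorphic bundle_B L (line_O 0) \<and>
              (\<forall>i. u i \<noteq> Infty \<longrightarrow> transport t A P i \<subseteq> L (Pt (t i)))))"

definition three_noncollinear ::
    "(4 \<Rightarrow> complex) \<Rightarrow> 2 vbundle \<Rightarrow> (4 \<Rightarrow> (complex ^ 2) set) \<Rightarrow> bool" where
  "three_noncollinear t E P \<longleftrightarrow>
     (\<exists>A U. bundle_iso E bundle_B A \<and>
        (\<forall>i. U i = blow_down (Pt (t i)) (transport t A P i)) \<and>
        (\<exists>i j k. U i \<noteq> P2_origin \<and> U j \<noteq> P2_origin \<and> U k \<noteq> P2_origin \<and>
           \<not> P2_collinear {U i, U j, U k}))"

end

theory Submission
  imports Defs "HOL-Computational_Algebra.Fundamental_Theorem_Algebra"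
begin

text \<open>A bundle on \<open>\<P>\<^sup>1\<close> splits as a sum of line bundles \<open>\<O>(m\<^sub>i)\<close>: a frame over a
  chart is extended over the missing points of the affine line by dividing by \<open>z - a\<close> combinations
  of sections vanishing at \<open>a\<close>, and at infinity the transition matrix is brought to column reduced form.
  The degree is \<open>\<Sum> m\<^sub>i\<close>.

  If \<open>E = \<O>(m\<^sub>1) \<oplus> \<O>(m\<^sub>2)\<close> with \<open>m\<^sub>1 < m\<^sub>2\<close> and \<open>m\<^sub>1 + m\<^sub>2 = 1\<close>, a complement of
  \<open>\<O>(m\<^sub>2)\<close> is the graph of a polynomial of degree at most \<open>m\<^sub>2 - m\<^sub>1\<close>, so \<open>(E, P)\<close> is decomposable as
  soon as such a polynomial interpolates the finite coordinates of the \<open>P\<^sub>i\<close>. For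
  \<open>m\<^sub>2 - m\<^sub>1 \<ge> 3\<close> this is always so; for \<open>E = B\<close> its failure is both (4) and (5), and it forces
  endomorphisms to be scalar. Projections show that simple bundles are indecomposable.

  On \<open>B\<close>, a connection with poles in the \<open>t\<^sub>i\<close> and the given residues amounts to a linear system with
  matrix of rows \<open>(1, t\<^sub>i, u\<^sub>i)\<close>, solvable when three of these rows are independent. Conversely, a
  connection on a decomposable bundle induces one on a summand, whose residues
  \<open>r\<^sub>i\<^sup>\<plusminus>\<close> have an integer sum by the residue theorem; this is excluded for nonspecial residues.\<close>

text \<open>The five conditions meet in one predicate, \<open>generic_coordinates\<close>: (4) and
  (5) are each equivalent to it, (2) implies it, it implies (1) and (3), and each of these implies
  (2). The Fuchs relation enters when a connection is built, nonspeciality when one is excluded.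
  Bases of the fibres are chosen without regularity and the atlas is an arbitrary list of charts.
  Hence everything is expressed by matrices \<open>F x\<close> whose columns become regular when
  read in the charts; the behaviour at \<open>Infty\<close> is recorded by integers, through
  \<open>F x ** twist m x\<close>. Since the degree is odd, the two twists differ by an odd number:
  1, which is \<open>B\<close>, or at least 3, where a cubic interpolates at all four nodes. On
  \<open>B\<close> the upper right entry of a connection matrix has to vanish at infinity to one
  order more than the diagonal ones. It gives two of the three linear conditions on the free
  parameters and the upper left entry gives the third; the lower right condition then is the Fuchs
  relation, and the lower left entry is unconstrained.\<close>

no_notation fps_nth (infixl \<open>$\<close> 75)


section \<open>Regular functions\<close>

lemma inj_chart: "c \<in> {aff_0, aff_inf} \<Longrightarrow> inj c"
  by (auto simp: inj_def aff_0_def aff_inf_def split: if_splits)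

lemma finite_compl_range_chart: "c \<in> {aff_0, aff_inf} \<Longrightarrow> finite (- range c)"
proof -
  have "- range aff_0 \<subseteq> {Infty}"
    by (auto simp: aff_0_def image_iff) (metis p1.exhaust)
  moreover have "- range aff_inf \<subseteq> {Pt 0}"
  proof
    fix x assume x: "x \<in> - range aff_inf"
    show "x \<in> {Pt 0}"
    proof (cases x)
      case (Pt z)
      have "z = 0"
      proof (rule ccontr)
        assume "z \<noteq> 0"
        then have "x = aff_inf (1 / z)" by (simp add: aff_inf_def Pt)
        with x show False by blast
      qed
      with Pt show ?thesis by simp
    next
      case Infty
      then have "x = aff_inf 0" by (simp add: aff_inf_def)
      with x show ?thesis by blast
    qed
  qed
  ultimately show "c \<in> {aff_0, aff_inf} \<Longrightarrow> finite (- range c)"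
    by (auto intro: finite_subset)
qed

lemma zariski_open_Int: "zariski_open U \<Longrightarrow> zariski_open V \<Longrightarrow> zariski_open (U \<inter> V)"
  by (auto simp: zariski_open_def)

lemma zariski_open_cofinite: "finite S \<Longrightarrow> zariski_open (- S)"
  by (simp add: zariski_open_def)

lemma zariski_open_UNIV [simp]: "zariski_open UNIV"
  by (simp add: zariski_open_def)

lemma finite_poly_zero: "poly q a \<noteq> (0::complex) \<Longrightarrow> finite {w. poly q w = 0}"
  by (metis poly_0 poly_roots_finite)

lemma zariski_open_chart_nonzero:
  assumes "c \<in> {aff_0, aff_inf}" "poly q a \<noteq> 0"
  shows "zariski_open (c ` {w. poly q w \<noteq> 0})"
proof -
  have "- c ` {w. poly q w \<noteq> 0} \<subseteq> (- range c) \<union> c ` {w. poly q w = 0}" by auto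
  with finite_compl_range_chart[OF assms(1)] finite_poly_zero[OF assms(2)] show ?thesis
    unfolding zariski_open_def by (metis finite_UnI finite_imageI finite_subset)
qed

lemma regular_on_subset: "regular_on U f \<Longrightarrow> V \<subseteq> U \<Longrightarrow> regular_on V f"
  unfolding regular_on_def by (meson subsetD)

lemma regular_on_cong: "(\<And>x. x \<in> U \<Longrightarrow> f x = g x) \<Longrightarrow> regular_on U f = regular_on U g"
  unfolding regular_on_def by (intro ball_cong all_cong imp_cong ex_cong refl) metis

text \<open>A fraction valid on \<open>U \<inter> V\<close> becomes valid on \<open>U\<close> when
  numerator and denominator are multiplied by a polynomial whose zeros are the finitely many chart
  points outside \<open>V\<close>: the new denominator excludes them.\<close>

lemma regular_on_local:
  assumes "\<And>x. x \<in> U \<Longrightarrow> \<exists>V. zariski_open V \<and> x \<in> V \<and> regular_on (U \<inter> V) f"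
  shows "regular_on U f"
  unfolding regular_on_def
proof (intro ballI allI impI)
  fix c a assume c: "c \<in> {aff_0, aff_inf}" and a: "c a \<in> U"
  obtain V where V: "zariski_open V" "c a \<in> V" "regular_on (U \<inter> V) f"
    using assms[OF a] by blast
  then obtain p q where pq: "poly q a \<noteq> 0"
      "\<And>w. c w \<in> U \<inter> V \<Longrightarrow> poly q w \<noteq> 0 \<Longrightarrow> f (c w) = poly p w / poly q w"
    using c a unfolding regular_on_def by blast
  define S where "S = {w. c w \<notin> V}"
  have "finite (- V)" using V unfolding zariski_open_def by auto
  moreover have "S = c -` (- V)" by (auto simp: S_def)
  ultimately have S: "finite S" using finite_vimageI[OF _ inj_chart[OF c]] by auto
  define r where "r = (\<Prod>s\<in>S. [:-s, 1:])"
  have r: "poly r w = 0 \<longleftrightarrow> w \<in> S" for w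
    using S by (auto simp: r_def poly_prod)
  show "\<exists>p q. poly q a \<noteq> 0 \<and>
           (\<forall>w. c w \<in> U \<and> poly q w \<noteq> 0 \<longrightarrow> f (c w) = poly p w / poly q w)"
  proof (intro exI conjI allI impI)
    show "poly (q * r) a \<noteq> 0" using pq V r by (simp add: S_def)
    fix w assume w: "c w \<in> U \<and> poly (q * r) w \<noteq> 0"
    then have "c w \<in> U \<inter> V" using r[of w] by (simp add: S_def)
    then show "f (c w) = poly (p * r) w / poly (q * r) w" using pq(2)[of w] w by simp
  qed
qed

lemma regular_on_const [intro!, simp]: "regular_on U (\<lambda>_. k)"
  unfolding regular_on_def
  by (intro ballI allI impI exI[of _ "[:k:]"] exI[of _ 1]) simp

lemma regular_on_add [intro]:
  assumes "regular_on U f" "regular_on U g"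
  shows "regular_on U (\<lambda>x. f x + g x)"
  unfolding regular_on_def
proof (intro ballI allI impI)
  fix c a assume c: "c \<in> {aff_0, aff_inf}" and a: "c a \<in> U"
  obtain p q where pq: "poly q a \<noteq> 0"
      "\<And>w. c w \<in> U \<Longrightarrow> poly q w \<noteq> 0 \<Longrightarrow> f (c w) = poly p w / poly q w"
    using assms(1) c a unfolding regular_on_def by blast
  obtain r s where rs: "poly s a \<noteq> 0"
      "\<And>w. c w \<in> U \<Longrightarrow> poly s w \<noteq> 0 \<Longrightarrow> g (c w) = poly r w / poly s w"
    using assms(2) c a unfolding regular_on_def by blast
  show "\<exists>p q. poly q a \<noteq> 0 \<and>
           (\<forall>w. c w \<in> U \<and> poly q w \<noteq> 0 \<longrightarrow> f (c w) + g (c w) = poly p w / poly q w)"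
    using pq rs
    by (intro exI[of _ "p * s + r * q"] exI[of _ "q * s"]) (auto simp: add_frac_eq)
qed

lemma regular_on_mult [intro]:
  assumes "regular_on U f" "regular_on U g"
  shows "regular_on U (\<lambda>x. f x * g x)"
  unfolding regular_on_def
proof (intro ballI allI impI)
  fix c a assume c: "c \<in> {aff_0, aff_inf}" and a: "c a \<in> U"
  obtain p q where pq: "poly q a \<noteq> 0"
      "\<And>w. c w \<in> U \<Longrightarrow> poly q w \<noteq> 0 \<Longrightarrow> f (c w) = poly p w / poly q w"
    using assms(1) c a unfolding regular_on_def by blast
  obtain r s where rs: "poly s a \<noteq> 0"
      "\<And>w. c w \<in> U \<Longrightarrow> poly s w \<noteq> 0 \<Longrightarrow> g (c w) = poly r w / poly s w"
    using assms(2) c a unfolding regular_on_def by blast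
  show "\<exists>p q. poly q a \<noteq> 0 \<and>
           (\<forall>w. c w \<in> U \<and> poly q w \<noteq> 0 \<longrightarrow> f (c w) * g (c w) = poly p w / poly q w)"
    using pq rs
    by (intro exI[of _ "p * r"] exI[of _ "q * s"]) auto
qed

lemma regular_on_inverse [intro]:
  assumes "regular_on U f" "\<And>x. x \<in> U \<Longrightarrow> f x \<noteq> 0"
  shows "regular_on U (\<lambda>x. inverse (f x))"
  unfolding regular_on_def
proof (intro ballI allI impI)
  fix c a assume c: "c \<in> {aff_0, aff_inf}" and a: "c a \<in> U"
  obtain p q where pq: "poly q a \<noteq> 0"
      "\<And>w. c w \<in> U \<Longrightarrow> poly q w \<noteq> 0 \<Longrightarrow> f (c w) = poly p w / poly q w"
    using assms(1) c a unfolding regular_on_def by blast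
  show "\<exists>p q. poly q a \<noteq> 0 \<and>
           (\<forall>w. c w \<in> U \<and> poly q w \<noteq> 0 \<longrightarrow> inverse (f (c w)) = poly p w / poly q w)"
    \<comment> \<open>The common factor \<open>q\<close> is kept so that a nonzero denominator
      \<open>p * q\<close> still guarantees \<open>q\<close> nonzero, which the formula for
      \<open>f\<close> requires.\<close>
    using pq assms(2)[OF a] a
    by (intro exI[of _ "q * q"] exI[of _ "p * q"]) auto
qed

lemma regular_on_minus [intro]: "regular_on U f \<Longrightarrow> regular_on U (\<lambda>x. - f x)"
  using regular_on_mult[OF regular_on_const[of U "-1"]] by simp

lemma regular_on_diff [intro]:
  "regular_on U f \<Longrightarrow> regular_on U g \<Longrightarrow> regular_on U (\<lambda>x. f x - g x)"
  using regular_on_add[OF _ regular_on_minus] by simp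

lemma regular_on_divide [intro]:
  "regular_on U f \<Longrightarrow> regular_on U g \<Longrightarrow> (\<And>x. x \<in> U \<Longrightarrow> g x \<noteq> 0) \<Longrightarrow> regular_on U (\<lambda>x. f x / g x)"
  using regular_on_mult[OF _ regular_on_inverse] by (simp add: divide_inverse)

lemma regular_on_if [intro]:
  "regular_on U f \<Longrightarrow> regular_on U g \<Longrightarrow> regular_on U (\<lambda>x. if b then f x else g x)"
  by (cases b) auto

lemma regular_on_sum [intro]:
  "(\<And>i. i \<in> I \<Longrightarrow> regular_on U (f i)) \<Longrightarrow> regular_on U (\<lambda>x. \<Sum>i\<in>I. f i x)"
  by (induction I rule: infinite_finite_induct) auto

lemma regular_on_prod [intro]:
  "(\<And>i. i \<in> I \<Longrightarrow> regular_on U (f i)) \<Longrightarrow> regular_on U (\<lambda>x. \<Prod>i\<in>I. f i x)"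
  by (induction I rule: infinite_finite_induct) auto

lemma regular_on_power [intro]: "regular_on U f \<Longrightarrow> regular_on U (\<lambda>x. f x ^ n)"
  by (induction n) auto

lemma regular_on_powi [intro]:
  assumes "regular_on U f" "\<And>x. x \<in> U \<Longrightarrow> f x \<noteq> 0"
  shows "regular_on U (\<lambda>x. f x powi k)"
proof (cases "k \<ge> 0")
  case True
  with regular_on_power[OF assms(1)] show ?thesis by (simp add: power_int_def)
next
  case False
  with regular_on_power[OF regular_on_inverse[OF assms]] show ?thesis by (simp add: power_int_def)
qed

lemma regular_on_poly [intro]: "regular_on U f \<Longrightarrow> regular_on U (\<lambda>x. poly p (f x))"
  by (induction p) (auto simp: )

text \<open>The coordinates \<open>z\<close> and \<open>w = 1/z\<close>; the values at their poles are junk.\<close>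

definition coord_0 :: "p1 \<Rightarrow> complex" where
  "coord_0 x = (case x of Pt z \<Rightarrow> z | Infty \<Rightarrow> 0)"

definition coord_inf :: "p1 \<Rightarrow> complex" where
  "coord_inf x = inverse (coord_0 x)"

lemma coord_0_simps [simp]: "coord_0 (Pt z) = z" "coord_0 Infty = 0"
  by (simp_all add: coord_0_def)

lemma coord_inf_simps [simp]: "coord_inf (Pt z) = inverse z" "coord_inf Infty = 0"
  by (simp_all add: coord_inf_def)

lemma regular_on_coord_0: "Infty \<notin> U \<Longrightarrow> regular_on U coord_0"
  unfolding regular_on_def
proof (intro ballI allI impI)
  fix c a assume *: "c \<in> {aff_0, aff_inf}" "c a \<in> U" "Infty \<notin> U"
  show "\<exists>p q. poly q a \<noteq> 0 \<and>
           (\<forall>w. c w \<in> U \<and> poly q w \<noteq> 0 \<longrightarrow> coord_0 (c w) = poly p w / poly q w)"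
  proof (cases "c = aff_0")
    case True
    show ?thesis
      by (intro exI[of _ "[:0,1:]"] exI[of _ 1]) (simp add: True aff_0_def)
  next
    case False
    then have c: "c = aff_inf" using * by auto
    show ?thesis using *
      by (intro exI[of _ 1] exI[of _ "[:0,1:]"]) (auto simp: c aff_inf_def split: if_splits)
  qed
qed

lemma regular_on_coord_inf: "Pt 0 \<notin> U \<Longrightarrow> regular_on U coord_inf"
  unfolding regular_on_def
proof (intro ballI allI impI)
  fix c a assume *: "c \<in> {aff_0, aff_inf}" "c a \<in> U" "Pt 0 \<notin> U"
  show "\<exists>p q. poly q a \<noteq> 0 \<and>
           (\<forall>w. c w \<in> U \<and> poly q w \<noteq> 0 \<longrightarrow> coord_inf (c w) = poly p w / poly q w)"
  proof (cases "c = aff_inf")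
    case True
    show ?thesis
      by (intro exI[of _ "[:0,1:]"] exI[of _ 1]) (simp add: True aff_inf_def)
  next
    case False
    then have c: "c = aff_0" using * by auto
    show ?thesis using *
      by (intro exI[of _ 1] exI[of _ "[:0,1:]"]) (auto simp: c aff_0_def divide_inverse)
  qed
qed

lemma coord_0_aff_0: "coord_0 (aff_0 z) = z"
  by (simp add: aff_0_def)

lemma coord_inf_aff_inf: "coord_inf (aff_inf w) = w"
  by (simp add: aff_inf_def)

text \<open>Regularity asks for a fraction in every chart through a point; one chart is enough,
  because the fraction can be composed with the coordinate function of that chart, which is itself
  regular in both charts.\<close>

lemma regular_on_chartI:
  assumes "\<And>x. x \<in> U \<Longrightarrow> \<exists>c\<in>{aff_0, aff_inf}. \<exists>a p q. x = c a \<and> poly q a \<noteq> 0 \<and>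
             (\<forall>w. c w \<in> U \<and> poly q w \<noteq> 0 \<longrightarrow> f (c w) = poly p w / poly q w)"
  shows "regular_on U f"
proof (rule regular_on_local)
  fix x assume "x \<in> U"
  then obtain c a p q where c: "c \<in> {aff_0, aff_inf}" and q: "x = c a" "poly q a \<noteq> 0"
    and f: "\<forall>w. c w \<in> U \<and> poly q w \<noteq> 0 \<longrightarrow> f (c w) = poly p w / poly q w"
    using assms[OF \<open>x \<in> U\<close>] by (elim bexE exE conjE) metis
  define V where "V = c ` {w. poly q w \<noteq> 0}"
  define h where h: "h = (if c = aff_0 then coord_0 else coord_inf)"
  have hc: "h (c w) = w" for w
    using c by (auto simp: h coord_0_aff_0 coord_inf_aff_inf)
  have n0: "Infty \<notin> range aff_0" "Pt 0 \<notin> range aff_inf"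
    by (auto simp: aff_0_def aff_inf_def split: if_splits)
  have V: "V \<subseteq> range c" by (auto simp: V_def)
  have "regular_on V h"
  proof (cases "c = aff_0")
    case True
    with V n0 show ?thesis by (auto simp: h intro!: regular_on_coord_0)
  next
    case False
    with c have "c = aff_inf" by simp
    with V n0 False show ?thesis by (auto simp: h intro!: regular_on_coord_inf)
  qed
  moreover have "poly q (h y) \<noteq> 0" if "y \<in> V" for y
    using that by (auto simp: V_def hc)
  ultimately have "regular_on V (\<lambda>y. poly p (h y) / poly q (h y))"
    by (intro regular_on_divide regular_on_poly) auto
  then have "regular_on (U \<inter> V) (\<lambda>y. poly p (h y) / poly q (h y))"
    by (rule regular_on_subset) auto
  also have "?this \<longleftrightarrow> regular_on (U \<inter> V) f"
    by (rule regular_on_cong) (auto simp: V_def hc f)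
  finally show "\<exists>V. zariski_open V \<and> x \<in> V \<and> regular_on (U \<inter> V) f"
    using zariski_open_chart_nonzero[OF c q(2)] q
    by (intro exI[of _ V]) (auto simp: V_def)
qed

lemma regular_on_nonzero_nhd:
  assumes "regular_on U f" "zariski_open U" "x \<in> U" "f x \<noteq> 0"
  obtains V where "zariski_open V" "x \<in> V" "V \<subseteq> U" "\<And>y. y \<in> V \<Longrightarrow> f y \<noteq> 0"
proof -
  obtain c a where c: "c \<in> {aff_0, aff_inf}" "x = c a"
    by (metis aff_0_def aff_inf_def insertI1 insertI2 p1.exhaust)
  then obtain p q where pq: "poly q a \<noteq> 0"
      "\<And>w. c w \<in> U \<Longrightarrow> poly q w \<noteq> 0 \<Longrightarrow> f (c w) = poly p w / poly q w"
    using assms unfolding regular_on_def by blast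
  have pa: "poly (p * q) a \<noteq> 0" using assms pq c by auto
  show ?thesis
  proof (rule that)
    show "zariski_open (U \<inter> c ` {w. poly (p * q) w \<noteq> 0})"
      by (rule zariski_open_Int[OF assms(2) zariski_open_chart_nonzero[OF c(1) pa]])
    show "x \<in> U \<inter> c ` {w. poly (p * q) w \<noteq> 0}" using assms(3) pa unfolding c(2) by blast
  qed (use pq in auto)
qed

section \<open>Global fractions, polynomials on the affine line, and the order at infinity\<close>

lemma poly_eq_cofinite:
  assumes "finite (- {z. poly p z = poly (q :: complex poly) z})"
  shows "p = q"
proof (rule ccontr)
  assume "p \<noteq> q"
  then have "finite {z. poly (p - q) z = 0}" using poly_roots_finite[of "p - q"] by auto
  then have "finite ({z. poly (p - q) z = 0} \<union> - {z. poly p z = poly q z})" using assms by blast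
  moreover have "{z. poly (p - q) z = 0} \<union> - {z. poly p z = poly q z} = UNIV" by auto
  ultimately show False using infinite_UNIV_char_0[where 'a=complex] by auto
qed

lemma finite_compl_Pt: "zariski_open U \<Longrightarrow> U \<noteq> {} \<Longrightarrow> finite (- {z. Pt z \<in> U})"
proof -
  assume "zariski_open U" "U \<noteq> {}"
  then have "finite (- U)" by (simp add: zariski_open_def)
  moreover have "- {z. Pt z \<in> U} = Pt -` (- U)" by auto
  moreover have "inj Pt" by (auto simp: inj_def)
  ultimately show ?thesis by (metis finite_vimageI)
qed

lemma infinite_Pt: "zariski_open U \<Longrightarrow> U \<noteq> {} \<Longrightarrow> \<exists>z. Pt z \<in> U"
  using finite_compl_Pt[of U] infinite_UNIV_char_0[where 'a=complex] by fastforce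

text \<open>Among all representations of \<open>f\<close> as a fraction, one with denominator of minimal degree has no
  common zeros, and then the denominator does not vanish anywhere on \<open>U\<close>.\<close>

lemma regular_on_fraction:
  assumes "regular_on U f" "zariski_open U" "U \<noteq> {}"
  obtains p q where "q \<noteq> 0" "\<And>z. Pt z \<in> U \<Longrightarrow> poly q z \<noteq> 0 \<and> f (Pt z) = poly p z / poly q z"
proof -
  have loc: "\<exists>p q. poly q a \<noteq> 0 \<and>
      (\<forall>w. Pt w \<in> U \<and> poly q w \<noteq> 0 \<longrightarrow> f (Pt w) = poly p w / poly q w)" if "Pt a \<in> U" for a
  proof -
    have "aff_0 \<in> {aff_0, aff_inf}" "aff_0 a \<in> U" using that by (simp_all add: aff_0_def)
    with assms(1) show ?thesis unfolding regular_on_def aff_0_def by meson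
  qed
  \<comment> \<open>Denominators of fractions that represent \<open>f\<close> at all but finitely
    many points; asking for this only generically makes the set closed under cancelling common
    factors.\<close>
  define R where "R q \<longleftrightarrow> q \<noteq> 0 \<and> (\<exists>p. finite (- {z. poly q z \<noteq> 0 \<and> f (Pt z) = poly p z / poly q z}))" for q
  have cof: "finite (- {z. poly q z \<noteq> 0 \<and> f (Pt z) = poly p z / poly q z})"
    if "poly q a \<noteq> 0" "\<forall>w. Pt w \<in> U \<and> poly q w \<noteq> 0 \<longrightarrow> f (Pt w) = poly p w / poly q w" for p q a
    by (rule finite_subset[of _ "- {z. Pt z \<in> U} \<union> {z. poly q z = 0}"])
      (use that finite_compl_Pt[OF assms(2,3)] finite_poly_zero in auto)
  obtain a where "Pt a \<in> U" using infinite_Pt[OF assms(2,3)] by blast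
  with loc obtain p0 q0 where "poly q0 a \<noteq> 0"
     "\<forall>w. Pt w \<in> U \<and> poly q0 w \<noteq> 0 \<longrightarrow> f (Pt w) = poly p0 w / poly q0 w" by blast
  then have "R q0" unfolding R_def using cof by fastforce
  then obtain q where "R q" and min: "\<And>q'. R q' \<Longrightarrow> degree q \<le> degree q'"
    using ex_has_least_nat[of R q0 degree] by blast
  then obtain p where q: "q \<noteq> 0" and pq: "finite (- {z. poly q z \<noteq> 0 \<and> f (Pt z) = poly p z / poly q z})"
    unfolding R_def by blast
  show ?thesis
  proof (rule that[of q p])
    show "q \<noteq> 0" by fact
    fix a assume "Pt a \<in> U"
    then obtain r s where rs: "poly s a \<noteq> 0"
       "\<forall>w. Pt w \<in> U \<and> poly s w \<noteq> 0 \<longrightarrow> f (Pt w) = poly r w / poly s w" using loc by blast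
    have "r * q = p * s"
    proof (rule poly_eq_cofinite)
      show "finite (- {z. poly (r * q) z = poly (p * s) z})"
        by (rule finite_subset[OF _ finite_UnI[OF cof[OF rs] pq]]) (auto simp: field_simps)
    qed
    then have eq: "poly r z * poly q z = poly p z * poly s z" for z
      by (metis poly_mult)
    \<comment> \<open>A zero of \<open>q\<close> at \<open>a\<close> would be a zero of
      \<open>p\<close> too, since the local denominator \<open>s\<close> does not vanish there, and
      cancelling \<open>z - a\<close> would contradict minimality.\<close>
    have qa: "poly q a \<noteq> 0"
    proof
      assume q0: "poly q a = 0"
      then have "poly p a = 0" using eq[of a] rs by auto
      with q0 obtain p' q' where pq': "p = [:-a, 1:] * p'" "q = [:-a, 1:] * q'"
        by (metis dvdE poly_eq_0_iff_dvd)
      have "R q'"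
        unfolding R_def
      proof (intro conjI exI)
        show "finite (- {z. poly q' z \<noteq> 0 \<and> f (Pt z) = poly p' z / poly q' z})"
          by (rule finite_subset[of _ "- {z. poly q z \<noteq> 0 \<and> f (Pt z) = poly p z / poly q z}"])
            (use pq in \<open>auto simp: pq' simp del: mult_pCons_left\<close>)
      qed (use q pq' in auto)
      moreover have "q' \<noteq> 0" using q pq' by auto
      then have "degree q = Suc (degree q')" unfolding pq' by (subst degree_mult_eq) auto
      ultimately show False using min[of q'] by simp
    qed
    moreover have "f (Pt a) = poly p a / poly q a"
      using rs eq[of a] qa \<open>Pt a \<in> U\<close> by (simp add: frac_eq_eq mult.commute)
    ultimately show "poly q a \<noteq> 0 \<and> f (Pt a) = poly p a / poly q a" by simp
  qed
qed

text \<open>The denominator of a global fraction has no zero on the affine line, so it is constant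
  by the fundamental theorem of algebra.\<close>

lemma regular_on_affine:
  assumes "regular_on (- {Infty}) f"
  obtains p where "\<And>z. f (Pt z) = poly p z"
proof -
  have "- {Infty} \<noteq> {}" using p1.distinct by blast
  then obtain p q where pq: "q \<noteq> 0" "\<And>z. poly q z \<noteq> 0 \<and> f (Pt z) = poly p z / poly q z"
    using regular_on_fraction[OF assms] zariski_open_cofinite[of "{Infty}"]
    by (metis ComplI finite.emptyI finite_insert p1.distinct(1) singletonD)
  then have "degree q = 0"
    using fundamental_theorem_of_algebra[of q] constant_degree pq(2) by blast
  then obtain k where k: "q = [:k:]" by (metis degree_eq_zeroE)
  show ?thesis
    by (rule that[of "smult (inverse k) p"]) (use pq in \<open>simp add: k divide_inverse mult.commute\<close>)
qed

lemma poly_reflect_inverse: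
  "w \<noteq> 0 \<Longrightarrow> poly p (inverse w) * w ^ degree p = poly (reflect_poly p) (w::complex)"
  by (simp add: poly_reflect_poly_nz mult.commute)

text \<open>In the coordinate \<open>w = 1/z\<close> the fraction reads
  \<open>reflect_poly p * w ^ degree q\<close> over \<open>reflect_poly q * w ^ degree p\<close>.
  Reflected polynomials take the leading coefficients as values at 0, so comparison with a local
  fraction \<open>r / s\<close> at \<open>w = 0\<close> gives both the degree bound and the
  value.\<close>

lemma regular_at_Infty_fraction:
  assumes "regular_on U f" "zariski_open U" "Infty \<in> U" "q \<noteq> 0"
    and f: "\<And>z. Pt z \<in> U \<Longrightarrow> poly q z \<noteq> 0 \<Longrightarrow> f (Pt z) = poly p z / poly q z"
  shows "degree p \<le> degree q" "f Infty = coeff p (degree q) / lead_coeff q"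
proof -
  have "aff_inf \<in> {aff_0, aff_inf}" "aff_inf 0 \<in> U" using assms by (simp_all add: aff_inf_def)
  then obtain r s where rs: "poly s 0 \<noteq> 0"
     "\<And>w. aff_inf w \<in> U \<Longrightarrow> poly s w \<noteq> 0 \<Longrightarrow> f (aff_inf w) = poly r w / poly s w"
    using assms(1) unfolding regular_on_def by meson
  let ?m = "degree p" and ?n = "degree q"
  have eq: "reflect_poly p * monom 1 ?n * s = r * monom 1 ?m * reflect_poly q"
  proof (rule poly_eq_cofinite, rule finite_subset)
    let ?S = "insert 0 (aff_inf -` (- U)) \<union> {w. poly s w = 0} \<union> {w. poly (reflect_poly q) w = 0}"
    have "finite (- U)" using assms by (auto simp: zariski_open_def)
    then have "finite (aff_inf -` (- U))"
      by (rule finite_vimageI) (simp add: inj_chart)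
    moreover have "finite {w. poly (reflect_poly q) w = 0}"
      using assms(4) by (intro poly_roots_finite) auto
    ultimately show "finite ?S" using finite_poly_zero[OF rs(1)] by blast
    show "- {z. poly (reflect_poly p * monom 1 ?n * s) z = poly (r * monom 1 ?m * reflect_poly q) z} \<subseteq> ?S"
    proof
      fix w assume w: "w \<in> - {z. poly (reflect_poly p * monom 1 ?n * s) z = poly (r * monom 1 ?m * reflect_poly q) z}"
      show "w \<in> ?S"
      proof (rule ccontr)
        assume n: "w \<notin> ?S"
        then have w0: "w \<noteq> 0" and U: "Pt (inverse w) \<in> U" and s: "poly s w \<noteq> 0" and q: "poly (reflect_poly q) w \<noteq> 0"
          by (auto simp: aff_inf_def divide_inverse)
        have q': "poly q (inverse w) \<noteq> 0" using q w0 by (simp add: poly_reflect_poly_nz)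
        have "poly p (inverse w) / poly q (inverse w) = poly r w / poly s w"
          using rs(2)[of w] f[OF U q'] w0 s U by (simp add: aff_inf_def divide_inverse)
        then have "poly p (inverse w) * poly s w = poly r w * poly q (inverse w)"
          using q' s by (simp add: field_simps)
        then have "(poly p (inverse w) * w ^ ?m) * w ^ ?n * poly s w = poly r w * w ^ ?m * (poly q (inverse w) * w ^ ?n)"
          by (simp add: algebra_simps)
        with w w0 show False
          by (simp add: poly_monom poly_reflect_inverse)
      qed
    qed
  qed
  show "?m \<le> ?n"
  proof (rule ccontr)
    assume "\<not> ?m \<le> ?n"
    then obtain k where k: "?m = ?n + Suc k" by (metis add_Suc_right less_imp_Suc_add not_le)
    have "monom 1 ?m = monom 1 ?n * (monom 1 (Suc k) :: complex poly)"
      by (simp add: k mult_monom)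
    then have "monom 1 ?n * (reflect_poly p * s) = monom 1 ?n * (r * monom 1 (Suc k) * reflect_poly q)"
      using eq by (simp only: ac_simps)
    then have "reflect_poly p * s = r * monom 1 (Suc k) * reflect_poly q"
      by (metis mult_left_cancel monom_eq_0_iff zero_neq_one)
    then have "poly (reflect_poly p * s) 0 = 0" by (simp add: poly_monom)
    then have "p = 0" using rs by auto
    with k show False by simp
  qed
  then obtain k where k: "?n = ?m + k" using le_Suc_ex by blast
  have "monom 1 ?n = monom 1 ?m * (monom 1 k :: complex poly)"
    by (simp add: k mult_monom)
  then have "monom 1 ?m * (reflect_poly p * monom 1 k * s) = monom 1 ?m * (r * reflect_poly q)"
    using eq by (simp only: ac_simps)
  then have "reflect_poly p * monom 1 k * s = r * reflect_poly q"
    by (metis mult_left_cancel monom_eq_0_iff zero_neq_one)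
  then have "poly (reflect_poly p * monom 1 k * s) 0 = poly (r * reflect_poly q) 0" by simp
  then have e: "lead_coeff p * 0 ^ k * poly s 0 = poly r 0 * lead_coeff q"
    by (simp add: poly_monom)
  \<comment> \<open>Both sides are 0 unless the degrees agree, in which case
    \<open>0 ^ 0 = 1\<close>.\<close>
  have "lead_coeff p * 0 ^ k = coeff p ?n"
    using k by (cases "k = 0") (auto simp: coeff_eq_0)
  moreover have "f Infty = poly r 0 / poly s 0"
    using rs assms(3) by (metis aff_inf_def)
  ultimately show "f Infty = coeff p ?n / lead_coeff q"
    using e rs(1) assms(4) by (simp add: frac_eq_eq mult.commute)
qed

section \<open>Regular matrices and frames\<close>

lemma matrix_inv_right: "invertible (A :: 'a::field^'n^'n) \<Longrightarrow> A ** matrix_inv A = mat 1"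
  and matrix_inv_left: "invertible (A :: 'a::field^'n^'n) \<Longrightarrow> matrix_inv A ** A = mat 1"
proof -
  assume "invertible A"
  then have "A ** matrix_inv A = mat 1 \<and> matrix_inv A ** A = mat 1"
    unfolding invertible_def matrix_inv_def by (rule someI_ex)
  then show "A ** matrix_inv A = mat 1" "matrix_inv A ** A = mat 1" by auto
qed

lemma matrix_inv_unique:
  fixes A :: "'a::field^'n^'n"
  assumes "A ** B = mat 1"
  shows "matrix_inv A = B"
proof -
  have "invertible A" using assms invertible_right_inverse by blast
  then have "matrix_inv A ** (A ** B) = B" by (simp add: matrix_mul_assoc matrix_inv_left)
  then show ?thesis by (simp add: assms)
qed

lemma invertible_matrix_inv: "invertible (A :: 'a::field^'n^'n) \<Longrightarrow> invertible (matrix_inv A)"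
  unfolding invertible_def using matrix_inv_right matrix_inv_left invertible_def by blast

lemma matrix_inv_matrix_inv: "invertible (A :: 'a::field^'n^'n) \<Longrightarrow> matrix_inv (matrix_inv A) = A"
  by (intro matrix_inv_unique matrix_inv_left)

lemma matrix_inv_mult:
  fixes A B :: "'a::field^'n^'n"
  assumes "invertible A" "invertible B"
  shows "matrix_inv (A ** B) = matrix_inv B ** matrix_inv A"
proof (rule matrix_inv_unique)
  have "(A ** B) ** (matrix_inv B ** matrix_inv A) = A ** (B ** matrix_inv B) ** matrix_inv A"
    by (simp only: matrix_mul_assoc)
  then show "(A ** B) ** (matrix_inv B ** matrix_inv A) = mat 1"
    by (simp add: assms matrix_inv_right)
qed

lemma matrix_inv_cancel:
  fixes A :: "'a::field^'n^'n"
  assumes "invertible A"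
  shows "A ** (matrix_inv A ** B) = B" "matrix_inv A ** (A ** B) = B"
  by (simp_all add: matrix_mul_assoc matrix_inv_left matrix_inv_right assms)

lemma matrix_inv_cancel_vec:
  fixes A :: "'a::field^'n^'n"
  assumes "invertible A"
  shows "A *v (matrix_inv A *v v) = v" "matrix_inv A *v (A *v v) = v"
  by (simp_all add: matrix_vector_mul_assoc matrix_inv_left matrix_inv_right assms)

lemma mat_mult_nth: "(mat c ** A) $ i $ j = c * (A $ i $ j)" for A :: "'a::semiring_1^'m^'n"
  by (simp add: matrix_matrix_mult_def mat_def if_distrib if_distribR cong: if_cong)

lemma mult_mat_nth: "(A ** mat c) $ i $ j = A $ i $ j * c" for A :: "'a::semiring_1^'m^'n"
  by (simp add: matrix_matrix_mult_def mat_def if_distrib if_distribR cong: if_cong)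

lemma mat_commute: "A ** mat c = mat c ** A" for A :: "'a::comm_semiring_1^'m^'n"
  by (simp add: vec_eq_iff mat_mult_nth mult_mat_nth mult.commute)

lemma mat_mult_vec: "mat c *v v = c *s v" for v :: "'a::semiring_1^'n"
  by (simp add: matrix_vector_mult_def mat_def vec_eq_iff if_distrib if_distribR cong: if_cong)

lemma mat_mult_mat: "mat c ** mat d = mat (c * d)" for c :: "'a::semiring_1"
  by (simp add: vec_eq_iff mat_mult_nth) (simp add: mat_def)

lemma invertible_mat: "c \<noteq> 0 \<Longrightarrow> invertible (mat (c::'a::field) :: 'a^'n^'n)"
  unfolding invertible_def by (intro exI[of _ "mat (inverse c)"]) (simp add: mat_mult_mat)

lemma matrix_mult_diagonal_nth:
  fixes A :: "'a::comm_ring_1^'n^'m"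
  shows "(A ** (\<chi> i j. if i = j then d i else 0)) $ i $ j = A $ i $ j * d j"
  by (simp add: matrix_matrix_mult_def if_distrib if_distribR cong: if_cong)

lemma matrix_diagonal_mult_nth:
  fixes A :: "'a::comm_ring_1^'n^'m"
  shows "((\<chi> i j. if i = j then d i else 0) ** A) $ i $ j = d i * A $ i $ j"
  by (simp add: matrix_matrix_mult_def if_distrib if_distribR cong: if_cong)

lemma matrix_diagonal_mult_vec:
  "((\<chi> i j. if i = j then d i else 0) *v (v::'a::comm_ring_1^'n)) $ i = d i * v $ i"
  by (simp add: matrix_vector_mult_def if_distrib if_distribR cong: if_cong)

lemma invertible_diagonal:
  assumes "\<And>i. d i \<noteq> (0::'a::field)"
  shows "invertible ((\<chi> i j. if i = j then d i else 0) :: 'a^'n^'n)"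
  unfolding invertible_det_nz by (subst det_diagonal) (auto simp: assms)

lemma matrix_inv_diagonal:
  assumes "\<And>i. d i \<noteq> (0::'a::field)"
  shows "matrix_inv ((\<chi> i j. if i = j then d i else 0) :: 'a^'n^'n) = (\<chi> i j. if i = j then inverse (d i) else 0)"
  by (rule matrix_inv_unique) (simp add: vec_eq_iff matrix_mult_diagonal_nth mat_def assms)

lemma kernel_of_singular:
  fixes A :: "'a::field^'n^'n"
  assumes "det A = 0"
  obtains c where "c \<noteq> 0" "A *v c = 0"
  using assms invertible_det_nz[of A] invertible_left_inverse[of A] matrix_left_invertible_ker[of A]
  by blast

section \<open>Regular families of matrices and vectors\<close>

lemma regular_mat_on_subset: "regular_mat_on U A \<Longrightarrow> V \<subseteq> U \<Longrightarrow> regular_mat_on V A"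
  by (auto simp: regular_mat_on_def intro: regular_on_subset)

lemma regular_mat_on_cong:
  assumes "\<And>x. x \<in> U \<Longrightarrow> A x = B x"
  shows "regular_mat_on U A \<longleftrightarrow> regular_mat_on U B"
  unfolding regular_mat_on_def by (intro all_cong1 regular_on_cong) (simp add: assms)

lemma regular_mat_on_local:
  assumes "\<And>x. x \<in> U \<Longrightarrow> \<exists>V. zariski_open V \<and> x \<in> V \<and> regular_mat_on (U \<inter> V) A"
  shows "regular_mat_on U A"
  unfolding regular_mat_on_def
  by (intro allI regular_on_local) (use assms regular_mat_on_def in blast)

lemma regular_mat_on_mult [intro]:
  "regular_mat_on U A \<Longrightarrow> regular_mat_on U B \<Longrightarrow> regular_mat_on U (\<lambda>x. A x ** B x)"
  unfolding regular_mat_on_def matrix_matrix_mult_def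
  by (simp add: regular_on_sum regular_on_mult)

lemma regular_mat_on_const [intro!, simp]: "regular_mat_on U (\<lambda>_. A)"
  unfolding regular_mat_on_def by simp

lemma regular_mat_on_mat [intro]: "regular_on U f \<Longrightarrow> regular_mat_on U (\<lambda>x. mat (f x))"
  unfolding regular_mat_on_def mat_def by (simp add: regular_on_if)

lemma regular_mat_on_diagonal [intro]:
  "(\<And>i. regular_on U (d i)) \<Longrightarrow> regular_mat_on U (\<lambda>x. \<chi> i j. if i = j then d i x else 0)"
  unfolding regular_mat_on_def by (simp add: regular_on_if)

lemma regular_vec_on_subset: "regular_vec_on U A \<Longrightarrow> V \<subseteq> U \<Longrightarrow> regular_vec_on V A"
  by (auto simp: regular_vec_on_def intro: regular_on_subset)

lemma regular_vec_on_cong: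
  assumes "\<And>x. x \<in> U \<Longrightarrow> A x = B x"
  shows "regular_vec_on U A \<longleftrightarrow> regular_vec_on U B"
  unfolding regular_vec_on_def by (intro all_cong1 regular_on_cong) (simp add: assms)

lemma regular_vec_on_local:
  assumes "\<And>x. x \<in> U \<Longrightarrow> \<exists>V. zariski_open V \<and> x \<in> V \<and> regular_vec_on (U \<inter> V) A"
  shows "regular_vec_on U A"
  unfolding regular_vec_on_def
  by (intro allI regular_on_local) (use assms regular_vec_on_def in blast)

lemma regular_vec_on_mult [intro]:
  "regular_mat_on U A \<Longrightarrow> regular_vec_on U v \<Longrightarrow> regular_vec_on U (\<lambda>x. A x *v v x)"
  unfolding regular_mat_on_def regular_vec_on_def matrix_vector_mult_def
  by (simp add: regular_on_sum regular_on_mult)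

lemma regular_vec_on_scale [intro]:
  "regular_on U f \<Longrightarrow> regular_vec_on U v \<Longrightarrow> regular_vec_on U (\<lambda>x. f x *s v x)"
  unfolding regular_vec_on_def by auto

lemma regular_on_det [intro]: "regular_mat_on U A \<Longrightarrow> regular_on U (\<lambda>x. det (A x))"
  unfolding regular_mat_on_def det_def by (intro regular_on_sum regular_on_mult regular_on_prod) auto

text \<open>Cramer's rule for a unit vector. It writes the entries of the inverse as quotients of
  determinants, from which their regularity is visible.\<close>

lemma matrix_inv_nth_det:
  fixes A :: "'a::field^'n^'n"
  assumes "invertible A"
  shows "matrix_inv A $ k $ l = det (\<chi> i j. if j = k then (if i = l then 1 else 0) else A$i$j) / det A"
proof -
  let ?b = "axis l 1 :: 'a^'n"
  have "A *v (matrix_inv A *v ?b) = ?b" by (simp add: assms matrix_inv_cancel_vec)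
  then have "matrix_inv A *v ?b = (\<chi> k. det(\<chi> i j. if j=k then ?b$i else A$i$j) / det A)"
    using cramer[of A] assms by (simp add: invertible_det_nz)
  then have "(matrix_inv A *v ?b) $ k = det(\<chi> i j. if j=k then ?b$i else A$i$j) / det A"
    by simp
  moreover have "(matrix_inv A *v ?b) $ k = matrix_inv A $ k $ l"
    by (simp add: matrix_vector_mult_def axis_def if_distrib cong: if_cong)
  ultimately show ?thesis
    by (simp add: axis_def cong: if_cong)
qed

lemma regular_mat_on_matrix_inv [intro]:
  fixes A :: "p1 \<Rightarrow> complex^'n^'n"
  assumes "regular_mat_on U A" "\<And>x. x \<in> U \<Longrightarrow> invertible (A x)"
  shows "regular_mat_on U (\<lambda>x. matrix_inv (A x))"
  unfolding regular_mat_on_def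
proof (intro allI)
  fix k l
  have "regular_mat_on U (\<lambda>x. \<chi> i j. if j = k then (if i = l then 1 else 0) else A x$i$j)"
    using assms(1) unfolding regular_mat_on_def by (simp add: regular_on_if)
  then have "regular_on U (\<lambda>x. det (\<chi> i j. if j = k then (if i = l then 1 else 0) else A x$i$j) / det (A x))"
    using assms by (intro regular_on_divide regular_on_det) (auto simp: invertible_det_nz)
  then show "regular_on U (\<lambda>x. matrix_inv (A x) $ k $ l)"
    by (subst regular_on_cong[OF matrix_inv_nth_det]) (use assms in auto)
qed

text \<open>\<open>F\<close> is the inverse of a trivialisation compatible with the atlas. Frames
  allow trivialisations over open sets that the atlas \<open>E\<close> does not list.\<close>

definition frame :: "('n::finite) vbundle \<Rightarrow> p1 set \<Rightarrow> (p1 \<Rightarrow> complex^'n^'n) \<Rightarrow> bool" where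
  "frame E U F \<longleftrightarrow> (\<forall>x\<in>U. invertible (F x)) \<and>
     (\<forall>(V, \<phi>)\<in>E. regular_mat_on (U \<inter> V) (\<lambda>x. \<phi> x ** F x))"

lemma frame_invertible: "frame E U F \<Longrightarrow> x \<in> U \<Longrightarrow> invertible (F x)"
  by (simp add: frame_def)

lemma frame_regular: "frame E U F \<Longrightarrow> (V, \<phi>) \<in> E \<Longrightarrow> regular_mat_on (U \<inter> V) (\<lambda>x. \<phi> x ** F x)"
  by (auto simp: frame_def)

lemma frame_subset: "frame E U F \<Longrightarrow> V \<subseteq> U \<Longrightarrow> frame E V F"
  unfolding frame_def by (fast intro: regular_mat_on_subset)

lemma frame_cong:
  assumes "frame E U F" "\<And>x. x \<in> U \<Longrightarrow> F x = G x"
  shows "frame E U G"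
proof -
  have "regular_mat_on (U \<inter> V) (\<lambda>x. \<phi> x ** G x)" if "(V, \<phi>) \<in> E" for V \<phi>
    using frame_regular[OF assms(1) that] assms(2)
    by (subst regular_mat_on_cong[where B = "\<lambda>x. \<phi> x ** F x"]) auto
  then show ?thesis using assms unfolding frame_def by fastforce
qed

lemma vector_bundle_chart:
  assumes "vector_bundle E"
  obtains V \<phi> where "(V, \<phi>) \<in> E" "x \<in> V" "zariski_open V" "\<And>y. y \<in> V \<Longrightarrow> invertible (\<phi> y)"
proof -
  have "x \<in> (\<Union>(U, \<phi>)\<in>E. U)" using assms unfolding vector_bundle_def by blast
  then obtain V \<phi> where V: "(V, \<phi>) \<in> E" "x \<in> V" by blast
  have "\<forall>(U, \<phi>)\<in>E. zariski_open U \<and> (\<forall>x\<in>U. invertible (\<phi> x))"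
    using assms unfolding vector_bundle_def by (rule conjunct1)
  from bspec[OF this V(1)] have "zariski_open V \<and> (\<forall>x\<in>V. invertible (\<phi> x))" by simp
  with V that show ?thesis by metis
qed

lemma chart_frame:
  assumes "vector_bundle E" "(U, \<phi>) \<in> E"
  shows "frame E U (\<lambda>x. matrix_inv (\<phi> x))"
  using assms unfolding vector_bundle_def frame_def
  by (fastforce intro: invertible_matrix_inv)

text \<open>Comparison with one known frame near each point suffices, because the transition from
  that frame to any chart is already regular.\<close>

lemma frameI:
  assumes "\<And>x. x \<in> U \<Longrightarrow> invertible (F x)"
    and "\<And>x. x \<in> U \<Longrightarrow> \<exists>V G. zariski_open V \<and> x \<in> V \<and> frame E V G \<and> regular_mat_on (U \<inter> V) (\<lambda>x. matrix_inv (G x) ** F x)"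
  shows "frame E U F"
  unfolding frame_def
proof (safe intro!: assms(1) regular_mat_on_local)
  fix W \<phi> x assume W: "(W, \<phi>) \<in> E" and x: "x \<in> U" "x \<in> W"
  obtain V G where V: "zariski_open V" "x \<in> V" "frame E V G"
    and r: "regular_mat_on (U \<inter> V) (\<lambda>x. matrix_inv (G x) ** F x)"
    using assms(2) x by meson
  let ?U = "U \<inter> W \<inter> V"
  have "regular_mat_on ?U (\<lambda>x. (\<phi> x ** G x) ** (matrix_inv (G x) ** F x))"
    by (rule regular_mat_on_mult; rule regular_mat_on_subset[OF frame_regular[OF V(3) W]] regular_mat_on_subset[OF r]) auto
  also have "?this \<longleftrightarrow> regular_mat_on ?U (\<lambda>x. \<phi> x ** F x)"
    by (rule regular_mat_on_cong)
      (use frame_invertible[OF V(3)] in \<open>simp add: matrix_mul_assoc[symmetric] matrix_inv_cancel\<close>)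
  finally show "\<exists>V. zariski_open V \<and> x \<in> V \<and> regular_mat_on (U \<inter> W \<inter> V) (\<lambda>x. \<phi> x ** F x)"
    using V by blast
qed

lemma is_section_frame:
  assumes "vector_bundle E" "is_section E U s" "frame E V F"
  shows "regular_vec_on (U \<inter> V) (\<lambda>x. matrix_inv (F x) *v s x)"
proof (rule regular_vec_on_local)
  fix x assume x: "x \<in> U \<inter> V"
  obtain W \<phi> where W: "(W, \<phi>) \<in> E" "x \<in> W" "zariski_open W" "\<And>y. y \<in> W \<Longrightarrow> invertible (\<phi> y)"
    using vector_bundle_chart[OF assms(1)] by blast
  let ?U = "U \<inter> V \<inter> W"
  have s: "regular_vec_on (U \<inter> W) (\<lambda>x. \<phi> x *v s x)"
    using assms(2) W(1) unfolding is_section_def by blast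
  have "regular_mat_on ?U (\<lambda>x. \<phi> x ** F x)" "regular_vec_on ?U (\<lambda>x. \<phi> x *v s x)"
    by (rule regular_mat_on_subset[OF frame_regular[OF assms(3) W(1)]], blast)
      (rule regular_vec_on_subset[OF s], blast)
  then have "regular_vec_on ?U (\<lambda>x. matrix_inv (\<phi> x ** F x) *v (\<phi> x *v s x))"
    using frame_invertible[OF assms(3)] W(4)
    by (intro regular_vec_on_mult[OF regular_mat_on_matrix_inv]) (auto intro: invertible_mult)
  also have "?this \<longleftrightarrow> regular_vec_on ?U (\<lambda>x. matrix_inv (F x) *v s x)"
    by (rule regular_vec_on_cong)
      (use frame_invertible[OF assms(3)] W(4) in \<open>simp add: matrix_inv_mult matrix_vector_mul_assoc[symmetric] matrix_inv_cancel_vec\<close>)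
  finally show "\<exists>W. zariski_open W \<and> x \<in> W \<and> regular_vec_on (U \<inter> V \<inter> W) (\<lambda>x. matrix_inv (F x) *v s x)"
    using W by blast
qed

lemma is_sectionI:
  assumes "\<And>x. x \<in> U \<Longrightarrow> \<exists>V G. zariski_open V \<and> x \<in> V \<and> frame E V G \<and> regular_vec_on (U \<inter> V) (\<lambda>x. matrix_inv (G x) *v s x)"
  shows "is_section E U s"
  unfolding is_section_def
proof (safe intro!: regular_vec_on_local)
  fix W \<phi> x assume W: "(W, \<phi>) \<in> E" and x: "x \<in> U" "x \<in> W"
  obtain V G where V: "zariski_open V" "x \<in> V" "frame E V G"
    and r: "regular_vec_on (U \<inter> V) (\<lambda>x. matrix_inv (G x) *v s x)"
    using assms x by meson
  let ?U = "U \<inter> W \<inter> V"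
  have "regular_vec_on ?U (\<lambda>x. (\<phi> x ** G x) *v (matrix_inv (G x) *v s x))"
    by (rule regular_vec_on_mult; rule regular_mat_on_subset[OF frame_regular[OF V(3) W]] regular_vec_on_subset[OF r]) auto
  also have "?this \<longleftrightarrow> regular_vec_on ?U (\<lambda>x. \<phi> x *v s x)"
    by (rule regular_vec_on_cong)
      (use frame_invertible[OF V(3)] in \<open>simp add: matrix_vector_mul_assoc[symmetric] matrix_inv_cancel_vec\<close>)
  finally show "\<exists>V. zariski_open V \<and> x \<in> V \<and> regular_vec_on (U \<inter> W \<inter> V) (\<lambda>x. \<phi> x *v s x)"
    using V by blast
qed

lemma frame_mult:
  assumes "frame E U F" "zariski_open U" "regular_mat_on V G" "V \<subseteq> U" "\<And>x. x \<in> V \<Longrightarrow> invertible (G x)"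
  shows "frame E V (\<lambda>x. F x ** G x)"
proof (rule frameI)
  fix x assume "x \<in> V"
  have "regular_mat_on (V \<inter> U) (\<lambda>x. matrix_inv (F x) ** (F x ** G x)) \<longleftrightarrow> regular_mat_on (V \<inter> U) G"
    by (rule regular_mat_on_cong) (use frame_invertible[OF assms(1)] in \<open>simp add: matrix_inv_cancel\<close>)
  then show "\<exists>V' G'. zariski_open V' \<and> x \<in> V' \<and> frame E V' G' \<and>
      regular_mat_on (V \<inter> V') (\<lambda>x. matrix_inv (G' x) ** (F x ** G x))"
    using assms \<open>x \<in> V\<close> by (intro exI[of _ U] exI[of _ F]) (auto elim: regular_mat_on_subset)
qed (use assms frame_invertible[OF assms(1)] in \<open>auto intro!: invertible_mult\<close>)

section \<open>Splitting of vector bundles\<close>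

definition poly_mat :: "complex poly^'m^'n \<Rightarrow> complex \<Rightarrow> complex^'m^'n" where
  "poly_mat M z = (\<chi> i j. poly (M $ i $ j) z)"

lemma poly_mat_nth [simp]: "poly_mat M z $ i $ j = poly (M $ i $ j) z"
  by (simp add: poly_mat_def)

lemma poly_mat_mult: "poly_mat (M ** N) z = poly_mat M z ** poly_mat N z"
  by (simp add: vec_eq_iff matrix_matrix_mult_def poly_sum)

lemma poly_mat_mat_1 [simp]: "poly_mat (mat 1) z = mat 1"
  by (simp add: vec_eq_iff mat_def)

lemma poly_det: "poly (det M) z = det (poly_mat M z)"
  by (simp add: det_def poly_sum poly_prod)

lemma regular_mat_on_poly_mat: "regular_on U f \<Longrightarrow> regular_mat_on U (\<lambda>x. poly_mat M (f x))"
  unfolding regular_mat_on_def by (auto intro: regular_on_poly)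

text \<open>Right multiplication by such a matrix replaces column \<open>l\<close> by the
  combination of the columns with coefficients \<open>c\<close>; the formula shows that this is
  invertible exactly if \<open>c $ l\<close> is nonzero. Both reductions below rest on it.\<close>

lemma det_replace_column:
  "det (\<chi> i j. if j = l then c $ i else mat 1 $ i $ j) = (c :: 'a::field^'n) $ l"
  using cramer_lemma[of l "mat 1" c] unfolding matrix_vector_mul_lid det_I mult_1_right .

text \<open>If a constant combination of the columns vanishes at \<open>a\<close>, it is divisible by \<open>z - a\<close>; replacing
  a column by the quotient lowers the order of vanishing of the determinant.\<close>

lemma local_reduction:
  fixes M :: "complex poly^'n^'n"
  assumes "det M \<noteq> 0"
  obtains G M' where "\<And>z. z \<noteq> a \<Longrightarrow> invertible (G z)" "\<And>z. z \<noteq> a \<Longrightarrow> poly_mat M z ** G z = poly_mat M' z"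
    "regular_mat_on (- {Infty, Pt a}) (\<lambda>x. G (coord_0 x))" "det (poly_mat M' a) \<noteq> 0"
proof -
  have "\<exists>G M'. (\<forall>z. z \<noteq> a \<longrightarrow> invertible (G z) \<and> poly_mat M z ** G z = poly_mat M' z) \<and>
    regular_mat_on (- {Infty, Pt a}) (\<lambda>x. G (coord_0 x)) \<and> det (poly_mat M' a) \<noteq> 0"
    using assms
  proof (induction "degree (det M)" arbitrary: M rule: less_induct)
    case less
    show ?case
    proof (cases "det (poly_mat M a) = 0")
      case False
      show ?thesis
        by (intro exI[of _ "\<lambda>_. mat 1"] exI[of _ M]) (use False in \<open>auto simp: invertible_mat\<close>)
    next
      case True
      then obtain c where c: "c \<noteq> 0" "poly_mat M a *v c = 0" using kernel_of_singular by blast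
      then obtain l where l: "c $ l \<noteq> 0" by (metis vec_eq_iff zero_index)
      define C where "C = (\<chi> i j. if j = l then c $ i else mat 1 $ i $ j)"
      define P where "P = (\<chi> i j. [:C $ i $ j:])"
      define N where "N = M ** P"
      have pevP: "poly_mat P z = C" for z by (simp add: vec_eq_iff P_def)
      have detC: "det C = c $ l" unfolding C_def by (rule det_replace_column)
      have detP: "det P = [:c $ l:]"
        by (subst poly_eq_poly_eq_iff[symmetric]) (simp add: fun_eq_iff poly_det pevP detC)
      have "poly (N $ i $ l) a = 0" for i
      proof -
        have "poly_mat N a $ i $ l = (poly_mat M a *v c) $ i"
          by (simp add: N_def poly_mat_mult pevP) (simp add: C_def matrix_matrix_mult_def matrix_vector_mult_def)
        then show ?thesis by (simp add: c)
      qed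
      then have "\<forall>i. \<exists>r. N $ i $ l = [:-a, 1:] * r"
        by (simp only: poly_eq_0_iff_dvd dvd_def) blast
      then obtain r where r: "\<And>i. N $ i $ l = [:-a, 1:] * r i" by metis
      define M1 where "M1 = (\<chi> i j. if j = l then r i else N $ i $ j)"
      define D where "D = (\<chi> i j. if i = j then if i = l then [:-a, 1:] else 1 else (0::complex poly)) "
      have ND: "N = M1 ** D"
        unfolding vec_eq_iff D_def matrix_mult_diagonal_nth by (simp add: M1_def r)
      have detD: "det D = [:-a, 1:]"
        by (subst det_diagonal) (simp_all add: D_def)
      \<comment> \<open>The determinant loses exactly one factor \<open>z - a\<close>, so the
        induction on its degree advances.\<close>
      have dets: "det M * [:c $ l:] = det M1 * [:-a, 1:]"
        using detP detD ND by (metis N_def det_mul)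
      have M1: "det M1 \<noteq> 0"
      proof
        assume "det M1 = 0"
        with dets have "det M * [:c $ l:] = 0" by simp
        with less.prems l show False by simp
      qed
      have "degree (det M * [:c $ l:]) = degree (det M)" using l by simp
      moreover have "degree (det M1 * [:-a, 1:]) = Suc (degree (det M1))"
        using M1 by (subst degree_mult_eq) auto
      ultimately have "degree (det M1) < degree (det M)" unfolding dets by linarith
      from less.hyps[OF this M1] obtain G M' where G: "\<And>z. z \<noteq> a \<Longrightarrow> invertible (G z)"
         "\<And>z. z \<noteq> a \<Longrightarrow> poly_mat M1 z ** G z = poly_mat M' z"
        and Gr: "regular_mat_on (- {Infty, Pt a}) (\<lambda>x. G (coord_0 x))" and M': "det (poly_mat M' a) \<noteq> 0"
        by blast
      define Di where "Di z = (\<chi> i j. if i = j then if i = l then inverse (z - a) else 1 else 0)" for z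
      have pevD: "poly_mat D z ** Di z = mat 1" if "z \<noteq> a" for z
        unfolding vec_eq_iff Di_def matrix_mult_diagonal_nth using that
        by (auto simp: D_def mat_def)
      have eq: "poly_mat M z ** (C ** Di z ** G z) = poly_mat M' z" if "z \<noteq> a" for z
      proof -
        have "poly_mat M z ** (C ** Di z ** G z) = (poly_mat M z ** poly_mat P z) ** Di z ** G z"
          by (simp add: pevP matrix_mul_assoc)
        also have "\<dots> = poly_mat M1 z ** (poly_mat D z ** Di z) ** G z"
          by (simp only: poly_mat_mult[symmetric] N_def[symmetric] ND) (simp add: poly_mat_mult matrix_mul_assoc)
        finally show ?thesis using G that by (simp add: pevD)
      qed
      have "regular_mat_on (- {Infty, Pt a}) (\<lambda>x. Di (coord_0 x))"
        unfolding Di_def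
        by (intro regular_mat_on_diagonal regular_on_if regular_on_inverse regular_on_diff regular_on_const regular_on_coord_0)
          (auto simp: coord_0_def split: p1.splits)
      then have reg: "regular_mat_on (- {Infty, Pt a}) (\<lambda>x. C ** Di (coord_0 x) ** G (coord_0 x))"
        by (rule regular_mat_on_mult[OF regular_mat_on_mult[OF regular_mat_on_const] Gr])
      have inv: "invertible (C ** Di z ** G z)" if "z \<noteq> a" for z
      proof (intro invertible_mult G that)
        show "invertible C" using detC l by (simp add: invertible_det_nz)
        show "invertible (Di z)" unfolding Di_def by (rule invertible_diagonal) (use that in auto)
      qed
      show ?thesis
        by (rule exI[of _ "\<lambda>z. C ** Di z ** G z"], rule exI[of _ M']) (use eq inv reg M' in auto)
    qed
  qed
  with that show ?thesis by blast
qed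

text \<open>If the matrix of leading coefficients is singular, a kernel vector gives a column operation lowering
  the largest of the column degrees involved.\<close>

lemma column_reduction:
  fixes N :: "complex poly^'n^'n"
  assumes "det N \<noteq> 0"
  obtains G d where "\<And>z. invertible (poly_mat G z)" "\<And>i j. degree ((N ** G) $ i $ j) \<le> d j"
    "det (\<chi> i j. coeff ((N ** G) $ i $ j) (d j)) \<noteq> 0"
proof -
  have "\<exists>G d. (\<forall>z. invertible (poly_mat G z)) \<and> (\<forall>i j. degree ((N ** G) $ i $ j) \<le> d j) \<and>
    det (\<chi> i j. coeff ((N ** G) $ i $ j) (d j)) \<noteq> 0"
    if "\<And>i j. degree (N $ i $ j) \<le> d j" for d
    using that assms
  proof (induction "\<Sum>j\<in>UNIV. d j" arbitrary: N d rule: less_induct)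
    case less
    show ?case
    proof (cases "det (\<chi> i j. coeff (N $ i $ j) (d j)) = 0")
      case False
      show ?thesis
        by (rule exI[of _ "mat 1"], rule exI[of _ d]) (use False less.prems in \<open>auto simp: invertible_mat\<close>)
    next
      case True
      then obtain c where c: "c \<noteq> 0" "(\<chi> i j. coeff (N $ i $ j) (d j)) *v c = 0"
        using kernel_of_singular by blast
      then have "{l. c $ l \<noteq> 0} \<noteq> {}" by (auto simp: vec_eq_iff)
      \<comment> \<open>Choosing \<open>k\<close> with the largest bound among the columns that
        occur makes every exponent \<open>d k - d l\<close> a genuine difference, so the operation
        has polynomial entries.\<close>
      then obtain k where k: "c $ k \<noteq> 0" "\<And>l. c $ l \<noteq> 0 \<Longrightarrow> d l \<le> d k"
        using Max_in[of "d ` {l. c $ l \<noteq> 0}"] Max_ge[of "d ` {l. c $ l \<noteq> 0}"] by fastforce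
      define H where "H = (\<chi> i j. if j = k then monom (c $ i) (d k - d i) else if i = j then 1 else 0)"
      define N1 where "N1 = N ** H"
      have detH: "det (poly_mat H z) = c $ k" for z
      proof -
        have "poly_mat H z = (\<chi> i j. if j = k then (\<chi> i. c $ i * z ^ (d k - d i)) $ i else mat 1 $ i $ j)"
          by (auto simp: vec_eq_iff H_def poly_monom mat_def)
        then show ?thesis by (simp only: det_replace_column) simp
      qed
      have N1j: "N1 $ i $ j = N $ i $ j" if "j \<noteq> k" for i j
      proof -
        have "N1 $ i $ j = (\<Sum>l\<in>UNIV. if l = j then N $ i $ l else 0)"
          unfolding N1_def matrix_matrix_mult_def
          by (subst vec_lambda_beta, subst vec_lambda_beta, rule sum.cong) (use that in \<open>auto simp: H_def\<close>)
        then show ?thesis by simp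
      qed
      have N1k: "N1 $ i $ k = (\<Sum>l\<in>UNIV. N $ i $ l * monom (c $ l) (d k - d l))" for i
        by (simp add: N1_def H_def matrix_matrix_mult_def)
      have "det N1 \<noteq> 0"
      proof
        assume "det N1 = 0"
        then have "det N * det H = 0" by (simp only: N1_def det_mul)
        with less.prems have "det H = 0" by auto
        with detH[of 0] k show False by (metis poly_0 poly_det)
      qed
      have tdeg: "degree (N $ i $ l * monom (c $ l) (d k - d l)) \<le> d k" for i l
      proof (cases "c $ l = 0")
        case False
        have "degree (N $ i $ l * monom (c $ l) (d k - d l)) \<le> degree (N $ i $ l) + (d k - d l)"
          by (rule order.trans[OF degree_mult_le]) (simp add: degree_monom_eq False)
        also have "\<dots> \<le> d k" using less.prems(1)[of i l] k(2)[OF False] by linarith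
        finally show ?thesis .
      qed simp
      have deg: "degree (N1 $ i $ k) \<le> d k" for i
        unfolding N1k by (intro degree_sum_le tdeg) simp
      have coeff: "coeff (N1 $ i $ k) (d k) = 0" for i
      proof -
        have "coeff (N $ i $ l * monom (c $ l) (d k - d l)) (d k) = coeff (N $ i $ l) (d l) * c $ l" for l
        proof (cases "c $ l = 0")
          case False
          then show ?thesis using k(2)[OF False]
            by (simp add: mult.commute[of _ "monom _ _"] coeff_monom_mult)
        qed simp
        then have "coeff (N1 $ i $ k) (d k) = ((\<chi> i j. coeff (N $ i $ j) (d j)) *v c) $ i"
          by (simp add: N1k coeff_sum matrix_vector_mult_def)
        then show ?thesis using c by simp
      qed
      \<comment> \<open>A bound 0 could not be lowered further; it would make column
        \<open>k\<close> vanish, against the nonzero determinant.\<close>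
      have dk: "d k \<noteq> 0"
      proof
        assume "d k = 0"
        then have "N1 $ i $ k = 0" for i
          using deg[of i] coeff[of i] by (metis le_zero_eq leading_coeff_0_iff)
        then have "column k N1 = 0" by (simp add: column_def vec_eq_iff)
        then have "row k (transpose N1) = 0" by simp
        then have "det (transpose N1) = 0" by (rule det_zero_row)
        with \<open>det N1 \<noteq> 0\<close> show False by (simp add: det_transpose)
      qed
      define d' where "d' = d(k := d k - 1)"
      have d': "degree (N1 $ i $ j) \<le> d' j" for i j
      proof (cases "j = k")
        case True
        have "degree (N1 $ i $ k) \<noteq> d k"
          using dk coeff[of i] by (metis degree_0 leading_coeff_0_iff)
        then show ?thesis using deg[of i] by (simp add: d'_def True)
      qed (simp add: d'_def N1j less.prems)
      have "(\<Sum>j\<in>UNIV. d' j) < (\<Sum>j\<in>UNIV. d j)"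
        by (rule sum_strict_mono_ex1) (use dk in \<open>auto simp: d'_def\<close>)
      from less.hyps[OF this d' \<open>det N1 \<noteq> 0\<close>] obtain G e
        where G: "\<And>z. invertible (poly_mat G z)" "\<And>i j. degree ((N1 ** G) $ i $ j) \<le> e j"
          "det (\<chi> i j. coeff ((N1 ** G) $ i $ j) (e j)) \<noteq> 0" by blast
      have "invertible (poly_mat (H ** G) z)" for z
        unfolding poly_mat_mult using G(1) detH[of z] k by (intro invertible_mult) (auto simp: invertible_det_nz)
      with G show ?thesis
        by (intro exI[of _ "H ** G"] exI[of _ e]) (simp add: N1_def matrix_mul_assoc)
    qed
  qed
  \<comment> \<open>The induction starts from the actual column degrees as bounds.\<close>
  note * = this[of "\<lambda>j. Max (range (\<lambda>i. degree (N $ i $ j)))"]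
  show ?thesis using * that by (auto simp: Max_ge)
qed

section \<open>Extending a frame over the affine line\<close>

lemma regular_mat_fraction:
  assumes "regular_mat_on U T" "zariski_open U" "U \<noteq> {}"
  obtains M q where "q \<noteq> 0" "\<And>z. Pt z \<in> U \<Longrightarrow> poly q z \<noteq> 0"
    "\<And>z. Pt z \<in> U \<Longrightarrow> poly_mat M z = mat (poly q z) ** T (Pt z)"
proof -
  have "\<forall>i j. \<exists>p q. q \<noteq> 0 \<and> (\<forall>z. Pt z \<in> U \<longrightarrow> poly q z \<noteq> 0 \<and> T (Pt z) $ i $ j = poly p z / poly q z)"
    using regular_on_fraction[OF _ assms(2,3)] assms(1) unfolding regular_mat_on_def by metis
  then obtain p q where q0: "\<And>i j. q i j \<noteq> 0"
    and pq: "\<And>i j z. Pt z \<in> U \<Longrightarrow> poly (q i j) z \<noteq> 0 \<and> T (Pt z) $ i $ j = poly (p i j) z / poly (q i j) z"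
    by metis
  define Q where "Q = (\<Prod>i\<in>UNIV. \<Prod>j\<in>UNIV. q i j)"
  have "q i j dvd Q" for i j
    unfolding Q_def by (meson UNIV_I dvd_prodI dvd_trans finite)
  then obtain r where r: "\<And>i j. Q = q i j * r i j" unfolding dvd_def by metis
  show ?thesis
  proof (rule that[of Q "\<chi> i j. p i j * r i j"])
    show "Q \<noteq> 0" by (simp add: Q_def q0)
    fix z assume z: "Pt z \<in> U"
    then show "poly Q z \<noteq> 0" by (simp add: Q_def poly_prod pq)
    show "poly_mat (\<chi> i j. p i j * r i j) z = mat (poly Q z) ** T (Pt z)"
      unfolding vec_eq_iff mat_mult_nth
    proof (intro allI)
      fix i j
      show "poly_mat (\<chi> i j. p i j * r i j) z $ i $ j = poly Q z * T (Pt z) $ i $ j"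
        using pq[OF z, of i j] by (simp add: r[of i j])
    qed
  qed
qed

lemma zariski_open_Int_nonempty:
  assumes "zariski_open U" "zariski_open V" "U \<noteq> {}" "V \<noteq> {}"
  shows "U \<inter> V \<noteq> {}"
proof
  assume "U \<inter> V = {}"
  then have "- U \<union> - V = UNIV" by blast
  moreover have "finite (- U \<union> - V)" using assms by (auto simp: zariski_open_def)
  moreover have "infinite (UNIV :: p1 set)"
    using infinite_UNIV_char_0[where 'a=complex] finite_imageD[of Pt UNIV]
    by (metis finite_subset inj_onI p1.inject subset_UNIV)
  ultimately show False by simp
qed

text \<open>Near \<open>a\<close> the frame has the matrix \<open>M / q\<close> in a chart. Column
  operations \<open>G\<close>, regular away from \<open>a\<close>, remove the zero of
  \<open>det M\<close> at \<open>a\<close>, and the factor \<open>(z - a) ^ k\<close> removes the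
  zero of \<open>q\<close>. The modified frame has the matrix \<open>M' / q1\<close> in the chart,
  which is regular and invertible at \<open>a\<close>.\<close>

lemma frame_extend:
  fixes E :: "('n::finite) vbundle"
  assumes E: "vector_bundle E" and F: "frame E U F" and U: "zariski_open U" "U \<noteq> {}" "Infty \<notin> U" "Pt a \<notin> U"
  obtains F' where "frame E (insert (Pt a) U) F'"
proof -
  obtain V \<psi> where V: "(V, \<psi>) \<in> E" "Pt a \<in> V" "zariski_open V" "\<And>y. y \<in> V \<Longrightarrow> invertible (\<psi> y)"
    using vector_bundle_chart[OF E] by blast
  have W: "zariski_open (U \<inter> V)" "U \<inter> V \<noteq> {}"
    using zariski_open_Int[OF U(1) V(3)] zariski_open_Int_nonempty[OF U(1) V(3) U(2)] V(2) by auto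
  have "regular_mat_on (U \<inter> V) (\<lambda>x. \<psi> x ** F x)" using frame_regular[OF F V(1)] .
  then obtain M q where q: "q \<noteq> 0" "\<And>z. Pt z \<in> U \<inter> V \<Longrightarrow> poly q z \<noteq> 0"
    and M: "\<And>z. Pt z \<in> U \<inter> V \<Longrightarrow> poly_mat M z = mat (poly q z) ** (\<psi> (Pt z) ** F (Pt z))"
    by (rule regular_mat_fraction[OF _ W]) blast
  have "det M \<noteq> 0"
  proof
    assume 0: "det M = 0"
    obtain z where z: "Pt z \<in> U \<inter> V" using infinite_Pt[OF W] by blast
    then have "invertible (poly_mat M z)" unfolding M[OF z] using frame_invertible[OF F] V(4) q
      by (intro invertible_mult invertible_mat) auto
    with 0 show False by (metis invertible_det_nz poly_0 poly_det)
  qed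
  from local_reduction[OF this, of a] obtain G M'
    where G: "\<And>z. z \<noteq> a \<Longrightarrow> invertible (G z)" "\<And>z. z \<noteq> a \<Longrightarrow> poly_mat M z ** G z = poly_mat M' z"
    "regular_mat_on (- {Infty, Pt a}) (\<lambda>x. G (coord_0 x))" and M': "det (poly_mat M' a) \<noteq> 0" by blast
  obtain k q1 where k: "q = [:-a, 1:] ^ k * q1" "\<not> [:-a, 1:] dvd q1"
    using order_decomp[OF q(1)] by blast
  then have q1: "poly q1 a \<noteq> 0" by (simp add: poly_eq_0_iff_dvd)
  \<comment> \<open>The value at \<open>Pt a\<close> is the one for which the formula
    \<open>M' / q1\<close> in the chart also holds there.\<close>
  define F' where "F' x = (if x = Pt a then matrix_inv (\<psi> x) ** (mat (inverse (poly q1 a)) ** poly_mat M' a)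
     else F x ** (mat ((coord_0 x - a) ^ k) ** G (coord_0 x)))" for x
  have frU: "frame E U F'"
  proof (rule frame_cong)
    have "regular_mat_on U (\<lambda>x. G (coord_0 x))"
      by (rule regular_mat_on_subset[OF G(3)]) (use U in auto)
    then have "regular_mat_on U (\<lambda>x. mat ((coord_0 x - a) ^ k) ** G (coord_0 x))"
      using U by (intro regular_mat_on_mult[OF regular_mat_on_mat] regular_on_power regular_on_diff regular_on_coord_0) auto
    moreover have "coord_0 x \<noteq> a" if "x \<in> U" for x using that U by (cases x) auto
    ultimately show "frame E U (\<lambda>x. F x ** (mat ((coord_0 x - a) ^ k) ** G (coord_0 x)))"
      using G(1) by (intro frame_mult[OF F U(1)] invertible_mult invertible_mat) auto
    show "F x ** (mat ((coord_0 x - a) ^ k) ** G (coord_0 x)) = F' x" if "x \<in> U" for x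
      using that U by (auto simp: F'_def)
  qed
  define V0 where "V0 = insert (Pt a) (U \<inter> V) \<inter> aff_0 ` {z. poly q1 z \<noteq> 0}"
  have V0: "zariski_open V0"
  proof -
    have "- insert (Pt a) (U \<inter> V) \<subseteq> - U \<union> - V" by blast
    then have "zariski_open (insert (Pt a) (U \<inter> V))"
      using U V W unfolding zariski_open_def by (metis finite_Un finite_subset empty_iff insertI1 Int_empty_left Int_empty_right)
    then show ?thesis unfolding V0_def
      using zariski_open_chart_nonzero[of aff_0 q1 a] q1 by (intro zariski_open_Int) auto
  qed
  have aV0: "Pt a \<in> V0" using q1 by (auto simp: V0_def aff_0_def)
  have key: "\<psi> x ** F' x = mat (inverse (poly q1 (coord_0 x))) ** poly_mat M' (coord_0 x)" if "x \<in> V0" for x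
  proof (cases "x = Pt a")
    case True
    then show ?thesis using V by (simp add: F'_def matrix_inv_cancel)
  next
    case False
    with that obtain z where z: "x = Pt z" "Pt z \<in> U \<inter> V" "poly q1 z \<noteq> 0" "z \<noteq> a"
      by (auto simp: V0_def aff_0_def)
    let ?T = "\<psi> x ** F x"
    have 1: "\<psi> x ** F' x = mat ((z - a) ^ k) ** (?T ** G z)"
      using z by (simp add: F'_def matrix_mul_assoc mat_commute)
    have pq: "poly q z = (z - a) ^ k * poly q1 z" by (simp add: k)
    have "?T ** G z = mat (inverse (poly q z)) ** (mat (poly q z) ** ?T) ** G z"
      using q(2)[OF z(2)] by (simp add: matrix_mul_assoc mat_mult_mat)
    also have "\<dots> = mat (inverse (poly q z)) ** poly_mat M' z"
      using G(2)[OF z(4)] M[OF z(2)] by (simp add: z(1) matrix_mul_assoc[symmetric])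
    finally have "\<psi> x ** F' x = mat ((z - a) ^ k * inverse (poly q z)) ** poly_mat M' z"
      by (simp only: 1 matrix_mul_assoc mat_mult_mat)
    moreover have "(z - a) ^ k * inverse (poly q z) = inverse (poly q1 z)"
      using z by (simp add: pq field_simps)
    ultimately show ?thesis by (simp add: z(1))
  qed
  have inv: "invertible (F' x)" if "x \<in> insert (Pt a) U" for x
  proof (cases "x = Pt a")
    case True
    have "invertible (matrix_inv (\<psi> (Pt a)))" "invertible (poly_mat M' a)"
      using V(2,4) M' by (auto intro: invertible_matrix_inv simp: invertible_det_nz[of "poly_mat M' a"])
    moreover have "invertible (mat (inverse (poly q1 a)) :: complex^'n^'n)"
      using q1 by (intro invertible_mat) simp
    ultimately show ?thesis by (simp add: F'_def True invertible_mult)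
  next
    case False
    with that frame_invertible[OF frU] show ?thesis by auto
  qed
  have "frame E (insert (Pt a) U) F'"
  proof (rule frameI[OF inv])
    fix x assume x: "x \<in> insert (Pt a) U"
    show "\<exists>V G. zariski_open V \<and> x \<in> V \<and> frame E V G \<and>
      regular_mat_on (insert (Pt a) U \<inter> V) (\<lambda>x. matrix_inv (G x) ** F' x)"
    proof (cases "x = Pt a")
      case False
      have "regular_mat_on (insert (Pt a) U \<inter> U) (\<lambda>x. matrix_inv (F' x) ** F' x)"
        by (subst regular_mat_on_cong[where B = "\<lambda>_. mat 1"])
          (use frame_invertible[OF frU] in \<open>auto simp: matrix_inv_left\<close>)
      with False x frU U show ?thesis by (intro exI[of _ U] exI[of _ F']) auto
    next
      case True
      have sub: "V0 \<subseteq> V" using V by (auto simp: V0_def)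
      have "frame E V0 (\<lambda>x. matrix_inv (\<psi> x))"
        by (rule frame_subset[OF chart_frame[OF E V(1)] sub])
      moreover have "regular_mat_on (insert (Pt a) U \<inter> V0) (\<lambda>x. matrix_inv (matrix_inv (\<psi> x)) ** F' x)"
      proof (subst regular_mat_on_cong)
        show "matrix_inv (matrix_inv (\<psi> x)) ** F' x = mat (inverse (poly q1 (coord_0 x))) ** poly_mat M' (coord_0 x)"
          if "x \<in> insert (Pt a) U \<inter> V0" for x
          using that key[of x] sub V(4) by (auto simp: matrix_inv_matrix_inv)
        have "Infty \<notin> insert (Pt a) U \<inter> V0" using U by auto
        then show "regular_mat_on (insert (Pt a) U \<inter> V0) (\<lambda>x. mat (inverse (poly q1 (coord_0 x))) ** poly_mat M' (coord_0 x))"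
          by (intro regular_mat_on_mult[OF regular_mat_on_mat] regular_mat_on_poly_mat regular_on_inverse
              regular_on_poly regular_on_coord_0) (auto simp: V0_def aff_0_def)
      qed
      ultimately show ?thesis using V0 aV0 True by blast
    qed
  qed
  then show ?thesis by (rule that)
qed

lemma frame_affine:
  assumes E: "vector_bundle (E :: ('n::finite) vbundle)"
  obtains F where "frame E (- {Infty}) F"
proof -
  have *: "\<exists>F. frame E (- {Infty}) F" if "finite S" "frame E (- {Infty} - Pt ` S) F" for S F
    using that
  proof (induction S arbitrary: F rule: finite_induct)
    case (insert a S)
    let ?U = "- {Infty} - Pt ` insert a S"
    have op: "zariski_open ?U" "?U \<noteq> {}"
    proof -
      have fin: "finite (insert Infty (Pt ` insert a S))" using insert by simp
      have e: "?U = - insert Infty (Pt ` insert a S)" by blast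
      show "zariski_open ?U" unfolding e by (rule zariski_open_cofinite[OF fin])
      have "finite (insert a S)" using insert by simp
      then obtain z where "z \<notin> insert a S" using infinite_UNIV_char_0[where 'a=complex] by (metis ex_new_if_finite)
      then have "Pt z \<in> ?U" by auto
      then show "?U \<noteq> {}" by blast
    qed
    obtain F' where F': "frame E (insert (Pt a) ?U) F'"
      using frame_extend[OF E insert.prems op] by auto
    have "insert (Pt a) ?U = - {Infty} - Pt ` S" using insert by auto
    with F' insert.IH show ?case by metis
  qed auto
  obtain V \<phi> where V: "(V, \<phi>) \<in> E" "Pt 0 \<in> V" "zariski_open V"
    using vector_bundle_chart[OF E] by metis
  have "frame E V (\<lambda>x. matrix_inv (\<phi> x))" by (rule chart_frame[OF E V(1)])
  then have "frame E (- {Infty} - Pt ` {z. Pt z \<notin> V}) (\<lambda>x. matrix_inv (\<phi> x))"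
  proof (rule frame_subset)
    show "- {Infty} - Pt ` {z. Pt z \<notin> V} \<subseteq> V"
    proof
      fix x assume "x \<in> - {Infty} - Pt ` {z. Pt z \<notin> V}"
      then show "x \<in> V" by (cases x) auto
    qed
  qed
  moreover have "finite {z. Pt z \<notin> V}"
    using finite_compl_Pt[OF V(3)] V(2) by (auto simp: Compl_eq)
  ultimately show ?thesis using * that by blast
qed


text \<open>The polynomial \<open>w ^ d * p (1 / w)\<close>, for \<open>d\<close> at least the
  degree of \<open>p\<close>: the coordinate near infinity of the section of \<open>O(d)\<close>
  given by \<open>p\<close>.\<close>

definition flip_poly :: "nat \<Rightarrow> complex poly \<Rightarrow> complex poly" where
  "flip_poly d p = reflect_poly p * monom 1 (d - degree p)"

lemma poly_flip_poly:
  assumes "degree p \<le> d" "z \<noteq> 0"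
  shows "poly (flip_poly d p) (inverse z) = poly p z / z ^ d"
proof -
  have "poly (flip_poly d p) (inverse z) = inverse z ^ degree p * poly p z * inverse z ^ (d - degree p)"
    using assms by (simp add: flip_poly_def poly_monom poly_reflect_poly_nz)
  also have "\<dots> = poly p z * inverse z ^ (degree p + (d - degree p))"
    by (simp add: power_add)
  finally show ?thesis using assms by (simp add: divide_inverse power_inverse)
qed

lemma poly_flip_poly_0: "degree p \<le> d \<Longrightarrow> poly (flip_poly d p) 0 = coeff p d"
  by (cases "degree p = d") (auto simp: flip_poly_def poly_monom coeff_eq_0)

text \<open>The transition matrix of a sum of line bundles. The value 1 at \<open>Infty\<close> fits
  the convention that the basis chosen in the fibre over \<open>Infty\<close> is the one that is
  regular near \<open>Infty\<close>.\<close>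

definition twist :: "('n::finite \<Rightarrow> int) \<Rightarrow> p1 \<Rightarrow> complex^'n^'n" where
  "twist m x = (\<chi> i j. if i = j then (case x of Pt z \<Rightarrow> z powi m i | Infty \<Rightarrow> 1) else 0)"

lemma twist_Infty [simp]: "twist m Infty = mat 1"
  by (simp add: vec_eq_iff) (simp add: twist_def mat_def)

lemma invertible_twist: "x \<noteq> Pt 0 \<Longrightarrow> invertible (twist m x)"
  unfolding twist_def by (rule invertible_diagonal) (auto split: p1.splits)

lemma matrix_inv_twist: "x \<noteq> Pt 0 \<Longrightarrow> matrix_inv (twist m x) = twist (\<lambda>i. - m i) x"
  unfolding twist_def by (subst matrix_inv_diagonal)
    (auto split: p1.splits simp: power_int_minus vec_eq_iff)

lemma regular_mat_on_twist:
  assumes "Infty \<notin> U" "Pt 0 \<notin> U"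
  shows "regular_mat_on U (twist m)"
proof -
  have "regular_mat_on U (\<lambda>x. \<chi> i j. if i = j then coord_0 x powi m i else 0)"
    using assms
    by (intro regular_mat_on_diagonal regular_on_powi regular_on_coord_0) (auto simp: coord_0_def split: p1.splits)
  also have "?this \<longleftrightarrow> ?thesis"
    by (rule regular_mat_on_cong) (use assms in \<open>auto simp: twist_def vec_eq_iff split: p1.splits\<close>)
  finally show ?thesis .
qed

text \<open>An isomorphism of \<open>\<O>(m\<^sub>1) \<oplus> \<dots> \<oplus> \<O>(m\<^sub>n)\<close> with \<open>E\<close>, given by the images \<open>F\<close> of the chosen
  basis vectors of the fibres.\<close>

definition splitting :: "('n::finite) vbundle \<Rightarrow> ('n \<Rightarrow> int) \<Rightarrow> (p1 \<Rightarrow> complex^'n^'n) \<Rightarrow> bool" where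
  "splitting E m F \<longleftrightarrow> frame E (- {Infty}) F \<and> frame E (- {Pt 0}) (\<lambda>x. F x ** twist m x)"

lemma splitting_invertible: "splitting E m F \<Longrightarrow> invertible (F x)"
  by (cases x) (auto simp: splitting_def frame_def dest: bspec[of _ _ Infty])

text \<open>The Birkhoff-Grothendieck theorem. In a chart at infinity the column-reduced frame is a
  polynomial matrix over a denominator of degree \<open>e\<close>, with column degrees
  \<open>d j\<close>. Rescaling column \<open>j\<close> by \<open>z powi (e - d j)\<close> makes it
  regular at infinity, where its value is, up to a factor, the matrix of leading coefficients, and
  column reduction has made that matrix invertible.\<close>

lemma splitting_exists:
  assumes E: "vector_bundle (E :: ('n::finite) vbundle)"
  obtains m F where "splitting E m F"
proof -
  obtain F where F: "frame E (- {Infty}) F" using frame_affine[OF E] by blast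
  obtain V \<psi> where V: "(V, \<psi>) \<in> E" "Infty \<in> V" "zariski_open V" "\<And>y. y \<in> V \<Longrightarrow> invertible (\<psi> y)"
    using vector_bundle_chart[OF E] by blast
  have W: "zariski_open (- {Infty} \<inter> V)"
    using V by (intro zariski_open_Int zariski_open_cofinite) auto
  obtain z0 where "Pt z0 \<in> V" using infinite_Pt[OF V(3)] V(2) by blast
  then have W': "- {Infty} \<inter> V \<noteq> {}" by blast
  have "regular_mat_on (- {Infty} \<inter> V) (\<lambda>x. \<psi> x ** F x)" using frame_regular[OF F V(1)] .
  then obtain M q where q: "q \<noteq> 0" "\<And>z. Pt z \<in> - {Infty} \<inter> V \<Longrightarrow> poly q z \<noteq> 0"
    and M: "\<And>z. Pt z \<in> - {Infty} \<inter> V \<Longrightarrow> poly_mat M z = mat (poly q z) ** (\<psi> (Pt z) ** F (Pt z))"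
    by (rule regular_mat_fraction[OF _ W W']) blast
  have "det M \<noteq> 0"
  proof
    assume 0: "det M = 0"
    have z: "Pt z0 \<in> - {Infty} \<inter> V" using \<open>Pt z0 \<in> V\<close> by simp
    then have "invertible (poly_mat M z0)" unfolding M[OF z] using frame_invertible[OF F] V(4) q
      by (intro invertible_mult invertible_mat) auto
    with 0 show False by (metis invertible_det_nz poly_0 poly_det)
  qed
  then obtain G d where G: "\<And>z. invertible (poly_mat G z)" and d: "\<And>i j. degree ((M ** G) $ i $ j) \<le> d j"
    and lead: "det (\<chi> i j. coeff ((M ** G) $ i $ j) (d j)) \<noteq> 0"
    by (rule column_reduction) blast
  define N where "N = M ** G"
  define e where "e = degree q"
  define m where "m j = int e - int (d j)" for j
  define R where "R = (\<chi> i j. flip_poly (d j) (N $ i $ j))"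
  have R0: "invertible (poly_mat R 0)"
    using lead unfolding invertible_det_nz poly_mat_def R_def N_def by (simp add: poly_flip_poly_0 d)
  have q0: "poly (flip_poly e q) 0 \<noteq> 0" using q(1) by (simp add: poly_flip_poly_0 e_def)
  \<comment> \<open>At \<open>Infty\<close> the frame is given the limiting value of the rescaled
    matrix, transported through the chart.\<close>
  define F1 where "F1 x = (if x = Infty then matrix_inv (\<psi> x) ** (mat (inverse (poly (flip_poly e q) 0)) ** poly_mat R 0)
    else F x ** poly_mat G (coord_0 x))" for x
  have fr1: "frame E (- {Infty}) F1"
  proof (rule frame_cong)
    show "frame E (- {Infty}) (\<lambda>x. F x ** poly_mat G (coord_0 x))"
      by (intro frame_mult[OF F] zariski_open_cofinite regular_mat_on_poly_mat regular_on_coord_0 G) auto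
  qed (simp add: F1_def)
  define V0 where "V0 = V \<inter> aff_inf ` {w. poly (flip_poly e q) w \<noteq> 0}"
  have V0: "zariski_open V0" "Infty \<in> V0" "Pt 0 \<notin> V0" "V0 \<subseteq> V"
  proof -
    show "zariski_open V0" unfolding V0_def
      by (intro zariski_open_Int V zariski_open_chart_nonzero[OF _ q0]) auto
    have "Infty = aff_inf 0" by (simp add: aff_inf_def)
    with V q0 show "Infty \<in> V0" unfolding V0_def by blast
    show "Pt 0 \<notin> V0" by (auto simp: V0_def aff_inf_def split: if_splits)
  qed (simp add: V0_def)
  have key: "\<psi> x ** (F1 x ** twist m x) = mat (inverse (poly (flip_poly e q) (coord_inf x))) ** poly_mat R (coord_inf x)"
    if "x \<in> V0" for x
  proof (cases x)
    case Infty
    then show ?thesis using V by (simp add: F1_def matrix_inv_cancel)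
  next
    case (Pt z)
    have z: "z \<noteq> 0" "Pt z \<in> - {Infty} \<inter> V" using that V0 Pt by auto
    let ?T = "\<psi> x ** F x"
    have "mat (poly q z) ** (?T ** poly_mat G z) = poly_mat N z"
      by (simp add: N_def poly_mat_mult M[OF z(2)] Pt matrix_mul_assoc)
    then have "?T ** poly_mat G z = mat (inverse (poly q z)) ** poly_mat N z"
      using q(2)[OF z(2)] by (metis mat_mult_mat matrix_mul_assoc matrix_mul_lid left_inverse)
    then have "\<psi> x ** (F1 x ** twist m x) = mat (inverse (poly q z)) ** poly_mat N z ** twist m x"
      by (simp add: F1_def Pt matrix_mul_assoc)
    moreover have "(mat (inverse (poly q z)) ** poly_mat N z ** twist m x) $ i $ j
       = (mat (inverse (poly (flip_poly e q) (coord_inf x))) ** poly_mat R (coord_inf x)) $ i $ j" for i j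
    proof -
      have 1: "poly (flip_poly e q) (inverse z) = poly q z / z ^ e"
        "poly (flip_poly (d j) (N $ i $ j)) (inverse z) = poly (N $ i $ j) z / z ^ d j"
        using z d by (simp_all add: poly_flip_poly e_def N_def)
      have 2: "z powi m j = z ^ e / z ^ d j" using z by (simp add: m_def power_int_diff)
      show ?thesis
        unfolding twist_def matrix_mult_diagonal_nth mat_mult_nth using z
        by (simp add: Pt R_def 1 2 divide_inverse)
    qed
    ultimately show ?thesis by (simp add: vec_eq_iff)
  qed
  have inv: "invertible (F1 x ** twist m x)" if "x \<in> - {Pt 0}" for x
  proof (cases x)
    case Infty
    have "invertible (mat (inverse (poly (flip_poly e q) 0)) :: complex^'n^'n)"
      using q0 by (intro invertible_mat) simp
    then show ?thesis
      using R0 invertible_matrix_inv[OF V(4)[OF V(2)]] by (simp add: F1_def Infty invertible_mult)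
  next
    case (Pt z)
    with that frame_invertible[OF fr1] show ?thesis by (intro invertible_mult invertible_twist) auto
  qed
  have "frame E (- {Pt 0}) (\<lambda>x. F1 x ** twist m x)"
  proof (rule frameI[OF inv])
    fix x assume x: "x \<in> - {Pt 0}"
    show "\<exists>V G. zariski_open V \<and> x \<in> V \<and> frame E V G \<and>
      regular_mat_on (- {Pt 0} \<inter> V) (\<lambda>x. matrix_inv (G x) ** (F1 x ** twist m x))"
    proof (cases "x = Infty")
      case False
      have "regular_mat_on (- {Pt 0} \<inter> - {Infty}) (\<lambda>x. matrix_inv (F1 x) ** (F1 x ** twist m x))"
        by (subst regular_mat_on_cong[where B = "twist m"])
          (use frame_invertible[OF fr1] in \<open>auto simp: matrix_inv_cancel intro!: regular_mat_on_twist\<close>)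
      with False x fr1 show ?thesis
        by (intro exI[of _ "- {Infty}"] exI[of _ F1]) (auto intro: zariski_open_cofinite)
    next
      case True
      have "frame E V0 (\<lambda>x. matrix_inv (\<psi> x))"
        by (rule frame_subset[OF chart_frame[OF E V(1)] V0(4)])
      moreover have "regular_mat_on (- {Pt 0} \<inter> V0) (\<lambda>x. matrix_inv (matrix_inv (\<psi> x)) ** (F1 x ** twist m x))"
      proof (subst regular_mat_on_cong)
        show "matrix_inv (matrix_inv (\<psi> x)) ** (F1 x ** twist m x) = mat (inverse (poly (flip_poly e q) (coord_inf x))) ** poly_mat R (coord_inf x)"
          if "x \<in> - {Pt 0} \<inter> V0" for x
          using that key[of x] V0 V(4) by (auto simp: matrix_inv_matrix_inv)
        show "regular_mat_on (- {Pt 0} \<inter> V0) (\<lambda>x. mat (inverse (poly (flip_poly e q) (coord_inf x))) ** poly_mat R (coord_inf x))"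
          by (intro regular_mat_on_mult[OF regular_mat_on_mat] regular_mat_on_poly_mat regular_on_inverse
              regular_on_poly regular_on_coord_inf) (auto simp: V0_def coord_inf_aff_inf)
      qed
      ultimately show ?thesis using V0 True by blast
    qed
  qed
  with fr1 that show ?thesis unfolding splitting_def by blast
qed

subsection \<open>The degree\<close>

lemma sum_order_complex:
  assumes "p \<noteq> (0 :: complex poly)" "finite S" "{z. poly p z = 0} \<subseteq> S"
  shows "(\<Sum>z\<in>S. Polynomial.order z p) = degree p"
proof -
  have "(\<Sum>z\<in>S. Polynomial.order z p) = (\<Sum>z\<in>{z. poly p z = 0}. Polynomial.order z p)"
    by (rule sum.mono_neutral_right) (use assms order_0I in \<open>auto simp: order_root\<close>)
  also have "\<dots> = size (proots p)"
    unfolding size_multiset_overloaded_eq by (simp add: assms)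
  finally show ?thesis by (simp add: size_proots_complex)
qed

lemma zorder_fraction:
  assumes "finite S" "p \<noteq> 0" "q \<noteq> 0" "\<And>w. w \<notin> S \<Longrightarrow> f w = poly p w / poly q w"
  shows "zorder f a = int (Polynomial.order a p) - int (Polynomial.order a q)"
proof -
  obtain p1 where p1: "p = [:-a, 1:] ^ Polynomial.order a p * p1" "\<not> [:-a, 1:] dvd p1"
    using order_decomp[OF assms(2)] by blast
  obtain q1 where q1: "q = [:-a, 1:] ^ Polynomial.order a q * q1" "\<not> [:-a, 1:] dvd q1"
    using order_decomp[OF assms(3)] by blast
  have nz: "poly p1 a \<noteq> 0" "poly q1 a \<noteq> 0" using p1(2) q1(2) by (simp_all add: poly_eq_0_iff_dvd)
  let ?S = "insert a (- (S \<union> {w. poly q1 w = 0}))"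
  have "- (insert a (- (S \<union> {w. poly q1 w = 0}))) \<subseteq> S \<union> {w. poly q1 w = 0}" by auto
  then have "finite (- ?S)" using assms(1) finite_poly_zero[OF nz(2)] by (meson finite_UnI finite_subset)
  then have op: "open ?S" using open_Compl[OF finite_imp_closed] by fastforce
  show ?thesis
  proof (rule zorder_eqI[OF op])
    show "(\<lambda>w. poly p1 w / poly q1 w) holomorphic_on ?S"
      using nz by (intro holomorphic_intros) auto
    show "poly p1 a / poly q1 a \<noteq> 0" using nz by simp
    fix w assume w: "w \<in> ?S" "w \<noteq> a"
    have "f w = poly p w / poly q w" using w assms(4) by auto
    also have "poly p w = (w - a) ^ Polynomial.order a p * poly p1 w"
      by (subst p1(1)) simp
    also have "poly q w = (w - a) ^ Polynomial.order a q * poly q1 w"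
      by (subst q1(1)) simp
    finally show "f w = poly p1 w / poly q1 w * (w - a) powi (int (Polynomial.order a p) - int (Polynomial.order a q))"
      using w by (simp add: power_int_diff mult.commute)
  qed simp
qed

lemma splitting_det_regular:
  assumes "splitting E m F" "(V, \<phi>) \<in> E"
  shows "regular_on (V \<inter> - {Infty}) (\<lambda>x. det (\<phi> x ** F x))"
    "regular_on (V \<inter> - {Pt 0}) (\<lambda>x. det (\<phi> x ** (F x ** twist m x)))"
proof -
  have "frame E (- {Infty}) F" "frame E (- {Pt 0}) (\<lambda>x. F x ** twist m x)"
    using assms(1) unfolding splitting_def by auto
  from this[THEN frame_regular[OF _ assms(2)], THEN regular_on_det] show "regular_on (V \<inter> - {Infty}) (\<lambda>x. det (\<phi> x ** F x))"
    "regular_on (V \<inter> - {Pt 0}) (\<lambda>x. det (\<phi> x ** (F x ** twist m x)))"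
    unfolding Int_commute[of V] .
qed

lemma det_twist: "x = Pt z \<Longrightarrow> z \<noteq> 0 \<Longrightarrow> det (twist m x) = z powi (\<Sum>i\<in>UNIV. m i)"
proof -
  assume x: "x = Pt z" "z \<noteq> 0"
  have "det (twist m x) = (\<Prod>i\<in>UNIV. z powi m i)"
    unfolding twist_def by (subst det_diagonal) (auto simp: x)
  also have "\<dots> = z powi (\<Sum>i\<in>UNIV. m i)"
  proof -
    have "(\<Prod>i\<in>I. z powi m i) = z powi (\<Sum>i\<in>I. m i)" for I :: "'a set"
      by (induction I rule: infinite_finite_induct) (auto simp: power_int_add x)
    then show ?thesis .
  qed
  finally show ?thesis .
qed

lemma finite_chart_compl:
  assumes "c \<in> {aff_0, aff_inf}" "zariski_open U" "U \<noteq> {}"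
  shows "finite {w. c w \<notin> U}"
proof -
  have "finite (- U)" using assms by (simp add: zariski_open_def)
  then have "finite (c -` (- U))" by (rule finite_vimageI) (rule inj_chart[OF assms(1)])
  moreover have "c -` (- U) = {w. c w \<notin> U}" by auto
  ultimately show ?thesis by simp
qed

text \<open>The unit \<open>h\<close> will be the determinant of a frame in a chart; being regular
  and nonzero at the point, it does not affect the order, which is why the order is the same in all
  charts.\<close>

lemma zorder_unit_mult_fraction:
  assumes c: "c \<in> {aff_0, aff_inf}" and h: "regular_on V h" "zariski_open V" "c a \<in> V" "h (c a) \<noteq> 0"
    and S: "finite S" "p \<noteq> 0" "q \<noteq> 0" "\<And>w. w \<notin> S \<Longrightarrow> f (c w) = h (c w) * (poly p w / poly q w)"
  shows "zorder (\<lambda>w. f (c w)) a = int (Polynomial.order a p) - int (Polynomial.order a q)"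
proof -
  obtain r s where rs: "poly s a \<noteq> 0" "\<forall>w. c w \<in> V \<and> poly s w \<noteq> 0 \<longrightarrow> h (c w) = poly r w / poly s w"
    using h(1,3) c unfolding regular_on_def by meson
  have ra: "poly r a \<noteq> 0" using rs h by auto
  have "zorder (\<lambda>w. f (c w)) a = int (Polynomial.order a (r * p)) - int (Polynomial.order a (s * q))"
  proof (rule zorder_fraction)
    have "V \<noteq> {}" using h by blast
    then show "finite (S \<union> {w. c w \<notin> V} \<union> {w. poly s w = 0})"
      using S(1) finite_chart_compl[OF c h(2)] finite_poly_zero[OF rs(1)] by blast
    show "r * p \<noteq> 0" "s * q \<noteq> 0" using rs ra S by auto
  qed (use rs S in auto)
  also have "Polynomial.order a (r * p) = Polynomial.order a p"
    using ra S by (subst order_mult) (auto simp: order_0I)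
  also have "Polynomial.order a (s * q) = Polynomial.order a q"
    using rs S by (subst order_mult) (auto simp: order_0I)
  finally show ?thesis .
qed

text \<open>The description in \<open>section_order\<close> is definite because some chart contains
  \<open>x\<close>; only then does the condition pin down the integer.\<close>

lemma section_orderI:
  fixes s :: "p1 \<Rightarrow> complex^1"
  assumes "vector_bundle E" "\<And>V \<phi>. (V, \<phi>) \<in> E \<Longrightarrow> x \<in> V \<Longrightarrow> order_at x (\<lambda>y. det (\<phi> y) * s y $ 1) = k"
  shows "section_order (det_bundle E) s x = k"
proof -
  have eq: "(mat (det (\<phi> y)) *v s y) $ 1 = det (\<phi> y) * s y $ 1" for \<phi> y
    by (simp add: mat_mult_vec)
  have all: "(\<forall>(V, \<psi>)\<in>det_bundle E. x \<in> V \<longrightarrow> order_at x (\<lambda>y. (\<psi> y *v s y) $ 1) = k') \<longleftrightarrow>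
      (\<forall>V \<phi>. (V, \<phi>) \<in> E \<longrightarrow> x \<in> V \<longrightarrow> order_at x (\<lambda>y. det (\<phi> y) * s y $ 1) = k')" (is "?l = ?r") for k'
  proof
    assume l: ?l
    show ?r
    proof (intro allI impI)
      fix V \<phi> assume V: "(V, \<phi>) \<in> E" "x \<in> V"
      have "(V, \<lambda>y. mat (det (\<phi> y))) \<in> det_bundle E" using V by (auto simp: det_bundle_def)
      from bspec[OF l this] V show "order_at x (\<lambda>y. det (\<phi> y) * s y $ 1) = k'" by (simp only: eq prod.case)
    qed
  next
    assume r: ?r
    show ?l
    proof safe
      fix V \<psi> assume V: "(V, \<psi>) \<in> det_bundle E" "x \<in> V"
      then obtain \<phi> where "(V, \<phi>) \<in> E" "\<psi> = (\<lambda>y. mat (det (\<phi> y)))" by (auto simp: det_bundle_def)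
      with r V show "order_at x (\<lambda>y. (\<psi> y *v s y) $ 1) = k'" by (simp only: eq)
    qed
  qed
  obtain V \<phi> where V: "(V, \<phi>) \<in> E" "x \<in> V" using vector_bundle_chart[OF assms(1)] by metis
  show ?thesis
    unfolding section_order_def all
  proof (rule the_equality)
    show "\<forall>V \<phi>. (V, \<phi>) \<in> E \<longrightarrow> x \<in> V \<longrightarrow> order_at x (\<lambda>y. det (\<phi> y) * s y $ 1) = k"
      using assms(2) by simp
    fix k' assume "\<forall>V \<phi>. (V, \<phi>) \<in> E \<longrightarrow> x \<in> V \<longrightarrow> order_at x (\<lambda>y. det (\<phi> y) * s y $ 1) = k'"
    then have "order_at x (\<lambda>y. det (\<phi> y) * s y $ 1) = k'" using V by simp
    with assms(2)[OF V] show "k' = k" by metis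
  qed
qed

text \<open>Measured against \<open>det F\<close>, a rational section is a fraction
  \<open>P / Q\<close>. Its orders at finite points add up to \<open>degree P - degree Q\<close>,
  and the order at \<open>Infty\<close> is the opposite number plus the sum of the twists. The
  result is wanted for every section, since \<open>bundle_degree\<close> picks an arbitrary
  one.\<close>

lemma degree_of_section:
  assumes E: "vector_bundle E" and sp: "splitting E m F" and s: "nonzero_rational_section (det_bundle E) s"
  shows "(\<Sum>x | section_order (det_bundle E) s x \<noteq> 0. section_order (det_bundle E) s x) = (\<Sum>i\<in>UNIV. m i)"
proof -
  obtain U x0 where U: "zariski_open U" "is_section (det_bundle E) U s" "x0 \<in> U" "s x0 \<noteq> 0"
    using s unfolding nonzero_rational_section_def by blast
  have sreg: "regular_on (U \<inter> V) (\<lambda>x. det (\<phi> x) * s x $ 1)" if "(V, \<phi>) \<in> E" for V \<phi>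
  proof -
    have "(V, \<lambda>x. mat (det (\<phi> x))) \<in> det_bundle E" using that by (auto simp: det_bundle_def)
    then have "regular_vec_on (U \<inter> V) (\<lambda>x. mat (det (\<phi> x)) *v s x)"
      using U(2) unfolding is_section_def by (auto dest!: bspec[of "det_bundle E"])
    then show ?thesis unfolding regular_vec_on_def by (simp add: mat_mult_vec)
  qed
  define \<sigma> where "\<sigma> x = s x $ 1 / det (F x)" for x
  have detF: "det (F x) \<noteq> 0" for x using splitting_invertible[OF sp] by (simp add: invertible_det_nz)
  have \<sigma>reg: "regular_on (U \<inter> - {Infty}) \<sigma>"
  proof (rule regular_on_local)
    fix x assume x: "x \<in> U \<inter> - {Infty}"
    obtain V \<phi> where V: "(V, \<phi>) \<in> E" "x \<in> V" "zariski_open V" "\<And>y. y \<in> V \<Longrightarrow> invertible (\<phi> y)"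
      using vector_bundle_chart[OF E] by blast
    have nz: "det (\<phi> y) \<noteq> 0" if "y \<in> V" for y using V(4) that invertible_det_nz by blast
    let ?W = "U \<inter> - {Infty} \<inter> V"
    have "regular_on ?W (\<lambda>x. det (\<phi> x) * s x $ 1 / det (\<phi> x ** F x))"
    proof (rule regular_on_divide)
      show "regular_on ?W (\<lambda>x. det (\<phi> x) * s x $ 1)" by (rule regular_on_subset[OF sreg[OF V(1)]]) blast
      show "regular_on ?W (\<lambda>x. det (\<phi> x ** F x))"
        by (rule regular_on_subset[OF splitting_det_regular(1)[OF sp V(1)]]) blast
    qed (use nz detF in \<open>simp add: det_mul\<close>)
    also have "?this \<longleftrightarrow> regular_on ?W \<sigma>"
      by (rule regular_on_cong) (use nz detF in \<open>simp add: det_mul \<sigma>_def\<close>)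
    finally show "\<exists>V. zariski_open V \<and> x \<in> V \<and> regular_on (U \<inter> - {Infty} \<inter> V) \<sigma>" using V by blast
  qed
  have U': "zariski_open (U \<inter> - {Infty})" "U \<inter> - {Infty} \<noteq> {}"
  proof -
    show "zariski_open (U \<inter> - {Infty})" by (intro zariski_open_Int U zariski_open_cofinite) simp
    show "U \<inter> - {Infty} \<noteq> {}" using infinite_Pt[OF U(1)] U(3) by auto
  qed
  obtain P Q where Q: "Q \<noteq> 0" and PQ: "\<And>z. Pt z \<in> U \<inter> - {Infty} \<Longrightarrow> poly Q z \<noteq> 0 \<and> \<sigma> (Pt z) = poly P z / poly Q z"
    by (rule regular_on_fraction[OF \<sigma>reg U']) blast
  \<comment> \<open>The point where \<open>s\<close> is nonzero may be \<open>Infty\<close>, which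
    the fraction does not see; nonvanishing spreads to a neighbourhood, and that contains a finite
    point of \<open>U\<close>.\<close>
  have P: "P \<noteq> 0"
  proof
    assume "P = 0"
    then have z: "s (Pt z) $ 1 = 0" if "Pt z \<in> U" for z
      using PQ[of z] that detF[of "Pt z"] by (simp add: \<sigma>_def)
    obtain V \<phi> where V: "(V, \<phi>) \<in> E" "x0 \<in> V" "zariski_open V" "\<And>y. y \<in> V \<Longrightarrow> invertible (\<phi> y)"
      using vector_bundle_chart[OF E] by blast
    have "s x0 $ 1 \<noteq> 0" using U(4) by (simp add: vec_eq_iff)
    then have "det (\<phi> x0) * s x0 $ 1 \<noteq> 0" using V(2,4) invertible_det_nz by auto
    then obtain W where "zariski_open W" "x0 \<in> W" "W \<subseteq> U \<inter> V" "\<And>y. y \<in> W \<Longrightarrow> det (\<phi> y) * s y $ 1 \<noteq> 0"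
      using regular_on_nonzero_nhd[OF sreg[OF V(1)] zariski_open_Int[OF U(1) V(3)]] U(3) V(2) by auto
    with infinite_Pt[of W] z show False by fastforce
  qed
  have s\<sigma>: "s x $ 1 = det (F x) * \<sigma> x" for x using detF by (simp add: \<sigma>_def)
  have ordPt: "section_order (det_bundle E) s (Pt a) = int (Polynomial.order a P) - int (Polynomial.order a Q)" for a
  proof (rule section_orderI[OF E])
    fix V \<phi> assume V: "(V, \<phi>) \<in> E" "Pt a \<in> V"
    have V': "zariski_open V" "\<And>y. y \<in> V \<Longrightarrow> invertible (\<phi> y)"
      using E V unfolding vector_bundle_def by auto
    show "order_at (Pt a) (\<lambda>y. det (\<phi> y) * s y $ 1) = int (Polynomial.order a P) - int (Polynomial.order a Q)"
      unfolding order_at_def p1.case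
    proof (rule zorder_unit_mult_fraction[of _ _ _ _ "{w. aff_0 w \<notin> U \<inter> - {Infty}}"])
      show "regular_on (V \<inter> - {Infty}) (\<lambda>x. det (\<phi> x ** F x))" by (rule splitting_det_regular(1)[OF sp V(1)])
      show "zariski_open (V \<inter> - {Infty})" by (intro zariski_open_Int V' zariski_open_cofinite) simp
      show "det (\<phi> (aff_0 a) ** F (aff_0 a)) \<noteq> 0"
        using V'(2)[OF V(2)] detF by (simp add: aff_0_def det_mul invertible_det_nz)
      show "finite {w. aff_0 w \<notin> U \<inter> - {Infty}}" by (rule finite_chart_compl[OF _ U']) simp
      fix w assume "w \<notin> {w. aff_0 w \<notin> U \<inter> - {Infty}}"
      then have "Pt w \<in> U \<inter> - {Infty}" by (simp add: aff_0_def)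
      from PQ[OF this] show "det (\<phi> (aff_0 w)) * s (aff_0 w) $ 1 = det (\<phi> (aff_0 w) ** F (aff_0 w)) * (poly P w / poly Q w)"
        by (simp add: aff_0_def det_mul s\<sigma>)
    qed (use V P Q in \<open>auto simp: aff_0_def\<close>)
  qed
  let ?m = "\<Sum>i\<in>UNIV. m i"
  have ordInf: "section_order (det_bundle E) s Infty = ?m + int (degree Q) - int (degree P)"
  proof (rule section_orderI[OF E])
    fix V \<phi> assume V: "(V, \<phi>) \<in> E" "Infty \<in> V"
    have V': "zariski_open V" "\<And>y. y \<in> V \<Longrightarrow> invertible (\<phi> y)"
      using E V unfolding vector_bundle_def by auto
    \<comment> \<open>The twist may have either sign: one of \<open>nat ?m\<close> and
      \<open>nat (- ?m)\<close> is 0, and the other one puts the power of \<open>w\<close> on the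
      side where its exponent is a natural number.\<close>
    let ?p = "reflect_poly P * monom 1 (degree Q + nat ?m)" and ?q = "reflect_poly Q * monom 1 (degree P + nat (- ?m))"
    have pq: "?p \<noteq> 0" "?q \<noteq> 0" using P Q by simp_all
    have "zorder (\<lambda>w. det (\<phi> (aff_inf w)) * s (aff_inf w) $ 1) 0 = int (Polynomial.order 0 ?p) - int (Polynomial.order 0 ?q)"
    proof (rule zorder_unit_mult_fraction[of _ _ _ _ "insert 0 {w. aff_inf w \<notin> U \<inter> - {Infty}}"])
      show "regular_on (V \<inter> - {Pt 0}) (\<lambda>x. det (\<phi> x ** (F x ** twist m x)))" by (rule splitting_det_regular(2)[OF sp V(1)])
      show "zariski_open (V \<inter> - {Pt 0})" by (intro zariski_open_Int V' zariski_open_cofinite) simp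
      show "det (\<phi> (aff_inf 0) ** (F (aff_inf 0) ** twist m (aff_inf 0))) \<noteq> 0"
        using V'(2)[OF V(2)] detF by (simp add: aff_inf_def det_mul invertible_det_nz)
      show "finite (insert 0 {w. aff_inf w \<notin> U \<inter> - {Infty}})" using finite_chart_compl[OF _ U', of aff_inf] by simp
      fix w assume w: "w \<notin> insert 0 {w. aff_inf w \<notin> U \<inter> - {Infty}}"
      then have w0: "w \<noteq> 0" and wU: "Pt (inverse w) \<in> U \<inter> - {Infty}" by (auto simp: aff_inf_def divide_inverse)
      have "inverse w powi ?m * (poly ?p w / poly ?q w) = poly P (inverse w) / poly Q (inverse w)"
      proof -
        have 1: "poly (reflect_poly P) w = poly P (inverse w) * w ^ degree P"
          "poly (reflect_poly Q) w = poly Q (inverse w) * w ^ degree Q"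
          using w0 by (simp_all add: poly_reflect_poly_nz mult.commute)
        have 2: "inverse w powi ?m * (w ^ nat ?m / w ^ nat (- ?m)) = 1"
          using w0 by (cases "?m \<ge> 0") (simp_all add: power_int_def power_inverse)
        have "inverse w powi ?m * (poly ?p w / poly ?q w)
          = (poly P (inverse w) / poly Q (inverse w)) * (inverse w powi ?m * (w ^ nat ?m / w ^ nat (- ?m)))"
          using w0 by (simp add: poly_monom 1 power_add)
        then show ?thesis by (simp only: 2) simp
      qed
      then show "det (\<phi> (aff_inf w)) * s (aff_inf w) $ 1
          = det (\<phi> (aff_inf w) ** (F (aff_inf w) ** twist m (aff_inf w))) * (poly ?p w / poly ?q w)"
        using PQ[OF wU] w0
        by (simp add: aff_inf_def det_mul s\<sigma> divide_inverse[of 1] det_twist[OF refl] mult.assoc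
              del: poly_mult times_divide_eq_right)
    qed (use V pq in \<open>auto simp: aff_inf_def\<close>)
    also have "Polynomial.order 0 ?p = degree Q + nat ?m"
      unfolding order_mult[OF pq(1)] using P by (simp add: order_0I)
    also have "Polynomial.order 0 ?q = degree P + nat (- ?m)"
      unfolding order_mult[OF pq(2)] using Q by (simp add: order_0I)
    also have "int (degree Q + nat ?m) - int (degree P + nat (- ?m)) = ?m + int (degree Q) - int (degree P)"
      by simp
    finally show "order_at Infty (\<lambda>y. det (\<phi> y) * s y $ 1) = ?m + int (degree Q) - int (degree P)"
      by (simp add: order_at_def)
  qed
  let ?R = "{z. poly P z = 0} \<union> {z. poly Q z = 0}" and ?o = "section_order (det_bundle E) s"
  have fin: "finite ?R" using P Q poly_roots_finite by auto
  have "(\<Sum>x | ?o x \<noteq> 0. ?o x) = (\<Sum>x\<in>insert Infty (Pt ` ?R). ?o x)"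
  proof (rule sum.mono_neutral_left)
    show "{x. ?o x \<noteq> 0} \<subseteq> insert Infty (Pt ` ?R)"
    proof
      fix x assume x: "x \<in> {x. ?o x \<noteq> 0}"
      show "x \<in> insert Infty (Pt ` ?R)"
      proof (cases x)
        case (Pt a)
        with x have "Polynomial.order a P \<noteq> 0 \<or> Polynomial.order a Q \<noteq> 0" by (auto simp: ordPt)
        with Pt show ?thesis by (auto simp: order_root)
      qed simp
    qed
  qed (use fin in auto)
  also have "\<dots> = ?o Infty + (\<Sum>x\<in>Pt ` ?R. ?o x)" using fin by (subst sum.insert) auto
  also have "(\<Sum>x\<in>Pt ` ?R. ?o x) = (\<Sum>a\<in>?R. ?o (Pt a))"
    by (subst sum.reindex) (auto simp: inj_on_def)
  also have "\<dots> = int (\<Sum>a\<in>?R. Polynomial.order a P) - int (\<Sum>a\<in>?R. Polynomial.order a Q)"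
    by (simp add: ordPt sum_subtractf)
  also have "\<dots> = int (degree P) - int (degree Q)"
    using fin P Q by (simp add: sum_order_complex)
  finally show ?thesis by (simp add: ordInf)
qed

lemma bundle_degree_splitting:
  assumes E: "vector_bundle E" and sp: "splitting E m F"
  shows "bundle_degree E = (\<Sum>i\<in>UNIV. m i)"
proof -
  define s where "s x = (\<chi> i::1. det (F x))" for x
  have detF: "det (F x) \<noteq> 0" for x using splitting_invertible[OF sp] by (simp add: invertible_det_nz)
  \<comment> \<open>The existence of one section makes the \<open>SOME\<close> in
    \<open>bundle_degree\<close> a genuine choice.\<close>
  have "nonzero_rational_section (det_bundle E) s"
    unfolding nonzero_rational_section_def
  proof (intro exI[of _ "- {Infty}"] conjI bexI[of _ "Pt 0"])
    show "is_section (det_bundle E) (- {Infty}) s"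
      unfolding is_section_def
    proof safe
      fix V \<psi> assume "(V, \<psi>) \<in> det_bundle E"
      then obtain \<phi> where \<phi>: "(V, \<phi>) \<in> E" "\<psi> = (\<lambda>x. mat (det (\<phi> x)))" by (auto simp: det_bundle_def)
      have "regular_on (- {Infty} \<inter> V) (\<lambda>x. det (\<phi> x) * det (F x))"
        using splitting_det_regular(1)[OF sp \<phi>(1)] by (simp add: det_mul Int_commute)
      then show "regular_vec_on (- {Infty} \<inter> V) (\<lambda>x. \<psi> x *v s x)"
        by (simp add: regular_vec_on_def \<phi> mat_mult_vec s_def)
    qed
    show "s (Pt 0) \<noteq> 0" using detF[of "Pt 0"] by (simp add: s_def vec_eq_iff)
  qed (auto intro: zariski_open_cofinite)
  then have "nonzero_rational_section (det_bundle E) (SOME s. nonzero_rational_section (det_bundle E) s)"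
    by (rule someI[of "nonzero_rational_section (det_bundle E)"])
  from degree_of_section[OF E sp this] show ?thesis
    unfolding bundle_degree_def Let_def .
qed

subsection \<open>Sections, endomorphisms and line subbundles in a splitting\<close>

definition zpow :: "int \<Rightarrow> p1 \<Rightarrow> complex" where
  "zpow d x = (case x of Pt z \<Rightarrow> z powi d | Infty \<Rightarrow> 1)"

lemma zpow_simps [simp]: "zpow d (Pt z) = z powi d" "zpow d Infty = 1"
  by (simp_all add: zpow_def)

lemma twist_zpow: "twist m x = (\<chi> i j. if i = j then zpow (m i) x else 0)"
  by (simp add: vec_eq_iff) (simp add: twist_def zpow_def)

lemma zpow_0 [simp]: "zpow 0 x = 1"
  by (cases x) auto

lemma zpow_nonzero: "x \<noteq> Pt 0 \<Longrightarrow> zpow d x \<noteq> 0"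
  by (cases x) auto

lemma zpow_minus: "zpow (- d) x = inverse (zpow d x)"
  by (cases x) (auto simp: power_int_minus)

lemma regular_on_zpow: "Infty \<notin> U \<Longrightarrow> Pt 0 \<notin> U \<Longrightarrow> regular_on U (zpow d)"
proof -
  assume U: "Infty \<notin> U" "Pt 0 \<notin> U"
  have "regular_on U (\<lambda>x. coord_0 x powi d)"
    using U by (intro regular_on_powi regular_on_coord_0) (auto simp: coord_0_def split: p1.splits)
  also have "?this \<longleftrightarrow> ?thesis"
    by (rule regular_on_cong) (use U in \<open>auto simp: zpow_def split: p1.splits\<close>)
  finally show ?thesis .
qed

lemma splitting_frame0: "splitting E m F \<Longrightarrow> frame E (- {Infty}) F"
  and splitting_frame1: "splitting E m F \<Longrightarrow> frame E (- {Pt 0}) (\<lambda>x. F x ** twist m x)"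
  by (auto simp: splitting_def)

lemma zariski_open_charts [simp]: "zariski_open (- {Infty})" "zariski_open (- {Pt a})"
  by (auto intro: zariski_open_cofinite)

lemma not_Infty_or_not_0: "x \<in> - {Infty} \<or> x \<in> - {Pt 0}"
  by auto

lemma is_section_splitting:
  assumes "vector_bundle E" "splitting E m F"
  shows "is_section E U s \<longleftrightarrow>
     regular_vec_on (U \<inter> - {Infty}) (\<lambda>x. matrix_inv (F x) *v s x) \<and>
     regular_vec_on (U \<inter> - {Pt 0}) (\<lambda>x. matrix_inv (F x ** twist m x) *v s x)"
    (is "?l \<longleftrightarrow> ?r0 \<and> ?r1")
proof (intro iffI conjI)
  assume ?l
  then show ?r0 ?r1
    using is_section_frame[OF assms(1)] splitting_frame0[OF assms(2)] splitting_frame1[OF assms(2)] by blast+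
next
  assume r: "?r0 \<and> ?r1"
  show ?l
  proof (rule is_sectionI)
    fix x
    show "\<exists>V G. zariski_open V \<and> x \<in> V \<and> frame E V G \<and> regular_vec_on (U \<inter> V) (\<lambda>x. matrix_inv (G x) *v s x)"
      using not_Infty_or_not_0[of x]
    proof
      assume "x \<in> - {Infty}"
      with r splitting_frame0[OF assms(2)] show ?thesis
        by (intro exI[of _ "- {Infty}"] exI[of _ F]) auto
    next
      assume "x \<in> - {Pt 0}"
      with r splitting_frame1[OF assms(2)] show ?thesis
        by (intro exI[of _ "- {Pt 0}"] exI[of _ "\<lambda>x. F x ** twist m x"]) auto
    qed
  qed
qed

lemma is_section_local:
  assumes "\<And>x. x \<in> U \<Longrightarrow> \<exists>V. zariski_open V \<and> x \<in> V \<and> is_section E (U \<inter> V) s"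
  shows "is_section E U s"
  unfolding is_section_def
proof (safe intro!: regular_vec_on_local)
  fix W \<phi> x assume W: "(W, \<phi>) \<in> E" and x: "x \<in> U" "x \<in> W"
  obtain V where V: "zariski_open V" "x \<in> V" "is_section E (U \<inter> V) s" using assms x by blast
  from bspec[OF V(3)[unfolded is_section_def] W] have "regular_vec_on (U \<inter> V \<inter> W) (\<lambda>x. \<phi> x *v s x)" by simp
  moreover have "U \<inter> V \<inter> W = U \<inter> W \<inter> V" by blast
  ultimately show "\<exists>V. zariski_open V \<and> x \<in> V \<and> regular_vec_on (U \<inter> W \<inter> V) (\<lambda>x. \<phi> x *v s x)"
    using V by auto
qed

lemma is_section_regular: "is_section E U s \<Longrightarrow> (V, \<phi>) \<in> E \<Longrightarrow> regular_vec_on (U \<inter> V) (\<lambda>x. \<phi> x *v s x)"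
  unfolding is_section_def by (drule (1) bspec) simp

lemma is_section_scale:
  fixes E :: "('n::finite) vbundle"
  assumes "is_section E U s" "regular_on U f"
  shows "is_section E U (\<lambda>x. f x *s s x)"
  unfolding is_section_def
proof safe
  fix V \<phi> assume V: "(V, \<phi>) \<in> E"
  have "regular_vec_on (U \<inter> V) (\<lambda>x. f x *s (\<phi> x *v s x))"
    by (intro regular_vec_on_scale is_section_regular[OF assms(1) V] regular_on_subset[OF assms(2)]) blast
  then show "regular_vec_on (U \<inter> V) (\<lambda>x. \<phi> x *v (f x *s s x))"
    by (simp add: vector_scalar_commute)
qed

lemma is_section_cong:
  assumes "is_section E U s" "\<And>x. x \<in> U \<Longrightarrow> s x = s' x"
  shows "is_section E U s'"
  unfolding is_section_def
proof safe
  fix V \<phi> assume V: "(V, \<phi>) \<in> E"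
  have "regular_vec_on (U \<inter> V) (\<lambda>x. \<phi> x *v s x) \<longleftrightarrow> regular_vec_on (U \<inter> V) (\<lambda>x. \<phi> x *v s' x)"
    by (rule regular_vec_on_cong) (use assms(2) in auto)
  with is_section_regular[OF assms(1) V] show "regular_vec_on (U \<inter> V) (\<lambda>x. \<phi> x *v s' x)" by simp
qed

lemma is_section_subset: "is_section E U s \<Longrightarrow> V \<subseteq> U \<Longrightarrow> is_section E V s"
  unfolding is_section_def by (fast intro: regular_vec_on_subset)

section \<open>Columns of frames and endomorphisms in frames\<close>

lemma frame_columns:
  fixes F :: "p1 \<Rightarrow> complex^'n^'n"
  shows "frame E U F \<longleftrightarrow> (\<forall>x\<in>U. invertible (F x)) \<and> (\<forall>j. is_section E U (\<lambda>x. column j (F x)))"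
proof -
  have "(\<phi> ** F) $ i $ j = (\<phi> *v column j F) $ i" for \<phi> F :: "complex^'n^'n" and i j
    by (simp add: matrix_matrix_mult_def matrix_vector_mult_def column_def)
  then show ?thesis
    unfolding frame_def is_section_def regular_mat_on_def regular_vec_on_def by fastforce
qed

lemma hom_frame:
  assumes "vector_bundle E" "bundle_hom E E N" "frame E U G"
  shows "regular_mat_on U (\<lambda>x. matrix_inv (G x) ** (N x ** G x))"
proof (rule regular_mat_on_local)
  fix x assume x: "x \<in> U"
  obtain W \<phi> where W: "(W, \<phi>) \<in> E" "x \<in> W" "zariski_open W" "\<And>y. y \<in> W \<Longrightarrow> invertible (\<phi> y)"
    using vector_bundle_chart[OF assms(1)] by blast
  let ?U = "U \<inter> W"
  have N: "regular_mat_on (W \<inter> W) (\<lambda>x. \<phi> x ** N x ** matrix_inv (\<phi> x))"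
    using bspec[OF assms(2)[unfolded bundle_hom_def] W(1), simplified] W(1) by (auto dest!: bspec[of E])
  have F: "regular_mat_on ?U (\<lambda>x. \<phi> x ** G x)" by (rule frame_regular[OF assms(3) W(1)])
  have "regular_mat_on ?U (\<lambda>x. matrix_inv (\<phi> x ** G x) ** ((\<phi> x ** N x ** matrix_inv (\<phi> x)) ** (\<phi> x ** G x)))"
  proof (rule regular_mat_on_mult[OF regular_mat_on_matrix_inv regular_mat_on_mult])
    show "regular_mat_on ?U (\<lambda>x. \<phi> x ** N x ** matrix_inv (\<phi> x))" by (rule regular_mat_on_subset[OF N]) blast
  qed (use F frame_invertible[OF assms(3)] W(4) in \<open>auto intro: invertible_mult\<close>)
  also have "?this \<longleftrightarrow> regular_mat_on ?U (\<lambda>x. matrix_inv (G x) ** (N x ** G x))"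
    by (rule regular_mat_on_cong)
      (use frame_invertible[OF assms(3)] W(4) in \<open>simp add: matrix_inv_mult matrix_mul_assoc[symmetric] matrix_inv_cancel\<close>)
  finally show "\<exists>W. zariski_open W \<and> x \<in> W \<and> regular_mat_on (U \<inter> W) (\<lambda>x. matrix_inv (G x) ** (N x ** G x))"
    using W by blast
qed

lemma bundle_hom_frameI:
  assumes "\<And>x. \<exists>V G. zariski_open V \<and> x \<in> V \<and> frame E V G \<and> regular_mat_on V (\<lambda>x. matrix_inv (G x) ** (N x ** G x))"
    and "\<And>U \<phi> x. (U, \<phi>) \<in> E \<Longrightarrow> x \<in> U \<Longrightarrow> invertible (\<phi> x)"
  shows "bundle_hom E E N"
  unfolding bundle_hom_def
proof (safe intro!: regular_mat_on_local)
  fix U \<phi> U' \<psi> x assume U: "(U, \<phi>) \<in> E" "(U', \<psi>) \<in> E" and x: "x \<in> U" "x \<in> U'"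
  obtain V G where V: "zariski_open V" "x \<in> V" "frame E V G"
    and r: "regular_mat_on V (\<lambda>x. matrix_inv (G x) ** (N x ** G x))"
    using assms(1) by meson
  let ?U = "U \<inter> U' \<inter> V"
  have "regular_mat_on ?U (\<lambda>x. (\<psi> x ** G x) ** (matrix_inv (G x) ** (N x ** G x)) ** matrix_inv (\<phi> x ** G x))"
  proof (rule regular_mat_on_mult[OF regular_mat_on_mult regular_mat_on_matrix_inv])
    show "regular_mat_on ?U (\<lambda>x. \<psi> x ** G x)"
      by (rule regular_mat_on_subset[OF frame_regular[OF V(3) U(2)]]) blast
    show "regular_mat_on ?U (\<lambda>x. \<phi> x ** G x)"
      by (rule regular_mat_on_subset[OF frame_regular[OF V(3) U(1)]]) blast
    show "regular_mat_on ?U (\<lambda>x. matrix_inv (G x) ** (N x ** G x))"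
      by (rule regular_mat_on_subset[OF r]) blast
  qed (use frame_invertible[OF V(3)] assms(2)[OF U(1)] in \<open>auto intro: invertible_mult\<close>)
  also have "?this \<longleftrightarrow> regular_mat_on ?U (\<lambda>x. \<psi> x ** N x ** matrix_inv (\<phi> x))"
    by (rule regular_mat_on_cong)
      (use frame_invertible[OF V(3)] assms(2)[OF U(1)] in
        \<open>simp add: matrix_inv_mult matrix_mul_assoc[symmetric] matrix_inv_cancel\<close>)
  finally show "\<exists>V. zariski_open V \<and> x \<in> V \<and> regular_mat_on (U \<inter> U' \<inter> V) (\<lambda>x. \<psi> x ** N x ** matrix_inv (\<phi> x))"
    using V by blast
qed

text \<open>\<open>f\<close> and \<open>g\<close> are the coordinates of a section of \<open>\<O>(d)\<close> in the two charts.\<close>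

lemma twisted_polynomial:
  assumes f: "regular_on (- {Infty}) f" and g: "regular_on (- {Pt 0}) g"
    and fg: "\<And>z. z \<noteq> 0 \<Longrightarrow> g (Pt z) = z powi (- d) * f (Pt z)"
  obtains p where "\<And>z. f (Pt z) = poly p z" "p \<noteq> 0 \<Longrightarrow> int (degree p) \<le> d"
    "g Infty = (if d < 0 then 0 else coeff p (nat d))"
proof -
  obtain p where p: "\<And>z. f (Pt z) = poly p z" using regular_on_affine[OF f] by blast
  have I: "Infty \<in> - {Pt 0}" by simp
  show ?thesis
  proof (cases "d < 0")
    case True
    \<comment> \<open>For negative \<open>d\<close> the polynomial \<open>z ^ (-d) * p\<close>
      itself is regular at \<open>Infty\<close>, so it has degree at most 0, which forces
      \<open>p = 0\<close>.\<close>
    have *: "g (Pt z) = poly (monom 1 (nat (- d)) * p) z / poly 1 z" if "Pt z \<in> - {Pt 0}" for z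
      using that True by (simp add: fg p poly_monom power_int_def)
    note deg = regular_at_Infty_fraction[OF g zariski_open_charts(2) I one_neq_zero *]
    have "p = 0"
    proof (rule ccontr)
      assume "p \<noteq> 0"
      then have "degree (monom 1 (nat (- d)) * p) = nat (- d) + degree p"
        by (simp add: degree_mult_eq degree_monom_eq)
      with deg(1) True show False by simp
    qed
    moreover from this have "g Infty = 0" using deg(2) by simp
    ultimately show ?thesis using p True by (intro that[of p]) auto
  next
    case False
    have *: "g (Pt z) = poly p z / poly (monom 1 (nat d)) z" if "Pt z \<in> - {Pt 0}" for z
      using that False by (simp add: fg p poly_monom power_int_def divide_inverse power_inverse)
    have ne: "monom 1 (nat d) \<noteq> (0 :: complex poly)" by simp
    note deg = regular_at_Infty_fraction[OF g zariski_open_charts(2) I ne *]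
    have "degree p \<le> nat d" "g Infty = coeff p (nat d)" using deg by (simp_all add: degree_monom_eq)
    with p that False show ?thesis by auto
  qed
qed

lemma span_singleton_eq: "vec.span {v} = range (\<lambda>k. k *s v)" for v :: "'a::field^'n"
  by (rule vec.span_singleton)

lemma column_nonzero:
  fixes A :: "complex^'n^'n"
  assumes "invertible A"
  shows "column j A \<noteq> 0"
proof
  assume "column j A = 0"
  then have "row j (transpose A) = 0" by simp
  then have "det (transpose A) = 0" by (rule det_zero_row)
  with assms show False by (simp add: invertible_det_nz det_transpose)
qed

lemma span_scale:
  fixes v :: "'a::field^'n"
  assumes "c \<noteq> 0"
  shows "vec.span {c *s v} = vec.span {v}"
proof -
  have "k *s v = (k / c) *s (c *s v)" for k using assms by simp
  then have "vec.span {v} \<subseteq> vec.span {c *s v}" unfolding span_singleton_eq by blast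
  moreover have "vec.span {c *s v} \<subseteq> vec.span {v}" unfolding span_singleton_eq by auto
  ultimately show ?thesis by blast
qed

lemma line_subbundle_splitting:
  assumes "splitting E m F"
  shows "line_subbundle E (\<lambda>x. vec.span {column j (F x)})"
  unfolding line_subbundle_def
proof
  fix x
  note nz = column_nonzero[of _ j]
  have col: "column j (F x ** twist m x) = zpow (m j) x *s column j (F x)" for x
    by (simp add: vec_eq_iff column_def twist_zpow matrix_mult_diagonal_nth mult.commute)
  show "\<exists>U s. zariski_open U \<and> x \<in> U \<and> is_section E U s \<and>
             (\<forall>y\<in>U. s y \<noteq> 0 \<and> vec.span {column j (F y)} = vec.span {s y})"
    using not_Infty_or_not_0[of x]
  proof
    assume "x \<in> - {Infty}"
    with splitting_frame0[OF assms] nz[OF splitting_invertible[OF assms]] show ?thesis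
      unfolding frame_columns by (intro exI[of _ "- {Infty}"] exI[of _ "\<lambda>x. column j (F x)"]) auto
  next
    assume "x \<in> - {Pt 0}"
    moreover have "is_section E (- {Pt 0}) (\<lambda>x. zpow (m j) x *s column j (F x))"
      using splitting_frame1[OF assms] unfolding frame_columns col[symmetric] by blast
    ultimately show ?thesis using nz[OF splitting_invertible[OF assms]]
      by (intro exI[of _ "- {Pt 0}"] exI[of _ "\<lambda>x. zpow (m j) x *s column j (F x)"])
        (auto simp: span_scale zpow_nonzero)
  qed
qed

text \<open>Near a given point some coordinate of \<open>s'\<close> in a chart does not vanish, and
  \<open>h\<close> is the quotient of the corresponding coordinates of \<open>s\<close> and
  \<open>s'\<close>.\<close>

lemma section_ratio_regular:
  assumes E: "vector_bundle E" and s: "is_section E U s" "zariski_open U" and s': "is_section E V s'" "zariski_open V"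
    and h: "\<And>x. x \<in> U \<inter> V \<Longrightarrow> s x = h x *s s' x" "\<And>x. x \<in> U \<inter> V \<Longrightarrow> s' x \<noteq> 0"
  shows "regular_on (U \<inter> V) h"
proof (rule regular_on_local)
  fix x assume x: "x \<in> U \<inter> V"
  obtain W \<phi> where W: "(W, \<phi>) \<in> E" "x \<in> W" "zariski_open W" "\<And>y. y \<in> W \<Longrightarrow> invertible (\<phi> y)"
    using vector_bundle_chart[OF E] by blast
  have "\<phi> x *v s' x \<noteq> 0"
  proof
    assume "\<phi> x *v s' x = 0"
    then have "matrix_inv (\<phi> x) *v (\<phi> x *v s' x) = 0" by simp
    with h(2)[OF x] W(2,4) show False by (simp add: matrix_inv_cancel_vec)
  qed
  then obtain i where i: "(\<phi> x *v s' x) $ i \<noteq> 0" by (auto simp: vec_eq_iff)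
  have r: "regular_on (U \<inter> W) (\<lambda>x. (\<phi> x *v s x) $ i)" "regular_on (V \<inter> W) (\<lambda>x. (\<phi> x *v s' x) $ i)"
    using is_section_regular[OF s(1) W(1)] is_section_regular[OF s'(1) W(1)] by (auto simp: regular_vec_on_def)
  from regular_on_nonzero_nhd[OF r(2) zariski_open_Int[OF s'(2) W(3)] _ i] x W(2)
  obtain W' where W': "zariski_open W'" "x \<in> W'" "W' \<subseteq> V \<inter> W" "\<And>y. y \<in> W' \<Longrightarrow> (\<phi> y *v s' y) $ i \<noteq> 0"
    by auto
  let ?U = "U \<inter> V \<inter> W'"
  have "regular_on ?U (\<lambda>x. (\<phi> x *v s x) $ i / (\<phi> x *v s' x) $ i)"
  proof (rule regular_on_divide)
    show "regular_on ?U (\<lambda>x. (\<phi> x *v s x) $ i)" by (rule regular_on_subset[OF r(1)]) (use W' in blast)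
    show "regular_on ?U (\<lambda>x. (\<phi> x *v s' x) $ i)" by (rule regular_on_subset[OF r(2)]) (use W' in blast)
  qed (use W' in blast)
  also have "?this \<longleftrightarrow> regular_on ?U h"
    by (rule regular_on_cong) (use h(1) W'(4) in \<open>simp add: vector_scalar_commute\<close>)
  finally show "\<exists>W. zariski_open W \<and> x \<in> W \<and> regular_on (U \<inter> V \<inter> W) h" using W' by blast
qed

text \<open>A line subbundle \<open>L\<close> is a line bundle, hence isomorphic to some \<open>\<O>(d)\<close>: a basis \<open>l\<close> of the
  fibres is chosen, and the local generators of \<open>L\<close> are the charts.\<close>

lemma line_subbundle_generator:
  fixes E :: "('n::finite) vbundle"
  assumes E: "vector_bundle E" and L: "line_subbundle E L"
  obtains d s where "is_section E (- {Infty}) s" "is_section E (- {Pt 0}) (\<lambda>x. zpow d x *s s x)"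
    "\<And>x. s x \<noteq> 0" "\<And>x. L x = vec.span {s x}"
proof -
  define gen where "gen U s \<longleftrightarrow> zariski_open U \<and> is_section E U s \<and> (\<forall>y\<in>U. s y \<noteq> 0 \<and> L y = vec.span {s y})" for U s
  have gen_ex: "\<exists>U s. x \<in> U \<and> gen U s" for x
    using L unfolding line_subbundle_def gen_def by blast
  then have "\<exists>v. v \<noteq> 0 \<and> L x = vec.span {v}" for x
    unfolding gen_def by metis
  then obtain l where l: "\<And>x. l x \<noteq> 0" "\<And>x. L x = vec.span {l x}" by metis
  \<comment> \<open>The coordinate of the arbitrarily chosen basis vector \<open>l x\<close> with
    respect to the local generator \<open>s\<close>; it serves as the chart of the line bundle
    \<open>B\<close>.\<close>
  define \<kappa> where "\<kappa> s x = (SOME k. l x = k *s s x)" for s x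
  have \<kappa>: "l x = \<kappa> s x *s s x" "\<kappa> s x \<noteq> 0" if "gen U s" "x \<in> U" for U s x
  proof -
    have "l x \<in> vec.span {s x}" using that l unfolding gen_def by (metis vec.span_base singletonI)
    then have "\<exists>k. l x = k *s s x" unfolding span_singleton_eq by auto
    then show 1: "l x = \<kappa> s x *s s x" unfolding \<kappa>_def by (rule someI_ex)
    then show "\<kappa> s x \<noteq> 0" using l(1)[of x] by auto
  qed
  define B where "B = {(U, (\<lambda>x. mat (\<kappa> s x)) :: p1 \<Rightarrow> complex^1^1) | U s. gen U s}"
  have inv_mat: "matrix_inv (mat c :: complex^1^1) = mat (inverse c)" if "c \<noteq> 0" for c
    by (rule matrix_inv_unique) (use that in \<open>simp add: mat_mult_mat\<close>)
  have B: "vector_bundle B"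
    unfolding vector_bundle_def
  proof (intro conjI)
    show "\<forall>(U, \<phi>)\<in>B. zariski_open U \<and> (\<forall>x\<in>U. invertible (\<phi> x))"
      using \<kappa>(2) by (auto simp: B_def gen_def intro!: invertible_mat)
    have "x \<in> (\<Union>(U, \<phi>)\<in>B. U)" for x using gen_ex[of x] by (auto simp: B_def)
    then show "(\<Union>(U, \<phi>)\<in>B. U) = UNIV" by blast
    show "\<forall>(U, \<phi>)\<in>B. \<forall>(V, \<psi>)\<in>B. regular_mat_on (U \<inter> V) (\<lambda>x. \<psi> x ** matrix_inv (\<phi> x))"
    proof safe
      fix U \<phi> V \<psi> assume "(U, \<phi>) \<in> B" "(V, \<psi>) \<in> B"
      then obtain s s' where s: "gen U s" "\<phi> = (\<lambda>x. mat (\<kappa> s x))" and s': "gen V s'" "\<psi> = (\<lambda>x. mat (\<kappa> s' x))"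
        by (auto simp: B_def)
      have "regular_on (U \<inter> V) (\<lambda>x. \<kappa> s' x * inverse (\<kappa> s x))"
      proof (rule section_ratio_regular[OF E])
        show "is_section E U s" "zariski_open U" "is_section E V s'" "zariski_open V"
          using s s' by (auto simp: gen_def)
        fix x assume x: "x \<in> U \<inter> V"
        then have "\<kappa> s x *s s x = \<kappa> s' x *s s' x" using \<kappa>(1) s(1) s'(1) by (metis IntE)
        then have "inverse (\<kappa> s x) *s (\<kappa> s x *s s x) = inverse (\<kappa> s x) *s (\<kappa> s' x *s s' x)" by simp
        then show "s x = (\<kappa> s' x * inverse (\<kappa> s x)) *s s' x"
          using \<kappa>(2)[OF s(1)] x by (simp add: mult.commute)
        show "s' x \<noteq> 0" using s' x by (simp add: gen_def)
      qed
      then have "regular_mat_on (U \<inter> V) (\<lambda>x. mat (\<kappa> s' x * inverse (\<kappa> s x)) :: complex^1^1)" by (rule regular_mat_on_mat)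
      also have "?this \<longleftrightarrow> regular_mat_on (U \<inter> V) (\<lambda>x. \<psi> x ** matrix_inv (\<phi> x))"
        by (rule regular_mat_on_cong) (use \<kappa>(2)[OF s(1)] in \<open>simp add: s s' inv_mat mat_mult_mat\<close>)
      finally show "regular_mat_on (U \<inter> V) (\<lambda>x. \<psi> x ** matrix_inv (\<phi> x))" .
    qed
  qed
  \<comment> \<open>The splitting theorem in rank 1 merges the local generators into one over each
    of the two standard open sets.\<close>
  obtain m f where sp: "splitting B m f" by (rule splitting_exists[OF B]) blast
  define s where "s x = f x $ 1 $ 1 *s l x" for x
  have nz: "f x $ 1 $ 1 \<noteq> 0" for x
    using splitting_invertible[OF sp, of x] by (simp add: invertible_det_nz det_1)
  have secI: "is_section E W (\<lambda>x. a x *s l x)"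
    if a: "frame B W (\<lambda>x. mat (a x))" for W a
  proof (rule is_section_local)
    fix x assume "x \<in> W"
    obtain U s0 where U: "x \<in> U" "gen U s0" using gen_ex by blast
    have "(U, \<lambda>x. mat (\<kappa> s0 x)) \<in> B" using U by (auto simp: B_def)
    from frame_regular[OF a this] have "regular_mat_on (W \<inter> U) (\<lambda>x. mat (\<kappa> s0 x * a x) :: complex^1^1)"
      by (simp add: mat_mult_mat)
    then have r: "regular_on (W \<inter> U) (\<lambda>x. \<kappa> s0 x * a x)"
      unfolding regular_mat_on_def by (simp add: mat_def)
    have "is_section E (W \<inter> U) s0" using U is_section_subset unfolding gen_def by blast
    from is_section_scale[OF this r] have "is_section E (W \<inter> U) (\<lambda>x. a x *s l x)"
      by (rule is_section_cong) (use \<kappa>(1)[OF U(2)] in \<open>simp add: mult.commute\<close>)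
    then show "\<exists>V. zariski_open V \<and> x \<in> V \<and> is_section E (W \<inter> V) (\<lambda>x. a x *s l x)"
      using U unfolding gen_def by blast
  qed
  have mat1: "A = mat (A $ 1 $ 1)" for A :: "complex^1^1"
    by (simp add: vec_eq_iff forall_1 mat_def)
  show ?thesis
  proof (rule that[of s "m 1"])
    have "frame B (- {Infty}) (\<lambda>x. mat (f x $ 1 $ 1))" using splitting_frame0[OF sp] mat1 by simp
    then show "is_section E (- {Infty}) s" unfolding s_def by (rule secI)
    have "frame B (- {Pt 0}) (\<lambda>x. mat (zpow (m 1) x * f x $ 1 $ 1))"
    proof (rule frame_cong[OF splitting_frame1[OF sp]])
      fix x
      have "f x ** twist m x = mat ((f x ** twist m x) $ 1 $ 1)" by (rule mat1)
      then show "f x ** twist m x = mat (zpow (m 1) x * f x $ 1 $ 1)"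
        by (simp add: twist_zpow matrix_mult_diagonal_nth mult.commute)
    qed
    from secI[OF this] show "is_section E (- {Pt 0}) (\<lambda>x. zpow (m 1) x *s s x)" by (simp add: s_def)
    show "s x \<noteq> 0" for x using nz[of x] l(1)[of x] by (simp add: s_def vec_eq_iff)
    show "L x = vec.span {s x}" for x
      using nz[of x] by (simp add: l(2) s_def span_scale)
  qed
qed

section \<open>Decomposable and simple quasiparabolic bundles\<close>

lemma mult_vec_columns2: "A *v v = v $ 1 *s column 1 A + v $ 2 *s column 2 A" for A :: "'a::comm_ring_1^2^'n"
  by (simp add: vec_eq_iff matrix_vector_mult_def column_def sum_2 mult.commute)

lemma column_mult: "column j (A ** B) = A *v column j B"
  by (simp add: vec_eq_iff column_def matrix_matrix_mult_def matrix_vector_mult_def)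

lemma direct_sum_columns:
  assumes "\<And>x. invertible (F x :: complex^2^2)"
  shows "internal_direct_sum (\<lambda>x. vec.span {column 1 (F x)}) (\<lambda>x. vec.span {column 2 (F x)})"
  unfolding internal_direct_sum_def
proof (intro allI conjI)
  fix x
  show "vec.span {column 1 (F x)} \<inter> vec.span {column 2 (F x)} = {0}"
  proof
    show "vec.span {column 1 (F x)} \<inter> vec.span {column 2 (F x)} \<subseteq> {0}"
    proof
      fix v assume "v \<in> vec.span {column 1 (F x)} \<inter> vec.span {column 2 (F x)}"
      then have "v \<in> range (\<lambda>k. k *s column 1 (F x))" "v \<in> range (\<lambda>k. k *s column 2 (F x))"
        unfolding span_singleton_eq by simp_all
      then obtain k l where kl: "v = k *s column 1 (F x)" "v = l *s column 2 (F x)" by blast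
      have "F x *v vector [k, - l] = 0"
        using kl by (simp add: mult_vec_columns2 vector_smult_lneg)
      then have "matrix_inv (F x) *v (F x *v vector [k, - l]) = 0" by simp
      then have "vector [k, - l] = (0 :: complex^2)" using assms by (simp add: matrix_inv_cancel_vec)
      then have "k = 0" by (simp add: vec_eq_iff forall_2)
      with kl show "v \<in> {0}" by simp
    qed
  qed (auto simp: vec.span_zero)
  show "{v + w |v w. v \<in> vec.span {column 1 (F x)} \<and> w \<in> vec.span {column 2 (F x)}} = UNIV"
  proof (intro equalityI subsetI)
    fix v :: "complex^2"
    have "v = F x *v (matrix_inv (F x) *v v)" using assms by (simp add: matrix_inv_cancel_vec)
    then have "\<exists>a b. v = a *s column 1 (F x) + b *s column 2 (F x)" unfolding mult_vec_columns2[of "F x"] by blast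
    then show "v \<in> {v + w |v w. v \<in> vec.span {column 1 (F x)} \<and> w \<in> vec.span {column 2 (F x)}}"
      unfolding span_singleton_eq by blast
  qed simp
qed

text \<open>Generators of the two summands, placed side by side, form the columns of a splitting
  whose twists are the degrees of the summands.\<close>

lemma decomposable_iff_splitting:
  assumes E: "vector_bundle E"
  shows "decomposable_qp t E P \<longleftrightarrow> (\<exists>m F. splitting E m F \<and>
    (\<forall>i. P i = vec.span {column 1 (F (Pt (t i)))} \<or> P i = vec.span {column 2 (F (Pt (t i)))}))"
    (is "_ \<longleftrightarrow> ?R")
proof
  assume "decomposable_qp t E P"
  then obtain L M where L: "line_subbundle E L" "line_subbundle E M" and LM: "internal_direct_sum L M"
    and P: "\<And>i. P i = L (Pt (t i)) \<or> P i = M (Pt (t i))"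
    unfolding decomposable_qp_def by blast
  obtain d s where s: "is_section E (- {Infty}) s" "is_section E (- {Pt 0}) (\<lambda>x. zpow d x *s s x)"
    "\<And>x. s x \<noteq> 0" "\<And>x. L x = vec.span {s x}"
    using line_subbundle_generator[OF E L(1)] by metis
  obtain d' s' where s': "is_section E (- {Infty}) s'" "is_section E (- {Pt 0}) (\<lambda>x. zpow d' x *s s' x)"
    "\<And>x. s' x \<noteq> 0" "\<And>x. M x = vec.span {s' x}"
    using line_subbundle_generator[OF E L(2)] by metis
  define F :: "p1 \<Rightarrow> complex^2^2" where "F x = (\<chi> i j. if j = 1 then s x $ i else s' x $ i)" for x
  define m :: "2 \<Rightarrow> int" where "m i = (if i = 1 then d else d')" for i
  have col: "column 1 (F x) = s x" "column 2 (F x) = s' x" for x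
    by (simp_all add: F_def column_def vec_eq_iff)
  have col': "column 1 (F x ** twist m x) = zpow d x *s s x" "column 2 (F x ** twist m x) = zpow d' x *s s' x" for x
    by (simp_all add: vec_eq_iff column_def twist_zpow matrix_mult_diagonal_nth mult.commute)
      (simp_all add: F_def m_def)
  \<comment> \<open>A vector in the kernel yields an element common to both lines, which is 0 in a
    direct sum.\<close>
  have inv: "invertible (F x)" for x
    unfolding invertible_left_inverse matrix_left_invertible_ker
  proof (intro allI impI)
    fix v assume "F x *v v = 0"
    then have eq: "v $ 1 *s s x = - (v $ 2) *s s' x"
      by (simp add: mult_vec_columns2 col eq_neg_iff_add_eq_0 vector_smult_lneg)
    have "v $ 1 *s s x \<in> L x" "- (v $ 2) *s s' x \<in> M x"
      unfolding s(4) s'(4) span_singleton_eq by blast+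
    with eq have "v $ 1 *s s x \<in> L x \<inter> M x" by simp
    then have "v $ 1 *s s x = 0" using LM unfolding internal_direct_sum_def by blast
    with eq s(3) s'(3) have "v $ 1 = 0" "v $ 2 = 0" by (simp_all add: vector_smult_lneg)
    then show "v = 0" by (simp add: vec_eq_iff forall_2)
  qed
  have "splitting E m F"
    unfolding splitting_def frame_columns forall_2 col col'
    using s s' inv by (auto intro!: invertible_mult invertible_twist)
  with P show ?R unfolding s(4) s'(4) using col by (metis (no_types, lifting))
next
  assume ?R
  then obtain m F where sp: "splitting E m F"
    and P: "\<forall>i. P i = vec.span {column 1 (F (Pt (t i)))} \<or> P i = vec.span {column 2 (F (Pt (t i)))}" by blast
  show "decomposable_qp t E P"
    unfolding decomposable_qp_def
    by (intro exI conjI) (rule line_subbundle_splitting[OF sp] direct_sum_columns[OF splitting_invertible[OF sp]] P)+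
qed

lemma vector_bundle_invertible: "vector_bundle E \<Longrightarrow> (U, \<phi>) \<in> E \<Longrightarrow> x \<in> U \<Longrightarrow> invertible (\<phi> x)"
proof -
  assume E: "vector_bundle E" and U: "(U, \<phi>) \<in> E" "x \<in> U"
  have "\<forall>(U, \<phi>)\<in>E. zariski_open U \<and> (\<forall>x\<in>U. invertible (\<phi> x))"
    using E unfolding vector_bundle_def by (rule conjunct1)
  from bspec[OF this U(1)] U(2) show "invertible (\<phi> x)" by simp
qed

lemma simple_imp_indecomposable:
  assumes E: "vector_bundle E" and simple: "simple_qp t E P"
  shows "\<not> decomposable_qp t E P"
proof
  assume "decomposable_qp t E P"
  then obtain m F where sp: "splitting E m F"
    and P: "\<And>i. P i = vec.span {column 1 (F (Pt (t i)))} \<or> P i = vec.span {column 2 (F (Pt (t i)))}"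
    unfolding decomposable_iff_splitting[OF E] by blast
  define D :: "complex^2^2" where "D = (\<chi> i j. if i = j then if i = 1 then 1 else 0 else 0)"
  define N where "N x = F x ** D ** matrix_inv (F x)" for x
  have inv: "invertible (F x)" for x by (rule splitting_invertible[OF sp])
  have N: "N x ** F x = F x ** D" for x
    using inv by (simp add: N_def matrix_mul_assoc[symmetric] matrix_inv_left)
  have "N x *v column j (F x) = column j (F x ** D)" for x j
    by (simp only: column_mult[symmetric] N)
  moreover have "column 1 (F x ** D) = column 1 (F x)" "column 2 (F x ** D) = 0" for x
    unfolding D_def column_def by (simp_all add: vec_eq_iff matrix_mult_diagonal_nth)
  ultimately have Nc: "N x *v column 1 (F x) = column 1 (F x)" "N x *v column 2 (F x) = 0" for x by simp_all
  have "bundle_hom E E N"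
  proof (rule bundle_hom_frameI)
    fix x
    show "\<exists>V G. zariski_open V \<and> x \<in> V \<and> frame E V G \<and> regular_mat_on V (\<lambda>x. matrix_inv (G x) ** (N x ** G x))"
      using not_Infty_or_not_0[of x]
    proof
      assume "x \<in> - {Infty}"
      with splitting_frame0[OF sp] inv show ?thesis
        by (intro exI[of _ "- {Infty}"] exI[of _ F]) (simp add: N matrix_inv_cancel)
    next
      assume x: "x \<in> - {Pt 0}"
      have "regular_mat_on (- {Pt 0}) (\<lambda>x. matrix_inv (F x ** twist m x) ** (N x ** (F x ** twist m x)))"
      proof (subst regular_mat_on_cong)
        fix y assume y: "y \<in> - {Pt 0}"
        \<comment> \<open>Diagonal matrices commute, so the projection has the constant matrix
          \<open>D\<close> in the frame at infinity as well.\<close>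
        have "D ** twist m y = twist m y ** D"
          unfolding vec_eq_iff twist_zpow matrix_mult_diagonal_nth matrix_diagonal_mult_nth D_def by simp
        then show "matrix_inv (F y ** twist m y) ** (N y ** (F y ** twist m y)) = D"
          using y inv by (simp add: matrix_inv_mult invertible_twist matrix_mul_assoc N)
            (simp add: matrix_mul_assoc[symmetric] matrix_inv_cancel invertible_twist)
      qed simp
      with x splitting_frame1[OF sp] show ?thesis
        by (intro exI[of _ "- {Pt 0}"] exI[of _ "\<lambda>x. F x ** twist m x"]) simp
    qed
  qed (rule vector_bundle_invertible[OF E])
  moreover have "(\<lambda>v. N (Pt (t i)) *v v) ` P i \<subseteq> P i" for i
    using P[of i] by (auto simp: span_singleton_eq vector_scalar_commute Nc image_iff)
  ultimately obtain c where c: "\<And>x. N x = mat c" using simple unfolding simple_qp_def by blast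
  have "c *s column 1 (F Infty) = column 1 (F Infty)" "c *s column 2 (F Infty) = 0"
    using Nc[of Infty] by (simp_all add: c mat_mult_vec)
  with column_nonzero[OF inv[of Infty]] show False by auto
qed

section \<open>Quasiparabolic structures on \<open>B\<close>\<close>

lemma vec2_diag: "vector [vector [a, 0], vector [0, b]] =
    ((\<chi> i j. if i = j then if i = 1 then a else b else 0) :: 'a::zero^2^2)"
  by (simp add: vec_eq_iff forall_2)

lemma line_O_chart:
  assumes "(V, \<theta>) \<in> line_O d"
  shows "V = - {Infty} \<and> \<theta> = (\<lambda>_. mat 1) \<or> V = - {Pt 0} \<and> \<theta> = (\<lambda>x. mat (zpow (- d) x))"
  using assms by (auto simp: line_O_def zpow_def)

lemma line_O_chart_regular:
  fixes \<theta> :: "p1 \<Rightarrow> complex^1^1"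
  assumes "(V, \<theta>) \<in> line_O d"
  shows "x \<in> V \<Longrightarrow> \<theta> x $ 1 $ 1 \<noteq> 0" "regular_on (V \<inter> - {Infty}) (\<lambda>x. \<theta> x $ 1 $ 1)"
    "regular_on (V \<inter> - {Pt 0}) (\<lambda>x. \<theta> x $ 1 $ 1 * zpow d x)"
proof -
  have "(x \<in> V \<longrightarrow> \<theta> x $ 1 $ 1 \<noteq> 0) \<and> regular_on (V \<inter> - {Infty}) (\<lambda>x. \<theta> x $ 1 $ 1) \<and>
    regular_on (V \<inter> - {Pt 0}) (\<lambda>x. \<theta> x $ 1 $ 1 * zpow d x)"
    using line_O_chart[OF assms]
  proof
    assume *: "V = - {Infty} \<and> \<theta> = (\<lambda>_. mat 1)"
    then show ?thesis by (auto simp: mat_def intro!: regular_on_zpow)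
  next
    assume *: "V = - {Pt 0} \<and> \<theta> = (\<lambda>x. mat (zpow (- d) x))"
    have "regular_on (- {Pt 0}) (\<lambda>x. zpow (- d) x * zpow d x)"
      by (subst regular_on_cong[where g = "\<lambda>_. 1"]) (auto simp: zpow_minus zpow_nonzero)
    with * show ?thesis by (auto simp: mat_def zpow_nonzero intro!: regular_on_zpow)
  qed
  then show "x \<in> V \<Longrightarrow> \<theta> x $ 1 $ 1 \<noteq> 0" "regular_on (V \<inter> - {Infty}) (\<lambda>x. \<theta> x $ 1 $ 1)"
    "regular_on (V \<inter> - {Pt 0}) (\<lambda>x. \<theta> x $ 1 $ 1 * zpow d x)" by auto
qed

lemma line_sumI:
  assumes "(U, \<phi>) \<in> L" "(V, \<psi>) \<in> M"
  shows "(U \<inter> V, \<lambda>x. vector [vector [\<phi> x $ 1 $ 1, 0], vector [0, \<psi> x $ 1 $ 1]]) \<in> line_sum L M"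
  unfolding line_sum_def by (rule CollectI, intro exI conjI, rule refl, rule assms(1), rule assms(2))

lemma line_O_charts:
  "(- {Infty}, \<lambda>_. mat 1) \<in> line_O d" "(- {Pt 0}, \<lambda>x. mat (zpow (- d) x)) \<in> line_O d"
  by (simp_all add: line_O_def zpow_def)

lemma line_sum_charts:
  "(- {Infty}, \<lambda>_. mat 1) \<in> line_sum (line_O (m 1)) (line_O (m 2))"
  "(- {Pt 0}, twist (\<lambda>i. - m i)) \<in> line_sum (line_O (m 1)) (line_O (m (2::2)))"
proof -
  show "(- {Infty}, \<lambda>_. mat 1) \<in> line_sum (line_O (m 1)) (line_O (m 2))"
  proof -
    have "(- {Infty} \<inter> - {Infty}, \<lambda>x. vector [vector [(mat 1 :: complex^1^1) $ 1 $ 1, 0], vector [0, (mat 1 :: complex^1^1) $ 1 $ 1]]) \<in> line_sum (line_O (m 1)) (line_O (m 2))"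
      by (rule line_sumI; rule line_O_charts)
    moreover have "vector [vector [(mat 1 :: complex^1^1) $ 1 $ 1, 0], vector [0, (mat 1 :: complex^1^1) $ 1 $ 1]] = (mat 1 :: complex^2^2)"
      unfolding vec2_diag by (simp add: vec_eq_iff mat_def)
    ultimately show ?thesis by simp
  qed
  show "(- {Pt 0}, twist (\<lambda>i. - m i)) \<in> line_sum (line_O (m 1)) (line_O (m 2))"
  proof -
    have "(- {Pt 0} \<inter> - {Pt 0}, \<lambda>x. vector [vector [(mat (zpow (- m 1) x) :: complex^1^1) $ 1 $ 1, 0],
        vector [0, (mat (zpow (- m 2) x) :: complex^1^1) $ 1 $ 1]]) \<in> line_sum (line_O (m 1)) (line_O (m 2))"
      by (rule line_sumI; rule line_O_charts)
    moreover have "vector [vector [(mat (zpow (- m 1) x) :: complex^1^1) $ 1 $ 1, 0],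
        vector [0, (mat (zpow (- m 2) x) :: complex^1^1) $ 1 $ 1]] = twist (\<lambda>i. - m i) x" for x
      unfolding vec2_diag twist_zpow by (simp add: vec_eq_iff mat_def forall_2)
    ultimately show ?thesis by simp
  qed
qed

lemma line_sum_chart:
  assumes "(V, \<psi>) \<in> line_sum (line_O (m 1)) (line_O (m (2::2)))"
  shows "x \<in> V \<Longrightarrow> invertible (\<psi> x)" "regular_mat_on (V \<inter> - {Infty}) \<psi>"
    "regular_mat_on (V \<inter> - {Pt 0}) (\<lambda>x. \<psi> x ** twist m x)"
proof -
  obtain V1 \<theta>1 V2 \<theta>2 where V: "V = V1 \<inter> V2" "(V1, \<theta>1) \<in> line_O (m 1)" "(V2, \<theta>2) \<in> line_O (m 2)"
    and \<psi>: "\<psi> = (\<lambda>x. vector [vector [\<theta>1 x $ 1 $ 1, 0], vector [0, \<theta>2 x $ 1 $ 1]])"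
    using assms by (auto simp: line_sum_def)
  note r1 = line_O_chart_regular[OF V(2)] and r2 = line_O_chart_regular[OF V(3)]
  show "invertible (\<psi> x)" if "x \<in> V"
    unfolding \<psi> vec2_diag by (rule invertible_diagonal) (use r1 r2 that V in auto)
  show "regular_mat_on (V \<inter> - {Infty}) \<psi>"
    unfolding \<psi> vec2_diag using r1(2) r2(2)
    by (intro regular_mat_on_diagonal regular_on_if) (auto elim!: regular_on_subset simp: V)
  have "\<psi> x ** twist m x = (\<chi> i j. if i = j then if i = 1 then \<theta>1 x $ 1 $ 1 * zpow (m 1) x else \<theta>2 x $ 1 $ 1 * zpow (m 2) x else 0)" for x
    unfolding \<psi> vec2_diag twist_zpow vec_eq_iff matrix_mult_diagonal_nth
    using exhaust_2 by (simp add: forall_2)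
  moreover have "regular_mat_on (V \<inter> - {Pt 0}) (\<lambda>x. \<chi> i j. if i = j then if i = (1::2) then \<theta>1 x $ 1 $ 1 * zpow (m 1) x else \<theta>2 x $ 1 $ 1 * zpow (m 2) x else 0)"
    using r1(3) r2(3)
    by (intro regular_mat_on_diagonal regular_on_if) (auto elim!: regular_on_subset simp: V)
  ultimately show "regular_mat_on (V \<inter> - {Pt 0}) (\<lambda>x. \<psi> x ** twist m x)" by simp
qed

text \<open>\<open>line_sum\<close> pairs all charts of the two factors, so there are mixed ones
  besides the two used in \<open>splitting\<close>; each of them is regular with respect to the
  frames at finite points and at infinity.\<close>

lemma splitting_line_sum_frame:
  assumes sp: "splitting E m F" and V: "(V, \<psi>) \<in> line_sum (line_O (m 1)) (line_O (m 2))"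
  shows "frame E V (\<lambda>x. F x ** matrix_inv (\<psi> x))"
proof (rule frameI)
  note \<psi> = line_sum_chart[OF V]
  show "invertible (F x ** matrix_inv (\<psi> x))" if "x \<in> V" for x
    using \<psi>(1)[OF that] splitting_invertible[OF sp] by (intro invertible_mult invertible_matrix_inv)
  fix x assume "x \<in> V"
  have r0: "regular_mat_on (V \<inter> - {Infty}) (\<lambda>x. matrix_inv (F x) ** (F x ** matrix_inv (\<psi> x)))"
    by (subst regular_mat_on_cong[where B = "\<lambda>x. matrix_inv (\<psi> x)"])
      (use \<psi> splitting_invertible[OF sp] in \<open>auto simp: matrix_inv_cancel\<close>)
  have r1: "regular_mat_on (V \<inter> - {Pt 0}) (\<lambda>x. matrix_inv (F x ** twist m x) ** (F x ** matrix_inv (\<psi> x)))"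
  proof (subst regular_mat_on_cong)
    show "matrix_inv (F x ** twist m x) ** (F x ** matrix_inv (\<psi> x)) = matrix_inv (\<psi> x ** twist m x)"
      if "x \<in> V \<inter> - {Pt 0}" for x
      using that \<psi>(1) splitting_invertible[OF sp]
      by (simp add: matrix_inv_mult invertible_twist matrix_mul_assoc[symmetric] matrix_inv_cancel)
    show "regular_mat_on (V \<inter> - {Pt 0}) (\<lambda>x. matrix_inv (\<psi> x ** twist m x))"
      by (rule regular_mat_on_matrix_inv[OF \<psi>(3)]) (use \<psi>(1) in \<open>auto intro!: invertible_mult invertible_twist\<close>)
  qed
  show "\<exists>V' G. zariski_open V' \<and> x \<in> V' \<and> frame E V' G \<and>
      regular_mat_on (V \<inter> V') (\<lambda>x. matrix_inv (G x) ** (F x ** matrix_inv (\<psi> x)))"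
    using not_Infty_or_not_0[of x]
  proof
    assume "x \<in> - {Infty}"
    with r0 splitting_frame0[OF sp] show ?thesis by (intro exI[of _ "- {Infty}"] exI[of _ F]) simp
  next
    assume "x \<in> - {Pt 0}"
    with r1 splitting_frame1[OF sp] show ?thesis
      by (intro exI[of _ "- {Pt 0}"] exI[of _ "\<lambda>x. F x ** twist m x"]) simp
  qed
qed

text \<open>Reading the inverse isomorphism in the two unmixed charts gives exactly the two frames
  of a splitting. Conversely, the regularity of \<open>A\<close> follows from that of its inverse by
  inverting matrices.\<close>

lemma bundle_iso_line_sum_iff:
  assumes E: "vector_bundle E"
  shows "bundle_iso E (line_sum (line_O (m 1)) (line_O (m 2))) A \<longleftrightarrow>
    (\<forall>x. invertible (A x)) \<and> splitting E m (\<lambda>x. matrix_inv (A x))"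
    (is "bundle_iso E ?B A \<longleftrightarrow> ?R")
proof
  assume "bundle_iso E ?B A"
  then obtain A' where hom: "bundle_hom ?B E A'" and A': "\<And>x. A x ** A' x = mat 1" "\<And>x. A' x ** A x = mat 1"
    unfolding bundle_iso_def by blast
  have inv: "invertible (A x)" for x using A' unfolding invertible_def by blast
  have eq: "matrix_inv (A x) = A' x" for x by (rule matrix_inv_unique[OF A'(1)])
  have inv': "invertible (A' x)" for x using invertible_matrix_inv[OF inv] eq by metis
  have reg: "regular_mat_on (V \<inter> U) (\<lambda>x. \<phi> x ** A' x ** matrix_inv (\<psi> x))"
    if "(V, \<psi>) \<in> ?B" "(U, \<phi>) \<in> E" for V \<psi> U \<phi>
    using bspec[OF bspec[OF hom[unfolded bundle_hom_def] that(1), simplified] that(2)] by simp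
  note c0 = line_sum_charts(1)[of m] and c1 = line_sum_charts(2)[of m]
  have f0: "frame E (- {Infty}) A'"
    unfolding frame_def using inv' reg[OF c0] by (auto simp: matrix_inv_unique[of "mat 1" "mat 1"])
  have "regular_mat_on (- {Pt 0} \<inter> U) (\<lambda>x. \<phi> x ** (A' x ** twist m x))" if U: "(U, \<phi>) \<in> E" for U \<phi>
  proof (subst regular_mat_on_cong)
    show "\<phi> x ** (A' x ** twist m x) = \<phi> x ** A' x ** matrix_inv (twist (\<lambda>i. - m i) x)" if "x \<in> - {Pt 0} \<inter> U" for x
      using that by (simp add: matrix_inv_twist matrix_mul_assoc)
  qed (rule reg[OF c1 U])
  then have f1: "frame E (- {Pt 0}) (\<lambda>x. A' x ** twist m x)"
    unfolding frame_def using inv' by (auto intro: invertible_mult invertible_twist)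
  show ?R using f0 f1 inv unfolding splitting_def eq by blast
next
  assume R: ?R
  then have inv: "\<And>x. invertible (A x)" and sp: "splitting E m (\<lambda>x. matrix_inv (A x))" by auto
  have hom: "bundle_hom ?B E (\<lambda>x. matrix_inv (A x))"
    unfolding bundle_hom_def
  proof safe
    fix V \<psi> U \<phi> assume V: "(V, \<psi>) \<in> ?B" and U: "(U, \<phi>) \<in> E"
    from frame_regular[OF splitting_line_sum_frame[OF sp V] U]
    show "regular_mat_on (V \<inter> U) (\<lambda>x. \<phi> x ** matrix_inv (A x) ** matrix_inv (\<psi> x))"
      by (simp add: matrix_mul_assoc)
  qed
  have "bundle_hom E ?B A"
    unfolding bundle_hom_def
  proof safe
    fix V \<psi> U \<phi> assume V: "(V, \<psi>) \<in> ?B" and U: "(U, \<phi>) \<in> E"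
    let ?T = "\<lambda>x. \<phi> x ** (matrix_inv (A x) ** matrix_inv (\<psi> x))"
    have "regular_mat_on (V \<inter> U) ?T" using frame_regular[OF splitting_line_sum_frame[OF sp V] U] .
    then have "regular_mat_on (V \<inter> U) (\<lambda>x. matrix_inv (?T x))"
      by (rule regular_mat_on_matrix_inv)
        (use inv line_sum_chart(1)[OF V] vector_bundle_invertible[OF E U] in
          \<open>auto intro!: invertible_mult invertible_matrix_inv\<close>)
    also have "?this \<longleftrightarrow> regular_mat_on (V \<inter> U) (\<lambda>x. \<psi> x ** A x ** matrix_inv (\<phi> x))"
      by (rule regular_mat_on_cong)
        (use inv line_sum_chart(1)[OF V] vector_bundle_invertible[OF E U] in
          \<open>simp add: matrix_inv_mult invertible_mult invertible_matrix_inv matrix_inv_matrix_inv\<close>)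
    finally show "regular_mat_on (U \<inter> V) (\<lambda>x. \<psi> x ** A x ** matrix_inv (\<phi> x))" by (simp add: Int_commute)
  qed
  with hom show "bundle_iso E ?B A"
    unfolding bundle_iso_def using inv matrix_inv_left matrix_inv_right by blast
qed

section \<open>Coordinates of lines and the subbundles \<open>O\<close> of \<open>B\<close>\<close>

definition B_twists :: "2 \<Rightarrow> int" where
  "B_twists i = (if i = 1 then 0 else 1)"

lemma B_twists_simps [simp]: "B_twists 1 = 0" "B_twists 2 = 1"
  by (simp_all add: B_twists_def)

lemma bundle_B_line_sum: "bundle_B = line_sum (line_O (B_twists 1)) (line_O (B_twists 2))"
  by (simp add: bundle_B_def)

definition line_vec :: "p1 \<Rightarrow> complex^2" where
  "line_vec u = (case u of Pt c \<Rightarrow> vector [1, c] | Infty \<Rightarrow> vector [0, 1])"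

lemma line_vec_simps [simp]:
  "line_vec (Pt c) $ 1 = 1" "line_vec (Pt c) $ 2 = c" "line_vec Infty $ 1 = 0" "line_vec Infty $ 2 = 1"
  by (simp_all add: line_vec_def)

lemma B_line_line_vec: "B_line (Pt z) u = vec.span {line_vec u}"
proof (cases u)
  case (Pt c)
  have "sec_e (Pt z) + c *s sec_f (Pt z) = line_vec u"
    by (simp add: sec_e_def sec_f_def Pt line_vec_def vec_eq_iff forall_2)
  with Pt show ?thesis by (simp add: B_line_def)
next
  case Infty
  then show ?thesis by (simp add: B_line_def sec_f_def line_vec_def)
qed

lemma image_span: "(\<lambda>v. A *v v) ` vec.span {v} = vec.span {A *v v}" for A :: "complex^'n^'m"
  unfolding span_singleton_eq image_image vector_scalar_commute ..

lemma is_line_line_vec: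
  fixes F :: "complex^2^2"
  assumes "is_line l" "invertible F"
  obtains u where "l = vec.span {F *v line_vec u}"
proof -
  have l: "vec.subspace l" "vec.dim l = 1" using assms unfolding is_line_def by auto
  obtain B where B: "B \<subseteq> l" "vec.independent B" "l \<subseteq> vec.span B" "card B = vec.dim l"
    using vec.basis_exists by blast
  then obtain v where v: "B = {v}" using l(2) by (auto simp: card_1_singleton_iff)
  have lv: "l = vec.span {v}"
    using B(1,3) l(1) unfolding v by (metis subset_antisym vec.span_minimal)
  have v0: "v \<noteq> 0" using B(2) v by (metis vec.dependent_zero singletonI)
  define w where "w = matrix_inv F *v v"
  have Fw: "F *v w = v" using assms(2) by (simp add: w_def matrix_inv_cancel_vec)
  then have w0: "w \<noteq> 0" using v0 by auto
  show ?thesis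
  proof (cases "w $ 1 = 0")
    case True
    then have "w = w $ 2 *s line_vec Infty" "w $ 2 \<noteq> 0" using w0 by (auto simp: vec_eq_iff forall_2)
    then have "v = w $ 2 *s (F *v line_vec Infty)" using Fw by (metis vector_scalar_commute)
    with lv \<open>w $ 2 \<noteq> 0\<close> that[of Infty] show ?thesis by (simp add: span_scale)
  next
    case False
    then have "w = w $ 1 *s line_vec (Pt (w $ 2 / w $ 1))" by (simp add: vec_eq_iff forall_2)
    then have "v = w $ 1 *s (F *v line_vec (Pt (w $ 2 / w $ 1)))" using Fw by (metis vector_scalar_commute)
    with lv False that[of "Pt (w $ 2 / w $ 1)"] show ?thesis by (simp add: span_scale)
  qed
qed

text \<open>The finite coordinates are values of one polynomial of degree at most 1, that is, of a
  section of \<open>O(1)\<close>; infinite coordinates impose nothing. The negation is the common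
  content of (4) and (5).\<close>

definition interpolable :: "(4 \<Rightarrow> complex) \<Rightarrow> (4 \<Rightarrow> p1) \<Rightarrow> bool" where
  "interpolable t u \<longleftrightarrow> (\<exists>\<beta> \<gamma>. \<forall>i c. u i = Pt c \<longrightarrow> c = \<beta> + \<gamma> * t i)"

text \<open>The common form of conditions (4) and (5): \<open>F\<close> is an isomorphism of \<open>B\<close> with \<open>E\<close>, and the \<open>u i\<close>
  are the coordinates of the lines.\<close>

definition generic_coordinates ::
    "(4 \<Rightarrow> complex) \<Rightarrow> 2 vbundle \<Rightarrow> (4 \<Rightarrow> (complex^2) set) \<Rightarrow> (p1 \<Rightarrow> complex^2^2) \<Rightarrow> (4 \<Rightarrow> p1) \<Rightarrow> bool" where
  "generic_coordinates t E P F u \<longleftrightarrow> splitting E B_twists F \<and>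
     (\<forall>i. P i = vec.span {F (Pt (t i)) *v line_vec (u i)}) \<and> \<not> interpolable t u"

lemma transport_iff:
  assumes "invertible (A (Pt (t i)))"
  shows "transport t A P i = vec.span {line_vec u} \<longleftrightarrow> P i = vec.span {matrix_inv (A (Pt (t i))) *v line_vec u}"
proof
  assume "transport t A P i = vec.span {line_vec u}"
  then have "(\<lambda>v. matrix_inv (A (Pt (t i))) *v v) ` (\<lambda>v. A (Pt (t i)) *v v) ` P i = (\<lambda>v. matrix_inv (A (Pt (t i))) *v v) ` vec.span {line_vec u}"
    by (simp add: transport_def)
  then show "P i = vec.span {matrix_inv (A (Pt (t i))) *v line_vec u}"
    by (simp add: image_span image_image matrix_inv_cancel_vec assms)
next
  assume "P i = vec.span {matrix_inv (A (Pt (t i))) *v line_vec u}"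
  then show "transport t A P i = vec.span {line_vec u}"
    by (simp add: transport_def image_span matrix_inv_cancel_vec assms)
qed

text \<open>The subbundle is spanned by the nowhere vanishing global section
  \<open>e + (\<beta> + \<gamma> z) f\<close>.\<close>

lemma exists_line_O_through:
  obtains L where "line_subbundle bundle_B L" "subbundle_isomorphic bundle_B L (line_O 0)"
    "\<And>z. L (Pt z) = vec.span {line_vec (Pt (\<beta> + \<gamma> * z))}"
proof -
  \<comment> \<open>Near infinity \<open>(\<beta> + \<gamma> z) f\<close> equals
    \<open>(\<beta> w + \<gamma>) g\<close>, whence the coordinate \<gamma> at
    \<open>Infty\<close>.\<close>
  define s :: "p1 \<Rightarrow> complex^2" where
    "s x = vector [1, case x of Pt z \<Rightarrow> \<beta> + \<gamma> * z | Infty \<Rightarrow> \<gamma>]" for x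
  have reg0: "regular_vec_on (V \<inter> - {Infty}) s" for V
  proof -
    have "regular_on (V \<inter> - {Infty}) (\<lambda>x. \<beta> + \<gamma> * coord_0 x)"
      by (intro regular_on_add regular_on_mult regular_on_const regular_on_coord_0) simp
    also have "?this \<longleftrightarrow> regular_on (V \<inter> - {Infty}) (\<lambda>x. case x of Pt z \<Rightarrow> \<beta> + \<gamma> * z | Infty \<Rightarrow> \<gamma>)"
      by (rule regular_on_cong) (auto split: p1.splits)
    finally show ?thesis by (simp add: regular_vec_on_def forall_2 s_def)
  qed
  have reg1: "regular_vec_on (V \<inter> - {Pt 0}) (\<lambda>x. twist (\<lambda>i. - B_twists i) x *v s x)" for V
  proof -
    have "regular_on (V \<inter> - {Pt 0}) (\<lambda>x. \<beta> * coord_inf x + \<gamma>)"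
      by (intro regular_on_add regular_on_mult regular_on_const regular_on_coord_inf) simp
    also have "?this \<longleftrightarrow> regular_on (V \<inter> - {Pt 0}) (\<lambda>x. zpow (- 1) x * s x $ 2)"
    proof (rule regular_on_cong)
      fix x assume "x \<in> V \<inter> - {Pt 0}"
      then show "\<beta> * coord_inf x + \<gamma> = zpow (- 1) x * s x $ 2"
        by (cases x) (auto simp: s_def power_int_minus distrib_left mult.commute)
    qed
    finally show ?thesis
      unfolding regular_vec_on_def forall_2 twist_zpow matrix_diagonal_mult_vec by (simp add: s_def)
  qed
  have sec: "is_section bundle_B UNIV s"
    unfolding is_section_def
  proof (safe intro!: regular_vec_on_local)
    fix V \<psi> x assume V: "(V, \<psi>) \<in> bundle_B"
    note \<psi> = line_sum_chart[of V \<psi> B_twists, OF V[unfolded bundle_B_line_sum]]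
    show "\<exists>W. zariski_open W \<and> x \<in> W \<and> regular_vec_on (UNIV \<inter> V \<inter> W) (\<lambda>x. \<psi> x *v s x)"
      using not_Infty_or_not_0[of x]
    proof
      assume "x \<in> - {Infty}"
      with regular_vec_on_mult[OF \<psi>(2) reg0] show ?thesis
        by (intro exI[of _ "- {Infty}"]) simp
    next
      assume x: "x \<in> - {Pt 0}"
      have "regular_vec_on (V \<inter> - {Pt 0}) (\<lambda>x. (\<psi> x ** twist B_twists x) *v (twist (\<lambda>i. - B_twists i) x *v s x))"
        by (rule regular_vec_on_mult[OF \<psi>(3) reg1])
      also have "?this \<longleftrightarrow> regular_vec_on (V \<inter> - {Pt 0}) (\<lambda>x. \<psi> x *v s x)"
        by (rule regular_vec_on_cong)
          (simp add: matrix_inv_twist[symmetric] matrix_vector_mul_assoc[symmetric] matrix_inv_cancel_vec invertible_twist)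
      finally show ?thesis using x by (intro exI[of _ "- {Pt 0}"]) simp
    qed
  qed
  have s0: "s x \<noteq> 0" for x by (simp add: s_def vec_eq_iff forall_2)
  define L where "L x = vec.span {s x}" for x
  show ?thesis
  proof (rule that[of L])
    show "line_subbundle bundle_B L"
      unfolding line_subbundle_def L_def by (intro allI exI[of _ UNIV] exI[of _ s]) (simp add: sec s0)
    show "subbundle_isomorphic bundle_B L (line_O 0)"
      unfolding subbundle_isomorphic_def
    proof (intro exI conjI allI)
      let ?A = "\<lambda>x. (\<chi> i j. s x $ i) :: complex^1^2"
      show "bundle_hom (line_O 0) bundle_B ?A"
        unfolding bundle_hom_def
      proof safe
        fix U V \<phi> \<psi> assume U: "(U, \<phi>) \<in> line_O 0" and V: "(V, \<psi>) \<in> bundle_B"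
        have \<phi>: "matrix_inv (\<phi> x) = mat 1" for x
          using line_O_chart[OF U] by (auto intro: matrix_inv_unique)
        have "regular_vec_on (UNIV \<inter> V) (\<lambda>x. \<psi> x *v s x)" by (rule is_section_regular[OF sec V])
        then show "regular_mat_on (U \<inter> V) (\<lambda>x. \<psi> x ** ?A x ** matrix_inv (\<phi> x))"
          unfolding regular_mat_on_def regular_vec_on_def \<phi>
          by (auto simp: matrix_matrix_mult_def[of _ "?A _"] matrix_vector_mult_def elim: regular_on_subset)
      qed
      fix x
      have A: "?A x *v v = v $ 1 *s s x" for v
        by (simp add: vec_eq_iff matrix_vector_mult_def)
      have "inj (\<lambda>v::complex^1. v $ 1 *s s x)"
        using s0[of x] by (auto simp: inj_def vec_eq_iff)
      moreover have "range (\<lambda>v::complex^1. v $ 1 *s s x) = L x"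
      proof -
        have "k *s s x = (vec k :: complex^1) $ 1 *s s x" for k by simp
        then show ?thesis unfolding L_def span_singleton_eq by blast
      qed
      ultimately show "bij_betw (\<lambda>v. ?A x *v v) UNIV (L x)" unfolding A bij_betw_def by blast
    qed
    show "L (Pt z) = vec.span {line_vec (Pt (\<beta> + \<gamma> * z))}" for z
      by (simp add: L_def s_def line_vec_def)
  qed
qed

lemma poly_degree_le_1: "degree q \<le> 1 \<Longrightarrow> poly q z = coeff q 0 + coeff q 1 * (z :: complex)"
proof -
  assume "degree q \<le> 1"
  then have "q = [:coeff q 0, coeff q 1:]"
    by (intro poly_eqI) (auto simp: coeff_pCons coeff_eq_0 split: nat.splits)
  then have "poly q z = poly [:coeff q 0, coeff q 1:] z" by simp
  then show ?thesis by (simp add: mult.commute)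
qed

text \<open>A map from \<open>O\<close> to \<open>B\<close> is a pair of a constant \<alpha> and a
  polynomial \<open>q\<close> of degree at most 1. Since its fibres are injective, \<alpha> is
  nonzero and the image is the graph of \<open>q / \<alpha>\<close>.\<close>

lemma line_O_in_B:
  assumes "subbundle_isomorphic bundle_B L (line_O 0)"
  obtains \<beta> \<gamma> where "\<And>z c. line_vec (Pt c) \<in> L (Pt z) \<Longrightarrow> c = \<beta> + \<gamma> * z"
proof -
  obtain A where hom: "bundle_hom (line_O 0) bundle_B A" and bij: "\<And>x. bij_betw (\<lambda>v. A x *v v) UNIV (L x)"
    using assms unfolding subbundle_isomorphic_def by blast
  have reg: "regular_mat_on (U \<inter> V) (\<lambda>x. \<psi> x ** A x ** matrix_inv (\<phi> x))"
    if "(U, \<phi>) \<in> line_O 0" "(V, \<psi>) \<in> bundle_B" for U \<phi> V \<psi>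
    using bspec[OF bspec[OF hom[unfolded bundle_hom_def] that(1), simplified] that(2)] by simp
  have mat1: "matrix_inv (mat 1 :: complex^1^1) = mat 1" by (rule matrix_inv_unique) simp
  have "regular_mat_on (- {Infty}) A"
    using reg[OF line_O_charts(1) line_sum_charts(1)[of B_twists, folded bundle_B_line_sum]] by (simp add: mat1)
  then have r0: "regular_on (- {Infty}) (\<lambda>x. A x $ i $ 1)" for i by (simp add: regular_mat_on_def)
  have "regular_mat_on (- {Pt 0}) (\<lambda>x. twist (\<lambda>i. - B_twists i) x ** A x)"
    using reg[OF line_O_charts(2) line_sum_charts(2)[of B_twists, folded bundle_B_line_sum]] by (simp add: mat1)
  then have r1: "regular_on (- {Pt 0}) (\<lambda>x. zpow (- B_twists i) x * A x $ i $ 1)" for i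
    unfolding regular_mat_on_def twist_zpow matrix_diagonal_mult_nth by blast
  have eq: "zpow (- B_twists i) (Pt z) * A (Pt z) $ i $ 1 = z powi (- B_twists i) * A (Pt z) $ i $ 1" if "z \<noteq> 0" for z i by simp
  obtain p where p: "\<And>z. A (Pt z) $ 1 $ 1 = poly p z" "p \<noteq> 0 \<Longrightarrow> int (degree p) \<le> B_twists 1"
    "A Infty $ 1 $ 1 = coeff p 0"
    using twisted_polynomial[OF r0 r1 eq, of 1] by auto
  obtain q where q: "\<And>z. A (Pt z) $ 2 $ 1 = poly q z" "q \<noteq> 0 \<Longrightarrow> int (degree q) \<le> B_twists 2"
    "A Infty $ 2 $ 1 = coeff q 1"
    using twisted_polynomial[OF r0 r1 eq, of 2] by auto
  obtain \<alpha> where \<alpha>: "p = [:\<alpha>:]" using p(2) by (metis degree_0 degree_eq_zeroE le_zero_eq B_twists_simps(1) of_nat_le_0_iff)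
  have dq: "degree q \<le> 1" using q(2) by (cases "q = 0") auto
  have A: "A x *v v = v $ 1 *s (\<chi> i. A x $ i $ 1)" for x v
    by (simp add: vec_eq_iff matrix_vector_mult_def)
  have A0: "A x $ 1 $ 1 \<noteq> 0 \<or> A x $ 2 $ 1 \<noteq> 0" for x
  proof (rule ccontr)
    assume "\<not> ?thesis"
    then have "A x *v v = 0" for v by (simp add: A vec_eq_iff forall_2)
    moreover have "inj (\<lambda>v. A x *v v)" using bij[of x] by (simp add: bij_betw_def)
    ultimately have "(1 :: complex^1) = 0" by (metis injD)
    then show False by simp
  qed
  \<comment> \<open>If \<alpha> were 0, then \<open>q\<close> would have no zero on the affine line,
    hence be constant, and as a section of \<open>O(1)\<close> it would vanish at
    \<open>Infty\<close>, where the map is injective too.\<close>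
  have \<alpha>0: "\<alpha> \<noteq> 0"
  proof
    assume 0: "\<alpha> = 0"
    then have "poly q z \<noteq> 0" for z using A0[of "Pt z"] by (simp add: p q \<alpha>)
    then have "degree q = 0" using fundamental_theorem_of_algebra[of q] constant_degree[of q] by blast
    then have "coeff q 1 = 0" by (simp add: coeff_eq_0)
    with A0[of Infty] 0 show False by (simp add: p q \<alpha>)
  qed
  show ?thesis
  proof (rule that[of "coeff q 0 / \<alpha>" "coeff q 1 / \<alpha>"])
    fix z c assume "line_vec (Pt c) \<in> L (Pt z)"
    then obtain v where "line_vec (Pt c) = A (Pt z) *v v" using bij[of "Pt z"] unfolding bij_betw_def by blast
    then have "line_vec (Pt c) $ i = v $ 1 * A (Pt z) $ i $ 1" for i by (simp add: A)
    from this[of 1] this[of 2] have v1: "v $ 1 * \<alpha> = 1" and c: "c = v $ 1 * poly q z" by (simp_all add: p q \<alpha>)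
    have v: "v $ 1 = 1 / \<alpha>" using v1 \<alpha>0 by (simp add: eq_divide_eq)
    show "c = coeff q 0 / \<alpha> + coeff q 1 / \<alpha> * z"
      unfolding c v poly_degree_le_1[OF dq] by (simp add: add_divide_distrib)
  qed
qed

text \<open>At most two finite coordinates remain, and a polynomial of degree 1 passes through them.
  This yields the bound on infinite coordinates in (4).\<close>

lemma interpolable_if_two_Infty:
  assumes "inj t" "i \<noteq> j" "u i = Infty" "u j = Infty"
  shows "interpolable t u"
proof -
  have "card (UNIV - {i, j}) = 2" using assms(2) by (simp add: card_Diff_subset)
  then obtain k l where kl: "UNIV - {i, j} = {k, l}" "k \<noteq> l" by (meson card_2_iff)
  then have tk: "t k \<noteq> t l" using assms(1) by (auto simp: inj_def)
  define c where "c i = (case u i of Pt c \<Rightarrow> c | Infty \<Rightarrow> 0)" for i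
  have c: "u i = Pt d \<Longrightarrow> c i = d" for i d by (simp add: c_def)
  define \<gamma> where "\<gamma> = (c l - c k) / (t l - t k)"
  have \<gamma>: "\<gamma> * t l - \<gamma> * t k = c l - c k"
    unfolding right_diff_distrib[symmetric] \<gamma>_def using tk by simp
  show ?thesis
    unfolding interpolable_def
  proof (intro exI allI impI)
    fix h d assume h: "u h = Pt d"
    then have "h \<in> UNIV - {i, j}" using assms by auto
    then consider "h = k" | "h = l" using kl by blast
    then show "d = (c k - \<gamma> * t k) + \<gamma> * t h"
      by cases (use c[OF h] \<gamma> in \<open>auto simp: algebra_simps\<close>)
  qed
qed

text \<open>The subbundles \<open>O\<close> of \<open>B\<close> are the graphs of polynomials of
  degree at most 1, so containing the finite lines in one of them is interpolation of their
  coordinates.\<close>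

lemma not_in_single_O_iff:
  assumes E: "vector_bundle E" and t: "inj t"
  shows "not_in_single_O t E P \<longleftrightarrow> (\<exists>F u. generic_coordinates t E P F u)"
proof
  assume "not_in_single_O t E P"
  then obtain A u where iso: "bundle_iso E bundle_B A" and tr: "\<And>i. transport t A P i = B_line (Pt (t i)) (u i)"
    and no: "\<not> (\<exists>L. line_subbundle bundle_B L \<and> subbundle_isomorphic bundle_B L (line_O 0) \<and>
              (\<forall>i. u i \<noteq> Infty \<longrightarrow> transport t A P i \<subseteq> L (Pt (t i))))"
    unfolding not_in_single_O_def by blast
  have inv: "\<And>x. invertible (A x)" and sp: "splitting E B_twists (\<lambda>x. matrix_inv (A x))"
    using iso unfolding bundle_B_line_sum bundle_iso_line_sum_iff[OF E] by auto
  have "\<not> interpolable t u"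
  proof
    assume "interpolable t u"
    then obtain \<beta> \<gamma> where \<beta>: "\<And>i c. u i = Pt c \<Longrightarrow> c = \<beta> + \<gamma> * t i" unfolding interpolable_def by blast
    obtain L where L: "line_subbundle bundle_B L" "subbundle_isomorphic bundle_B L (line_O 0)"
      "\<And>z. L (Pt z) = vec.span {line_vec (Pt (\<beta> + \<gamma> * z))}" by (rule exists_line_O_through[of \<beta> \<gamma>]) blast
    have "transport t A P i \<subseteq> L (Pt (t i))" if "u i \<noteq> Infty" for i
    proof -
      obtain c where c: "u i = Pt c" using \<open>u i \<noteq> Infty\<close> by (cases "u i") auto
      show ?thesis unfolding tr B_line_line_vec L(3) c using \<beta>[OF c] by simp
    qed
    with L(1,2) no show False by blast
  qed
  with sp tr inv show "\<exists>F u. generic_coordinates t E P F u"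
    unfolding generic_coordinates_def B_line_line_vec by (auto simp: transport_iff)
next
  assume "\<exists>F u. generic_coordinates t E P F u"
  then obtain F u where sp: "splitting E B_twists F" and P: "\<And>i. P i = vec.span {F (Pt (t i)) *v line_vec (u i)}"
    and ni: "\<not> interpolable t u" unfolding generic_coordinates_def by blast
  note inv = splitting_invertible[OF sp]
  define A where "A x = matrix_inv (F x)" for x
  have A: "invertible (A x)" "matrix_inv (A x) = F x" for x
    using inv by (simp_all add: A_def invertible_matrix_inv matrix_inv_matrix_inv)
  have tr: "transport t A P i = B_line (Pt (t i)) (u i)" for i
    unfolding B_line_line_vec using transport_iff[OF A(1)] by (simp add: A P)
  have "card {i. u i = Infty} \<le> Suc 0"
    using interpolable_if_two_Infty[OF t] ni by (subst card_le_Suc0_iff_eq) auto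
  moreover have "\<not> (\<exists>L. line_subbundle bundle_B L \<and> subbundle_isomorphic bundle_B L (line_O 0) \<and>
              (\<forall>i. u i \<noteq> Infty \<longrightarrow> transport t A P i \<subseteq> L (Pt (t i))))"
  proof
    assume "\<exists>L. line_subbundle bundle_B L \<and> subbundle_isomorphic bundle_B L (line_O 0) \<and>
              (\<forall>i. u i \<noteq> Infty \<longrightarrow> transport t A P i \<subseteq> L (Pt (t i)))"
    then obtain L where L: "subbundle_isomorphic bundle_B L (line_O 0)"
       "\<And>i. u i \<noteq> Infty \<Longrightarrow> transport t A P i \<subseteq> L (Pt (t i))" by blast
    obtain \<beta> \<gamma> where \<beta>: "\<And>z c. line_vec (Pt c) \<in> L (Pt z) \<Longrightarrow> c = \<beta> + \<gamma> * z" by (rule line_O_in_B[OF L(1)]) blast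
    have "c = \<beta> + \<gamma> * t i" if "u i = Pt c" for i c
    proof (rule \<beta>)
      have "line_vec (Pt c) \<in> vec.span {line_vec (u i)}" by (simp add: that vec.span_base)
      then show "line_vec (Pt c) \<in> L (Pt (t i))" using L(2)[of i] that unfolding tr B_line_line_vec by auto
    qed
    with ni show False unfolding interpolable_def by blast
  qed
  moreover have "bundle_iso E bundle_B A"
    unfolding bundle_B_line_sum bundle_iso_line_sum_iff[OF E] using A sp by simp
  ultimately show "not_in_single_O t E P" unfolding not_in_single_O_def using tr by (metis One_nat_def)
qed

section \<open>The projective interpretation\<close>

definition point3 :: "complex \<Rightarrow> p1 \<Rightarrow> complex^3" where
  "point3 z u = (case u of Pt c \<Rightarrow> vector [1, z, c] | Infty \<Rightarrow> vector [0, 0, 1])"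

lemma point3_simps [simp]: "point3 z (Pt c) $ 1 = 1" "point3 z (Pt c) $ 2 = z" "point3 z (Pt c) $ 3 = c"
  by (simp_all add: point3_def)

lemma blow_down_line_vec: "blow_down (Pt z) (vec.span {line_vec u}) = vec.span {point3 z u}"
proof -
  have "vector [(k *s line_vec u) $ 1, z * (k *s line_vec u) $ 1, (k *s line_vec u) $ 2] = k *s point3 z u" for k
    by (cases u) (simp_all add: line_vec_def point3_def vec_eq_iff forall_3 mult.commute)
  then show ?thesis unfolding blow_down_def p1.case span_singleton_eq image_image by simp
qed

lemma point3_origin: "vec.span {point3 z u} = P2_origin \<longleftrightarrow> u = Infty"
proof
  assume *: "vec.span {point3 z u} = P2_origin"
  show "u = Infty"
  proof (rule ccontr)
    assume "u \<noteq> Infty"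
    then obtain c where u: "u = Pt c" by (cases u) auto
    have "point3 z u \<in> P2_origin" unfolding *[symmetric] by (simp add: vec.span_base)
    then obtain k where "point3 z u = k *s vector [0, 0, 1]" unfolding P2_origin_def span_singleton_eq by blast
    then have "point3 z u $ 1 = 0" by simp
    then show False by (simp add: u)
  qed
qed (simp add: P2_origin_def point3_def)

lemma collinear_det:
  assumes "P2_collinear {vec.span {v1}, vec.span {v2}, vec.span {v3 :: complex^3}}"
  shows "det (vector [v1, v2, v3]) = 0"
proof (rule ccontr)
  let ?M = "vector [v1, v2, v3] :: complex^3^3"
  assume "det ?M \<noteq> 0"
  then have inv: "invertible (transpose ?M)" by (simp add: invertible_det_nz det_transpose)
  obtain W where W: "vec.subspace W" "vec.dim W = 2" "vec.span {v1} \<subseteq> W" "vec.span {v2} \<subseteq> W" "vec.span {v3} \<subseteq> W"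
    using assms unfolding P2_collinear_def by auto
  have v: "v1 \<in> W" "v2 \<in> W" "v3 \<in> W" using W(3-5) vec.span_base by blast+
  have comb: "transpose ?M *v y = y $ 1 *s v1 + y $ 2 *s v2 + y $ 3 *s v3" for y
    by (simp add: vec_eq_iff forall_3 matrix_vector_mult_def transpose_def sum_3 mult.commute)
  have "x \<in> W" for x
  proof -
    have "x = transpose ?M *v (matrix_inv (transpose ?M) *v x)" using inv matrix_inv_cancel_vec by metis
    also have "\<dots> \<in> W"
      unfolding comb by (intro vec.subspace_add vec.subspace_scale W(1) v)
    finally show ?thesis .
  qed
  then have "W = UNIV" by blast
  then show False using W(2) by (simp add: vec.dim_UNIV card_cart_basis)
qed

lemma plane_dim: "vec.subspace {v :: complex^3. v $ 3 = \<beta> * v $ 1 + \<gamma> * v $ 2} \<and>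
  vec.dim {v :: complex^3. v $ 3 = \<beta> * v $ 1 + \<gamma> * v $ 2} = 2"
proof
  let ?W = "{v :: complex^3. v $ 3 = \<beta> * v $ 1 + \<gamma> * v $ 2}"
  let ?a = "vector [1, 0, \<beta>] :: complex^3" and ?b = "vector [0, 1, \<gamma>] :: complex^3"
  show "vec.subspace ?W" by (auto simp: vec.subspace_def algebra_simps)
  have "?a \<notin> vec.span {?b}"
  proof
    assume "?a \<in> vec.span {?b}"
    then obtain k where "?a = k *s ?b" unfolding span_singleton_eq by blast
    then have "?a $ 1 = (k *s ?b) $ 1" by simp
    then show False by simp
  qed
  moreover have "vec.independent {?b}" by (simp add: vec_eq_iff forall_3)
  ultimately have ind: "vec.independent {?a, ?b}" using vec.independent_insert[of ?a "{?b}"] by auto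
  have ne: "?a \<noteq> ?b" by (simp add: vec_eq_iff forall_3)
  have "x \<in> vec.span {?a, ?b}" if "x \<in> ?W" for x
  proof -
    have "x = x $ 1 *s ?a + x $ 2 *s ?b" using that by (simp add: vec_eq_iff forall_3 mult.commute)
    moreover have "x $ 1 *s ?a + x $ 2 *s ?b \<in> vec.span {?a, ?b}"
      by (intro vec.span_add vec.span_scale vec.span_base) auto
    ultimately show ?thesis by simp
  qed
  moreover have "{?a, ?b} \<subseteq> ?W" by simp
  ultimately have "vec.dim ?W = card {?a, ?b}" using ind by (intro vec.dim_unique[OF _ _ ind]) auto
  then show "vec.dim ?W = 2" using ne by simp
qed

text \<open>The graph of the interpolating polynomial is a line of the plane avoiding the origin.
  Conversely, two finite points with distinct \<open>t i\<close> determine the polynomial, and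
  collinearity with any third finite point says that it passes through that one as well.\<close>

lemma interpolable_iff_collinear:
  assumes t: "inj t"
  shows "interpolable t u \<longleftrightarrow> \<not> (\<exists>i j k. u i \<noteq> Infty \<and> u j \<noteq> Infty \<and> u k \<noteq> Infty \<and>
    \<not> P2_collinear {vec.span {point3 (t i) (u i)}, vec.span {point3 (t j) (u j)}, vec.span {point3 (t k) (u k)}})"
    (is "_ \<longleftrightarrow> \<not> ?N")
proof
  assume "interpolable t u"
  then obtain \<beta> \<gamma> where \<beta>: "\<And>i c. u i = Pt c \<Longrightarrow> c = \<beta> + \<gamma> * t i" unfolding interpolable_def by blast
  let ?W = "{v :: complex^3. v $ 3 = \<beta> * v $ 1 + \<gamma> * v $ 2}"
  have sub: "vec.span {point3 (t i) (u i)} \<subseteq> ?W" if "u i \<noteq> Infty" for i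
  proof -
    obtain c where c: "u i = Pt c" using \<open>u i \<noteq> Infty\<close> by (cases "u i") auto
    have "point3 (t i) (u i) \<in> ?W" using \<beta>[OF c] by (simp add: c)
    then show ?thesis using plane_dim[of \<beta> \<gamma>] by (intro vec.span_minimal) auto
  qed
  show "\<not> ?N"
  proof safe
    fix i j k assume ijk: "u i \<noteq> Infty" "u j \<noteq> Infty" "u k \<noteq> Infty"
      and n: "\<not> P2_collinear {vec.span {point3 (t i) (u i)}, vec.span {point3 (t j) (u j)}, vec.span {point3 (t k) (u k)}}"
    have "P2_collinear {vec.span {point3 (t i) (u i)}, vec.span {point3 (t j) (u j)}, vec.span {point3 (t k) (u k)}}"
      unfolding P2_collinear_def
    proof (intro exI conjI ballI)
      show "vec.subspace ?W" "vec.dim ?W = 2" using plane_dim[of \<beta> \<gamma>] by auto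
      fix p assume "p \<in> {vec.span {point3 (t i) (u i)}, vec.span {point3 (t j) (u j)}, vec.span {point3 (t k) (u k)}}"
      then show "p \<subseteq> ?W" using sub[OF ijk(1)] sub[OF ijk(2)] sub[OF ijk(3)] by fastforce
    qed
    with n show False by blast
  qed
next
  assume N: "\<not> ?N"
  show "interpolable t u"
  proof (cases "\<exists>i j ci cj. i \<noteq> j \<and> u i = Pt ci \<and> u j = Pt cj")
    case False
    show ?thesis
    proof (cases "\<exists>i c. u i = Pt c")
      case True
      then obtain i c where i: "u i = Pt c" by blast
      have "d = c + 0 * t j" if "u j = Pt d" for j d
        using False i that by (cases "i = j") auto
      then show ?thesis unfolding interpolable_def by blast
    next
      case False
      then show ?thesis unfolding interpolable_def by auto
    qed
  next
    case True
    then obtain i j ci cj where ij: "i \<noteq> j" "u i = Pt ci" "u j = Pt cj" by blast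
    have tij: "t j - t i \<noteq> 0" using ij t by (auto simp: inj_def)
    define \<gamma> where "\<gamma> = (cj - ci) / (t j - t i)"
    have \<gamma>: "\<gamma> * (t j - t i) = cj - ci" using tij by (simp add: \<gamma>_def)
    have "c = (ci - \<gamma> * t i) + \<gamma> * t k" if k: "u k = Pt c" for k c
    proof -
      have "P2_collinear {vec.span {point3 (t i) (u i)}, vec.span {point3 (t j) (u j)}, vec.span {point3 (t k) (u k)}}"
        using N ij k by (metis p1.distinct(1))
      \<comment> \<open>Expansion of the determinant with rows \<open>(1, t, u)\<close>; it is
        linear in the unknown coordinate \<open>c\<close>, with coefficient
        \<open>t j - t i\<close>.\<close>
      from collinear_det[OF this] have "t j * c - t k * cj - t i * c + t i * cj + t k * ci - t j * ci = 0"
        by (simp add: det_3 ij k algebra_simps)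
      then have "(t j - t i) * c = (t j - t i) * ci + (cj - ci) * (t k - t i)" by (simp add: algebra_simps)
      also have "\<dots> = (t j - t i) * (ci + \<gamma> * (t k - t i))" unfolding \<gamma>[symmetric] by (simp add: algebra_simps)
      finally have "c = ci + \<gamma> * (t k - t i)" using tij by simp
      then show ?thesis by (simp add: algebra_simps)
    qed
    then show ?thesis unfolding interpolable_def by blast
  qed
qed

lemma three_noncollinear_iff:
  assumes E: "vector_bundle E" and t: "inj t" and P: "\<And>i. is_line (P i)"
  shows "three_noncollinear t E P \<longleftrightarrow> (\<exists>F u. generic_coordinates t E P F u)"
proof
  assume "three_noncollinear t E P"
  then obtain A U where iso: "bundle_iso E bundle_B A" and U: "\<And>i. U i = blow_down (Pt (t i)) (transport t A P i)"
    and nc: "\<exists>i j k. U i \<noteq> P2_origin \<and> U j \<noteq> P2_origin \<and> U k \<noteq> P2_origin \<and> \<not> P2_collinear {U i, U j, U k}"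
    unfolding three_noncollinear_def by blast
  have inv: "\<And>x. invertible (A x)" and sp: "splitting E B_twists (\<lambda>x. matrix_inv (A x))"
    using iso unfolding bundle_B_line_sum bundle_iso_line_sum_iff[OF E] by auto
  have "\<forall>i. \<exists>u. P i = vec.span {matrix_inv (A (Pt (t i))) *v line_vec u}"
    using is_line_line_vec[OF P invertible_matrix_inv[OF inv]] by metis
  then obtain u where u: "\<And>i. P i = vec.span {matrix_inv (A (Pt (t i))) *v line_vec (u i)}" by metis
  then have "transport t A P i = vec.span {line_vec (u i)}" for i by (simp only: transport_iff[OF inv])
  then have "U i = vec.span {point3 (t i) (u i)}" for i by (simp add: U blow_down_line_vec)
  with nc have "\<not> interpolable t u" unfolding interpolable_iff_collinear[OF t] by (simp add: point3_origin)
  with sp u show "\<exists>F u. generic_coordinates t E P F u" unfolding generic_coordinates_def by blast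
next
  assume "\<exists>F u. generic_coordinates t E P F u"
  then obtain F u where sp: "splitting E B_twists F" and P: "\<And>i. P i = vec.span {F (Pt (t i)) *v line_vec (u i)}"
    and ni: "\<not> interpolable t u" unfolding generic_coordinates_def by blast
  note inv = splitting_invertible[OF sp]
  define A where "A x = matrix_inv (F x)" for x
  have A: "invertible (A x)" "matrix_inv (A x) = F x" for x
    using inv by (simp_all add: A_def invertible_matrix_inv matrix_inv_matrix_inv)
  have "transport t A P i = vec.span {line_vec (u i)}" for i
    using transport_iff[OF A(1)] by (simp add: A P)
  then have U: "blow_down (Pt (t i)) (transport t A P i) = vec.span {point3 (t i) (u i)}" for i
    by (simp add: blow_down_line_vec)
  have iso: "bundle_iso E bundle_B A"
    unfolding bundle_B_line_sum bundle_iso_line_sum_iff[OF E] using A sp by simp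
  show "three_noncollinear t E P"
    unfolding three_noncollinear_def
  proof (rule exI[of _ A], rule exI[of _ "\<lambda>i. vec.span {point3 (t i) (u i)}"], intro conjI allI)
    show "bundle_iso E bundle_B A" by (rule iso)
    show "vec.span {point3 (t i) (u i)} = blow_down (Pt (t i)) (transport t A P i)" for i by (simp add: U)
    show "\<exists>i j k. vec.span {point3 (t i) (u i)} \<noteq> P2_origin \<and> vec.span {point3 (t j) (u j)} \<noteq> P2_origin \<and>
      vec.span {point3 (t k) (u k)} \<noteq> P2_origin \<and>
      \<not> P2_collinear {vec.span {point3 (t i) (u i)}, vec.span {point3 (t j) (u j)}, vec.span {point3 (t k) (u k)}}"
      using ni unfolding interpolable_iff_collinear[OF t] point3_origin by simp
  qed
qed

text \<open>In the coordinates of \<open>B\<close>, an endomorphism is \<open>(a, 0; p(z), b)\<close> with \<open>deg p \<le> 1\<close>, and it preserves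
  the line with coordinate \<open>c\<close> at \<open>z\<close> iff \<open>p(z) + b c = a c\<close>.\<close>

lemma generic_imp_simple:
  assumes E: "vector_bundle E" and t: "inj t" and gen: "generic_coordinates t E P F u"
  shows "simple_qp t E P"
  unfolding simple_qp_def
proof (intro allI impI)
  fix N assume N: "bundle_hom E E N \<and> (\<forall>i. (\<lambda>v. N (Pt (t i)) *v v) ` P i \<subseteq> P i)"
  have sp: "splitting E B_twists F" and P: "\<And>i. P i = vec.span {F (Pt (t i)) *v line_vec (u i)}"
    and ni: "\<not> interpolable t u" using gen unfolding generic_coordinates_def by auto
  note inv = splitting_invertible[OF sp]
  define K where "K x = matrix_inv (F x) ** (N x ** F x)" for x
  have r0: "regular_on (- {Infty}) (\<lambda>x. K x $ i $ j)" for i j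
    using hom_frame[OF E conjunct1[OF N] splitting_frame0[OF sp]] unfolding K_def regular_mat_on_def by blast
  have "regular_mat_on (- {Pt 0}) (\<lambda>x. matrix_inv (F x ** twist B_twists x) ** (N x ** (F x ** twist B_twists x)))"
    by (rule hom_frame[OF E conjunct1[OF N] splitting_frame1[OF sp]])
  also have "?this \<longleftrightarrow> regular_mat_on (- {Pt 0}) (\<lambda>x. twist (\<lambda>i. - B_twists i) x ** (K x ** twist B_twists x))"
    by (rule regular_mat_on_cong)
      (simp add: K_def matrix_inv_mult inv invertible_twist matrix_inv_twist matrix_mul_assoc)
  finally have r1: "regular_on (- {Pt 0}) (\<lambda>x. zpow (- B_twists i) x * (K x $ i $ j * zpow (B_twists j) x))" for i j
    unfolding regular_mat_on_def twist_zpow matrix_diagonal_mult_nth matrix_mult_diagonal_nth by blast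
  have eq: "zpow (- B_twists i) (Pt z) * (K (Pt z) $ i $ j * zpow (B_twists j) (Pt z)) = z powi (- (B_twists i - B_twists j)) * K (Pt z) $ i $ j"
    if "z \<noteq> 0" for z i j
    using that by (simp add: power_int_diff power_int_minus divide_inverse)
  obtain p11 where p11: "\<And>z. K (Pt z) $ 1 $ 1 = poly p11 z" "p11 \<noteq> 0 \<Longrightarrow> int (degree p11) \<le> 0"
    "K Infty $ 1 $ 1 = coeff p11 0"
    using twisted_polynomial[OF r0 r1 eq, of 1 1] by auto
  obtain p12 where p12: "\<And>z. K (Pt z) $ 1 $ 2 = poly p12 z" "p12 \<noteq> 0 \<Longrightarrow> int (degree p12) \<le> - 1"
    "K Infty $ 1 $ 2 = 0"
    using twisted_polynomial[OF r0 r1 eq, of 1 2] by auto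
  obtain p21 where p21: "\<And>z. K (Pt z) $ 2 $ 1 = poly p21 z" "p21 \<noteq> 0 \<Longrightarrow> int (degree p21) \<le> 1"
    "K Infty $ 2 $ 1 = coeff p21 1"
    using twisted_polynomial[OF r0 r1 eq, of 2 1] by auto
  obtain p22 where p22: "\<And>z. K (Pt z) $ 2 $ 2 = poly p22 z" "p22 \<noteq> 0 \<Longrightarrow> int (degree p22) \<le> 0"
    "K Infty $ 2 $ 2 = coeff p22 0"
    using twisted_polynomial[OF r0 r1 eq, of 2 2] by auto
  \<comment> \<open>This entry is a map from \<open>O(1)\<close> to \<open>O\<close>, a section of
    \<open>O(-1)\<close>.\<close>
  have p12_0: "p12 = 0" using p12(2) by (cases "p12 = 0") auto
  have c0: "\<exists>a. p = [:a:]" if "p \<noteq> 0 \<Longrightarrow> int (degree p) \<le> 0" for p :: "complex poly"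
    using that by (metis degree_0 degree_eq_zeroE le_zero_eq of_nat_le_0_iff)
  obtain a where a: "p11 = [:a:]" using c0[OF p11(2)] by blast
  obtain b where b: "p22 = [:b:]" using c0[OF p22(2)] by blast
  have d21: "degree p21 \<le> 1" using p21(2) by (cases "p21 = 0") auto
  note q = poly_degree_le_1[OF d21]
  have pres: "poly p21 (t i) + b * c = a * c" if c: "u i = Pt c" for i c
  proof -
    let ?F = "F (Pt (t i))"
    have "?F *v line_vec (u i) \<in> P i" unfolding P by (simp add: vec.span_base)
    then have "N (Pt (t i)) *v (?F *v line_vec (u i)) \<in> P i" using N by blast
    then obtain k where "N (Pt (t i)) *v (?F *v line_vec (u i)) = k *s (?F *v line_vec (u i))"
      unfolding P span_singleton_eq by blast
    then have "matrix_inv ?F *v (N (Pt (t i)) *v (?F *v line_vec (u i))) = matrix_inv ?F *v (?F *v (k *s line_vec (u i)))"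
      by (simp add: vector_scalar_commute)
    then have "K (Pt (t i)) *v line_vec (u i) = k *s line_vec (u i)"
      using inv by (simp add: K_def matrix_inv_cancel_vec matrix_vector_mul_assoc matrix_mul_assoc)
        (simp add: matrix_vector_mul_assoc[symmetric] matrix_inv_cancel_vec)
    then have "(K (Pt (t i)) *v line_vec (u i)) $ 1 = k * line_vec (u i) $ 1" "(K (Pt (t i)) *v line_vec (u i)) $ 2 = k * line_vec (u i) $ 2"
      by simp_all
    then have "a = k" "poly p21 (t i) + b * c = k * c"
      by (simp_all add: matrix_vector_mult_def sum_2 c p11 p12 p21 p22 p12_0 a b)
    then show ?thesis by simp
  qed
  \<comment> \<open>Otherwise \<open>p21 / (a - b)\<close> would interpolate the finite
    coordinates.\<close>
  have ab: "a = b"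
  proof (rule ccontr)
    assume "a \<noteq> b"
    have "c = coeff p21 0 / (a - b) + coeff p21 1 / (a - b) * t i" if "u i = Pt c" for i c
    proof -
      have "(a - b) * c = coeff p21 0 + coeff p21 1 * t i" using pres[OF that] by (simp add: q algebra_simps)
      then have "c = (coeff p21 0 + coeff p21 1 * t i) / (a - b)" using \<open>a \<noteq> b\<close> by (simp add: eq_divide_eq mult.commute)
      then show ?thesis by (simp add: add_divide_distrib)
    qed
    with ni show False unfolding interpolable_def by blast
  qed
  \<comment> \<open>Now \<open>p21\<close>, of degree at most 1, vanishes at every node with finite
    coordinate. If it were nonzero there would be at most one such node, and a constant would
    interpolate.\<close>
  have p0: "p21 = 0"
  proof (rule ccontr)
    assume n: "p21 \<noteq> 0"
    have root: "poly p21 (t i) = 0" if "u i = Pt c" for i c using pres[OF that] ab by simp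
    have uniq: "i = j" if "u i = Pt c" "u j = Pt d" for i j c d
    proof (rule ccontr)
      assume "i \<noteq> j"
      then have "t i \<noteq> t j" using t by (auto simp: inj_def)
      moreover have "coeff p21 0 + coeff p21 1 * t i = 0" "coeff p21 0 + coeff p21 1 * t j = 0"
        using root[OF that(1)] root[OF that(2)] by (simp_all add: q)
      ultimately have "coeff p21 1 = 0" "coeff p21 0 = 0"
        by (metis add_diff_cancel_left' diff_self mult_eq_0_iff right_diff_distrib' right_minus_eq)+
      then have "poly p21 z = 0" for z by (simp add: q)
      with n poly_all_0_iff_0[of p21] show False by blast
    qed
    have "interpolable t u"
    proof (cases "\<exists>i c. u i = Pt c")
      case True
      then obtain i c where i: "u i = Pt c" by blast
      have "d = c + 0 * t j" if "u j = Pt d" for j d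
        using uniq[OF i that] i that by simp
      then show ?thesis unfolding interpolable_def by blast
    qed (auto simp: interpolable_def)
    with ni show False by blast
  qed
  have K: "K x = mat a" for x
    by (cases x) (simp_all add: vec_eq_iff forall_2 mat_def p11 p12 p21 p22 p12_0 p0 a b ab)
  have "N x = mat a" for x
  proof -
    have "N x = F x ** (K x ** matrix_inv (F x))"
      using inv by (simp add: K_def matrix_mul_assoc[symmetric] matrix_inv_right matrix_inv_cancel)
    also have "\<dots> = mat a"
      unfolding K mat_commute[symmetric] using inv by (simp add: matrix_inv_cancel)
    finally show ?thesis .
  qed
  then show "\<exists>c. \<forall>x. N x = mat c" by blast
qed

section \<open>Changing the splitting, and interpolation at the four nodes\<close>

lemma splitting_swap:
  assumes "splitting E m (F :: p1 \<Rightarrow> complex^2^2)"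
  obtains G where "splitting E (\<lambda>i. if i = 1 then m 2 else m 1) G"
proof -
  define G :: "p1 \<Rightarrow> complex^2^2" where "G x = (\<chi> i j. F x $ i $ (if j = 1 then 2 else 1))" for x
  have det: "det (G x) = - det (F x)" for x by (simp add: G_def det_2 mult.commute)
  have twist: "det (G x ** twist (\<lambda>i. if i = 1 then m 2 else m 1) x) = - det (F x ** twist m x)" for x
    by (simp add: det_mul det) (simp add: twist_zpow det_2 mult.commute)
  have c: "column 1 (G x) = column 2 (F x)" "column 2 (G x) = column 1 (F x)" for x
    by (simp_all add: column_def G_def)
  have d: "column 1 (G x ** twist (\<lambda>i. if i = 1 then m 2 else m 1) x) = column 2 (F x ** twist m x)"
    "column 2 (G x ** twist (\<lambda>i. if i = 1 then m 2 else m 1) x) = column 1 (F x ** twist m x)" for x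
    unfolding column_def twist_zpow matrix_mult_diagonal_nth by (simp_all add: G_def)
  have "splitting E (\<lambda>i. if i = 1 then m 2 else m 1) G"
    using assms unfolding splitting_def frame_columns forall_2 c d invertible_det_nz det twist by simp
  then show ?thesis by (rule that)
qed

text \<open>Adding to the first basis vector a multiple of the second one, by a section \<open>h\<close> of
  \<open>\<O>(m\<^sub>2 - m\<^sub>1)\<close>.\<close>

lemma splitting_shear:
  assumes sp: "splitting E m (F :: p1 \<Rightarrow> complex^2^2)" and h: "int (degree h) \<le> m 2 - m 1"
  obtains G where "splitting E m G" "\<And>z. column 1 (G (Pt z)) = F (Pt z) *v line_vec (Pt (poly h z))"
    "\<And>z. column 2 (G (Pt z)) = F (Pt z) *v line_vec Infty"
proof -
  define d where "d = nat (m 2 - m 1)"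
  have hd: "degree h \<le> d" and md: "m 2 = m 1 + int d" using h by (simp_all add: d_def)
  \<comment> \<open>\<open>S\<close> and \<open>T\<close> are the shear in the two frames. The
    section \<open>h\<close> of \<open>O(d)\<close> has the coordinate \<open>flip_poly d h\<close>
    near infinity, with the value \<open>coeff h d\<close> at \<open>Infty\<close>.\<close>
  define S :: "p1 \<Rightarrow> complex^2^2" where
    "S x = vector [vector [1, 0], vector [case x of Pt z \<Rightarrow> poly h z | Infty \<Rightarrow> coeff h d, 1]]" for x
  define T :: "p1 \<Rightarrow> complex^2^2" where
    "T x = vector [vector [1, 0], vector [poly (flip_poly d h) (coord_inf x), 1]]" for x
  have inv: "invertible (S x)" "invertible (T x)" for x
    by (simp_all add: invertible_det_nz det_2 S_def T_def)
  have Sreg: "regular_mat_on (- {Infty}) S"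
  proof -
    have "regular_on (- {Infty}) (\<lambda>x. case x of Pt z \<Rightarrow> poly h z | Infty \<Rightarrow> coeff h d) \<longleftrightarrow>
        regular_on (- {Infty}) (\<lambda>x. poly h (coord_0 x))"
      by (rule regular_on_cong) (auto split: p1.splits)
    moreover have "regular_on (- {Infty}) (\<lambda>x. poly h (coord_0 x))" by (intro regular_on_poly regular_on_coord_0) simp
    ultimately show ?thesis unfolding regular_mat_on_def forall_2 S_def by simp
  qed
  have "regular_on (- {Pt 0}) (\<lambda>x. poly (flip_poly d h) (coord_inf x))"
    by (intro regular_on_poly regular_on_coord_inf) simp
  then have Treg: "regular_mat_on (- {Pt 0}) T"
    unfolding regular_mat_on_def forall_2 T_def by simp
  have comm: "twist m x ** T x = S x ** twist m x" if "x \<in> - {Pt 0}" for x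
    unfolding vec_eq_iff twist_zpow matrix_mult_diagonal_nth matrix_diagonal_mult_nth forall_2
  proof (intro conjI)
    show "zpow (m 2) x * T x $ 2 $ 1 = S x $ 2 $ 1 * zpow (m 1) x"
    proof (cases x)
      case (Pt z)
      with that have z: "z \<noteq> 0" by simp
      then show ?thesis using hd by (simp add: Pt T_def S_def poly_flip_poly md power_int_add)
    qed (simp add: T_def S_def poly_flip_poly_0 hd)
  qed (simp_all add: T_def S_def)
  define G where "G x = F x ** S x" for x
  have "frame E (- {Infty}) G"
    unfolding G_def by (rule frame_mult[OF splitting_frame0[OF sp] _ Sreg]) (auto simp: inv)
  moreover have "frame E (- {Pt 0}) (\<lambda>x. G x ** twist m x)"
  proof (rule frame_cong)
    show "frame E (- {Pt 0}) (\<lambda>x. F x ** twist m x ** T x)"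
      by (rule frame_mult[OF splitting_frame1[OF sp] _ Treg]) (auto simp: inv)
    show "F x ** twist m x ** T x = G x ** twist m x" if "x \<in> - {Pt 0}" for x
      using comm[OF that] by (simp add: G_def matrix_mul_assoc[symmetric])
  qed
  ultimately have "splitting E m G" unfolding splitting_def by blast
  moreover have "column 1 (S (Pt z)) = line_vec (Pt (poly h z))" "column 2 (S (Pt z)) = line_vec Infty" for z
    by (simp_all add: column_def S_def line_vec_def vec_eq_iff forall_2)
  then have "column 1 (G (Pt z)) = F (Pt z) *v line_vec (Pt (poly h z))" "column 2 (G (Pt z)) = F (Pt z) *v line_vec Infty" for z
    unfolding G_def column_mult by simp_all
  ultimately show ?thesis by (rule that)
qed

text \<open>The Lagrange basis polynomials before normalisation. Left monic, they let the sum of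
  residues be read off as a top coefficient.\<close>

definition nodal_poly :: "('i::finite \<Rightarrow> complex) \<Rightarrow> 'i \<Rightarrow> complex poly" where
  "nodal_poly t i = (\<Prod>j\<in>UNIV - {i}. [:- t j, 1:])"

lemma poly_nodal_poly: "poly (nodal_poly t i) z = (\<Prod>j\<in>UNIV - {i}. z - t j)"
  by (simp add: nodal_poly_def poly_prod)

lemma poly_nodal_poly_node:
  assumes "inj t"
  shows "poly (nodal_poly t i) (t k) = 0 \<longleftrightarrow> k \<noteq> i"
  using assms by (auto simp: poly_nodal_poly inj_def)

lemma nodal_poly_monic: "degree (nodal_poly (t :: 4 \<Rightarrow> complex) i) = 3" "coeff (nodal_poly t i) 3 = 1"
proof -
  have "degree (nodal_poly t i) = (\<Sum>j\<in>UNIV - {i}. degree [:- t j, 1:])"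
    unfolding nodal_poly_def by (rule degree_prod_sum_eq) simp
  then show d: "degree (nodal_poly t i) = 3" by simp
  have "lead_coeff (nodal_poly t i) = 1"
    unfolding nodal_poly_def by (simp add: lead_coeff_prod)
  with d show "coeff (nodal_poly t i) 3 = 1" by simp
qed

lemma exists_interpolating_poly:
  fixes t :: "4 \<Rightarrow> complex"
  assumes t: "inj t"
  obtains h where "degree h \<le> 3" "\<And>i. poly h (t i) = c i"
proof
  let ?h = "\<Sum>i\<in>UNIV. smult (c i / poly (nodal_poly t i) (t i)) (nodal_poly t i)"
  show "degree ?h \<le> 3"
    by (intro degree_sum_le) (auto simp: nodal_poly_monic intro: order.trans[OF degree_smult_le])
  fix k
  have "poly ?h (t k) = (\<Sum>i\<in>UNIV. if i = k then c k else 0)"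
    unfolding poly_sum by (rule sum.cong) (use poly_nodal_poly_node[OF t] in auto)
  then show "poly ?h (t k) = c k" by simp
qed

text \<open>The twists add up to 1, so they are distinct and can be ordered. Their odd difference is
  1, giving \<open>B\<close>, or at least 3, where a cubic through the four nodes always splits the
  parabolic structure.\<close>

lemma indecomposable_imp_generic:
  assumes E: "vector_bundle E" and t: "inj t" and P: "\<And>i. is_line (P i)" and deg: "bundle_degree E = 1"
    and ind: "\<not> decomposable_qp t E P"
  obtains F u where "generic_coordinates t E P F u"
proof -
  obtain m0 F0 where sp0: "splitting E m0 (F0 :: p1 \<Rightarrow> complex^2^2)" by (rule splitting_exists[OF E]) blast
  have sum0: "m0 1 + m0 2 = 1"
    using bundle_degree_splitting[OF E sp0] deg by (simp add: sum_2)
  obtain m F where sp: "splitting E m F" and sum: "m 1 + m 2 = (1::int)" and lt: "m 1 < m (2::2)"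
  proof (cases "m0 1 < m0 2")
    case True
    with sp0 sum0 that show ?thesis by blast
  next
    case False
    obtain G where "splitting E (\<lambda>i. if i = 1 then m0 2 else m0 1) G" by (rule splitting_swap[OF sp0]) blast
    moreover have "m0 2 < m0 1" using False sum0 by presburger
    ultimately show ?thesis using sum0 by (intro that[of "\<lambda>i. if i = 1 then m0 2 else m0 1" G]) auto
  qed
  have "\<forall>i. \<exists>u. P i = vec.span {F (Pt (t i)) *v line_vec u}"
    using is_line_line_vec[OF P splitting_invertible[OF sp]] by metis
  then obtain u where u: "\<And>i. P i = vec.span {F (Pt (t i)) *v line_vec (u i)}" by metis
  \<comment> \<open>Shearing by \<open>h\<close> moves the first summand onto the lines with finite
    coordinates, while the lines with infinite coordinate stay in the second one.\<close>
  have nopoly: False if h: "int (degree h) \<le> m 2 - m 1" "\<And>i c. u i = Pt c \<Longrightarrow> poly h (t i) = c" for h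
  proof -
    obtain G where G: "splitting E m G" "\<And>z. column 1 (G (Pt z)) = F (Pt z) *v line_vec (Pt (poly h z))"
      "\<And>z. column 2 (G (Pt z)) = F (Pt z) *v line_vec Infty"
      by (rule splitting_shear[OF sp h(1)]) blast
    have "P i = vec.span {column 1 (G (Pt (t i)))} \<or> P i = vec.span {column 2 (G (Pt (t i)))}" for i
    proof (cases "u i")
      case (Pt c)
      then show ?thesis using h(2)[OF Pt] by (simp add: u G)
    next
      case Infty
      then show ?thesis by (simp add: u G)
    qed
    with G(1) ind show False unfolding decomposable_iff_splitting[OF E] by blast
  qed
  have small: "m 2 - m 1 < 3"
  proof (rule ccontr)
    assume n: "\<not> m 2 - m 1 < 3"
    \<comment> \<open>At nodes with infinite coordinate the value 0 is arbitrary.\<close>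
    obtain h where h: "degree h \<le> 3" "\<And>i. poly h (t i) = (case u i of Pt c \<Rightarrow> c | Infty \<Rightarrow> 0)"
      by (rule exists_interpolating_poly[OF t, of "\<lambda>i. case u i of Pt c \<Rightarrow> c | Infty \<Rightarrow> 0"]) blast
    show False by (rule nopoly[of h]) (use h n in auto)
  qed
  then have m12: "m 1 = 0" "m 2 = 1" using sum lt by presburger+
  then have "m = B_twists" by (simp add: fun_eq_iff forall_2)
  moreover have "\<not> interpolable t u"
  proof
    assume "interpolable t u"
    then obtain \<beta> \<gamma> where b: "\<And>i c. u i = Pt c \<Longrightarrow> c = \<beta> + \<gamma> * t i" unfolding interpolable_def by blast
    show False
    proof (rule nopoly[of "[:\<beta>, \<gamma>:]"])
      show "poly [:\<beta>, \<gamma>:] (t i) = c" if "u i = Pt c" for i c using b[OF that] by (simp add: mult.commute)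
    qed (simp add: m12)
  qed
  ultimately have "generic_coordinates t E P F u" using sp u unfolding generic_coordinates_def by simp
  then show ?thesis by (rule that)
qed

section \<open>Logarithmic forms and connections\<close>

definition residue_chart :: "complex \<Rightarrow> p1 \<Rightarrow> complex" where
  "residue_chart t x = (case x of Pt z \<Rightarrow> (if z = t then 1 else z - t) | Infty \<Rightarrow> 1)"

definition infinity_chart :: "p1 \<Rightarrow> complex" where
  "infinity_chart x = (case x of Pt z \<Rightarrow> - (z ^ 2) | Infty \<Rightarrow> 1)"

section \<open>Charts of the bundle of logarithmic forms\<close>

lemma log_forms_cases:
  assumes "(V, \<omega>) \<in> log_forms D"
  obtains (affine) "V = - insert Infty (Pt ` D)" "\<omega> = (\<lambda>_. mat 1)"
  | (node) t where "t \<in> D" "V = - insert Infty (Pt ` (D - {t}))" "\<omega> = (\<lambda>x. mat (residue_chart t x))"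
  | (infinity) "V = - (Pt ` insert 0 D)" "\<omega> = (\<lambda>x. mat (infinity_chart x))"
  using assms unfolding log_forms_def residue_chart_def infinity_chart_def by fastforce

lemma log_forms_charts:
  "(- insert Infty (Pt ` D), \<lambda>_. mat 1) \<in> log_forms D"
  "t \<in> D \<Longrightarrow> (- insert Infty (Pt ` (D - {t})), \<lambda>x. mat (residue_chart t x)) \<in> log_forms D"
  "(- (Pt ` insert 0 D), \<lambda>x. mat (infinity_chart x)) \<in> log_forms D"
  unfolding log_forms_def residue_chart_def infinity_chart_def by auto

lemma mat_nth_11 [simp]: "(mat c :: 'a::zero^1^1) $ 1 $ 1 = c"
  by (simp add: mat_def)

lemma log_forms_chart:
  fixes \<omega> :: "p1 \<Rightarrow> complex^1^1"
  assumes D: "finite D" and V: "(V, \<omega>) \<in> log_forms D"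
  shows "zariski_open V" "x \<in> V \<Longrightarrow> \<omega> x $ 1 $ 1 \<noteq> 0"
    "regular_on (V \<inter> - insert Infty (Pt ` D)) (\<lambda>x. \<omega> x $ 1 $ 1)"
proof -
  have "zariski_open V \<and> (\<forall>x\<in>V. \<omega> x $ 1 $ 1 \<noteq> 0) \<and>
    regular_on (V \<inter> - insert Infty (Pt ` D)) (\<lambda>x. \<omega> x $ 1 $ 1)"
    using V
  proof (cases rule: log_forms_cases)
    case affine
    then show ?thesis using D by (auto intro!: zariski_open_cofinite)
  next
    case (node t)
    let ?S = "V \<inter> - insert Infty (Pt ` D)"
    have "regular_on ?S (\<lambda>x. coord_0 x - t)" by (intro regular_on_diff regular_on_coord_0 regular_on_const) auto
    also have "?this \<longleftrightarrow> regular_on ?S (\<lambda>x. \<omega> x $ 1 $ 1)"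
    proof (rule regular_on_cong)
      fix x assume "x \<in> ?S"
      then show "coord_0 x - t = \<omega> x $ 1 $ 1" using node by (cases x) (auto simp: residue_chart_def)
    qed
    finally show ?thesis using node D
      by (auto intro!: zariski_open_cofinite simp: residue_chart_def split: p1.splits)
  next
    case infinity
    let ?S = "V \<inter> - insert Infty (Pt ` D)"
    have "regular_on ?S (\<lambda>x. - (coord_0 x ^ 2))" by (intro regular_on_minus regular_on_power regular_on_coord_0) auto
    also have "?this \<longleftrightarrow> regular_on ?S (\<lambda>x. \<omega> x $ 1 $ 1)"
    proof (rule regular_on_cong)
      fix x assume "x \<in> ?S"
      then show "- (coord_0 x ^ 2) = \<omega> x $ 1 $ 1" using infinity by (cases x) (auto simp: infinity_chart_def)
    qed
    finally show ?thesis using infinity D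
      by (auto intro!: zariski_open_cofinite simp: infinity_chart_def split: p1.splits)
  qed
  then show "zariski_open V" "x \<in> V \<Longrightarrow> \<omega> x $ 1 $ 1 \<noteq> 0"
    "regular_on (V \<inter> - insert Infty (Pt ` D)) (\<lambda>x. \<omega> x $ 1 $ 1)" by auto
qed

text \<open>Two different charts overlap only away from the nodes and \<open>Infty\<close>, where
  all chart functions are regular and nonzero.\<close>

lemma log_forms_transition:
  fixes \<omega> \<psi> :: "p1 \<Rightarrow> complex^1^1"
  assumes D: "finite D" and V: "(V, \<omega>) \<in> log_forms D" "(W, \<psi>) \<in> log_forms D"
  shows "regular_on (V \<inter> W) (\<lambda>x. \<psi> x $ 1 $ 1 / \<omega> x $ 1 $ 1)"
proof (cases "V = W \<and> \<omega> = \<psi>")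
  case True
  then have "regular_on (V \<inter> W) (\<lambda>x. \<psi> x $ 1 $ 1 / \<omega> x $ 1 $ 1) \<longleftrightarrow> regular_on (V \<inter> W) (\<lambda>_. 1)"
    using log_forms_chart(2)[OF D V(1)] by (intro regular_on_cong) auto
  then show ?thesis by simp
next
  case False
  have "V \<inter> W \<subseteq> - insert Infty (Pt ` D)"
    using V(1)
  proof (cases rule: log_forms_cases)
    case affine
    then show ?thesis by auto
  next
    case (node t)
    from V(2) show ?thesis by (cases rule: log_forms_cases) (use node False in auto)
  next
    case infinity
    from V(2) show ?thesis by (cases rule: log_forms_cases) (use infinity False in auto)
  qed
  then have "V \<inter> W \<subseteq> V \<inter> - insert Infty (Pt ` D)" "V \<inter> W \<subseteq> W \<inter> - insert Infty (Pt ` D)" by auto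
  then show ?thesis
    using regular_on_subset[OF log_forms_chart(3)[OF D V(1)]] regular_on_subset[OF log_forms_chart(3)[OF D V(2)]]
      log_forms_chart(2)[OF D V(1)]
    by (intro regular_on_divide) auto
qed

lemma tensor_chart:
  assumes "(U, \<phi>) \<in> E" "(V, \<omega>) \<in> L"
  shows "(U \<inter> V, \<lambda>x. \<chi> i j. \<omega> x $ 1 $ 1 * \<phi> x $ i $ j) \<in> tensor_line E L"
  unfolding tensor_line_def by (rule CollectI, intro exI conjI, rule refl, rule assms(1), rule assms(2))

lemma scaled_mult_vec: "(\<chi> i j. c * A $ i $ j) *v v = c *s (A *v v)" for A :: "'a::comm_ring_1^'n^'m"
  by (simp add: vec_eq_iff matrix_vector_mult_def sum_distrib_left mult.assoc)

lemma tensor_section_frame: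
  fixes E :: "('n::finite) vbundle"
  assumes E: "vector_bundle E" and s: "is_section (tensor_line E (log_forms D)) U s"
    and G: "frame E W G" and V: "(V, \<omega>) \<in> log_forms D"
  shows "regular_vec_on (U \<inter> W \<inter> V) (\<lambda>x. \<omega> x $ 1 $ 1 *s (matrix_inv (G x) *v s x))"
proof (rule regular_vec_on_local)
  fix x assume "x \<in> U \<inter> W \<inter> V"
  obtain Y \<phi> where Y: "(Y, \<phi>) \<in> E" "x \<in> Y" "zariski_open Y" "\<And>y. y \<in> Y \<Longrightarrow> invertible (\<phi> y)"
    using vector_bundle_chart[OF E] by blast
  let ?U = "U \<inter> W \<inter> V \<inter> Y"
  have s': "regular_vec_on (U \<inter> (Y \<inter> V)) (\<lambda>x. \<omega> x $ 1 $ 1 *s (\<phi> x *v s x))"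
    using is_section_regular[OF s tensor_chart[OF Y(1) V]] by (simp add: scaled_mult_vec)
  have "regular_vec_on ?U (\<lambda>x. matrix_inv (\<phi> x ** G x) *v (\<omega> x $ 1 $ 1 *s (\<phi> x *v s x)))"
  proof (rule regular_vec_on_mult[OF regular_mat_on_matrix_inv])
    show "regular_mat_on ?U (\<lambda>x. \<phi> x ** G x)" by (rule regular_mat_on_subset[OF frame_regular[OF G Y(1)]]) blast
    show "regular_vec_on ?U (\<lambda>x. \<omega> x $ 1 $ 1 *s (\<phi> x *v s x))" by (rule regular_vec_on_subset[OF s']) blast
  qed (use frame_invertible[OF G] Y(4) in \<open>auto intro: invertible_mult\<close>)
  also have "?this \<longleftrightarrow> regular_vec_on ?U (\<lambda>x. \<omega> x $ 1 $ 1 *s (matrix_inv (G x) *v s x))"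
    by (rule regular_vec_on_cong)
      (use frame_invertible[OF G] Y(4) in
        \<open>simp add: vector_scalar_commute matrix_inv_mult matrix_vector_mul_assoc[symmetric] matrix_inv_cancel_vec\<close>)
  finally show "\<exists>Y. zariski_open Y \<and> x \<in> Y \<and> regular_vec_on (U \<inter> W \<inter> V \<inter> Y) (\<lambda>x. \<omega> x $ 1 $ 1 *s (matrix_inv (G x) *v s x))"
    using Y by blast
qed

lemma tensor_sectionI:
  fixes E :: "('n::finite) vbundle" and s :: "p1 \<Rightarrow> complex^'n"
  assumes D: "finite D"
    and loc: "\<And>x. x \<in> U \<Longrightarrow> \<exists>V \<omega> W G. (V, \<omega>) \<in> log_forms D \<and> x \<in> V \<and> zariski_open W \<and> x \<in> W \<and> frame E W G \<and>
      regular_vec_on (U \<inter> W \<inter> V) (\<lambda>x. \<omega> x $ 1 $ 1 *s (matrix_inv (G x) *v s x))"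
  shows "is_section (tensor_line E (log_forms D)) U s"
  unfolding is_section_def
proof safe
  fix Y \<theta> assume "(Y, \<theta>) \<in> tensor_line E (log_forms D)"
  then obtain U' \<phi> V' \<psi> where Y: "Y = U' \<inter> V'" "(U', \<phi>) \<in> E" "(V', \<psi>) \<in> log_forms D"
    and \<theta>: "\<theta> = (\<lambda>x. \<chi> i j. \<psi> x $ 1 $ 1 * \<phi> x $ i $ j)" by (auto simp: tensor_line_def)
  show "regular_vec_on (U \<inter> Y) (\<lambda>x. \<theta> x *v s x)"
  proof (rule regular_vec_on_local)
    fix x assume x: "x \<in> U \<inter> Y"
    then obtain V W \<omega> G where V: "(V, \<omega>) \<in> log_forms D" "x \<in> V" and W: "zariski_open W" "x \<in> W" "frame E W G"
      and r: "regular_vec_on (U \<inter> W \<inter> V) (\<lambda>x. \<omega> x $ 1 $ 1 *s (matrix_inv (G x) *v s x))" using loc by blast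
    let ?U = "U \<inter> Y \<inter> (V \<inter> W)"
    have "regular_vec_on ?U (\<lambda>x. (\<psi> x $ 1 $ 1 / \<omega> x $ 1 $ 1) *s ((\<phi> x ** G x) *v (\<omega> x $ 1 $ 1 *s (matrix_inv (G x) *v s x))))"
    proof (rule regular_vec_on_scale[OF _ regular_vec_on_mult])
      show "regular_on ?U (\<lambda>x. \<psi> x $ 1 $ 1 / \<omega> x $ 1 $ 1)"
        by (rule regular_on_subset[OF log_forms_transition[OF D V(1) Y(3)]]) (use Y in blast)
      show "regular_mat_on ?U (\<lambda>x. \<phi> x ** G x)"
        by (rule regular_mat_on_subset[OF frame_regular[OF W(3) Y(2)]]) (use Y in blast)
      show "regular_vec_on ?U (\<lambda>x. \<omega> x $ 1 $ 1 *s (matrix_inv (G x) *v s x))"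
        by (rule regular_vec_on_subset[OF r]) blast
    qed
    also have "?this \<longleftrightarrow> regular_vec_on ?U (\<lambda>x. \<theta> x *v s x)"
      by (rule regular_vec_on_cong)
        (use log_forms_chart(2)[OF D V(1)] frame_invertible[OF W(3)] in
          \<open>simp add: \<theta> scaled_mult_vec vector_scalar_commute matrix_vector_mul_assoc[symmetric] matrix_inv_cancel_vec\<close>)
    finally show "\<exists>V. zariski_open V \<and> x \<in> V \<and> regular_vec_on (U \<inter> Y \<inter> V) (\<lambda>x. \<theta> x *v s x)"
      using V W log_forms_chart(1)[OF D V(1)] zariski_open_Int by blast
  qed
qed

section \<open>The differential of a regular function\<close>

lemma open_chart_vimage:
  assumes "c \<in> {aff_0, aff_inf}" "zariski_open U"
  shows "open {w. c w \<in> U}"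
proof (cases "U = {}")
  case False
  have "finite {w. c w \<notin> U}" by (rule finite_chart_compl[OF assms False])
  then have "open (- {w. c w \<notin> U})" by (intro open_Compl finite_imp_closed)
  moreover have "- {w. c w \<notin> U} = {w. c w \<in> U}" by auto
  ultimately show ?thesis by simp
qed simp

lemma regular_on_chart_deriv:
  assumes f: "regular_on U f" and U: "zariski_open U" and c: "c \<in> {aff_0, aff_inf}" and a: "c a \<in> U"
  obtains p q where "poly q a \<noteq> 0"
    "\<And>w. c w \<in> U \<Longrightarrow> poly q w \<noteq> 0 \<Longrightarrow> ((\<lambda>w. f (c w)) has_field_derivative poly p w / poly q w) (at w)"
proof -
  obtain p q where q: "poly q a \<noteq> 0" and pq: "\<And>w. c w \<in> U \<Longrightarrow> poly q w \<noteq> 0 \<Longrightarrow> f (c w) = poly p w / poly q w"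
    using f c a unfolding regular_on_def by blast
  let ?S = "{w. c w \<in> U} \<inter> {w. poly q w \<noteq> 0}"
  have "{w. poly q w \<noteq> 0} = - {w. poly q w = 0}" by auto
  then have "open {w. poly q w \<noteq> 0}"
    using finite_imp_closed[OF finite_poly_zero[OF q]] by (simp add: open_Compl)
  then have S: "open ?S" by (intro open_Int open_chart_vimage c U)
  show ?thesis
  proof (rule that[of "q * q" "pderiv p * q - p * pderiv q"])
    show "poly (q * q) a \<noteq> 0" using q by simp
    fix w assume w: "c w \<in> U" "poly (q * q) w \<noteq> 0"
    have "((\<lambda>w. poly p w / poly q w) has_field_derivative
       (poly (pderiv p) w * poly q w - poly p w * poly (pderiv q) w) / (poly q w * poly q w)) (at w)"
      using w by (intro DERIV_divide poly_DERIV) auto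
    then have "((\<lambda>w. f (c w)) has_field_derivative
       (poly (pderiv p) w * poly q w - poly p w * poly (pderiv q) w) / (poly q w * poly q w)) (at w)"
      by (rule has_field_derivative_transform_within_open[OF _ S]) (use w pq in auto)
    then show "((\<lambda>w. f (c w)) has_field_derivative poly (pderiv p * q - p * pderiv q) w / poly (q * q) w) (at w)"
      by simp
  qed
qed

lemma regular_on_differentiable:
  assumes "regular_on U f" "zariski_open U" "c \<in> {aff_0, aff_inf}" "c a \<in> U"
  shows "((\<lambda>w. f (c w)) has_field_derivative deriv (\<lambda>w. f (c w)) a) (at a)"
  using regular_on_chart_deriv[OF assms] assms(4) DERIV_imp_deriv by metis

lemma log_d_cong:
  assumes V: "zariski_open V" "x \<in> V" and eq: "\<And>y. y \<in> V \<Longrightarrow> f y = g y"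
  shows "log_d D f x = log_d D g x"
proof -
  have "deriv (\<lambda>w. f (c w)) a = deriv (\<lambda>w. g (c w)) a" if c: "c \<in> {aff_0, aff_inf}" "c a \<in> V" for c a
  proof (rule deriv_cong_ev)
    have "\<forall>\<^sub>F w in nhds a. c w \<in> V"
      using eventually_nhds_in_open[OF open_chart_vimage[OF c(1) V(1)]] c(2) by simp
    then show "\<forall>\<^sub>F w in nhds a. f (c w) = g (c w)"
      by (rule eventually_mono) (rule eq)
  qed simp
  from this[of aff_0] this[of aff_inf 0] V(2) show ?thesis
    by (cases x) (auto simp: log_d_def aff_0_def aff_inf_def)
qed

lemma log_d_add:
  assumes "regular_on U f" "regular_on U g" "zariski_open U" "x \<in> U"
  shows "log_d D (\<lambda>y. f y + g y) x = log_d D f x + log_d D g x"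
proof -
  have "deriv (\<lambda>w. f (c w) + g (c w)) a = deriv (\<lambda>w. f (c w)) a + deriv (\<lambda>w. g (c w)) a"
    if c: "c \<in> {aff_0, aff_inf}" "c a \<in> U" for c a
    by (intro DERIV_imp_deriv DERIV_add regular_on_differentiable[OF _ assms(3) c] assms)
  from this[of aff_0] this[of aff_inf 0] assms(4) show ?thesis
    by (cases x) (auto simp: log_d_def aff_0_def aff_inf_def)
qed

lemma log_d_mult:
  assumes "regular_on U f" "regular_on U g" "zariski_open U" "x \<in> U"
  shows "log_d D (\<lambda>y. f y * g y) x = f x * log_d D g x + log_d D f x * g x"
proof -
  have d: "deriv (\<lambda>w. f (c w) * g (c w)) a = f (c a) * deriv (\<lambda>w. g (c w)) a + deriv (\<lambda>w. f (c w)) a * g (c a)"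
    if c: "c \<in> {aff_0, aff_inf}" "c a \<in> U" for c a
  proof -
    have "deriv (\<lambda>w. f (c w) * g (c w)) a = deriv (\<lambda>w. f (c w)) a * g (c a) + deriv (\<lambda>w. g (c w)) a * f (c a)"
      by (intro DERIV_imp_deriv DERIV_mult regular_on_differentiable[OF _ assms(3) c] assms)
    then show ?thesis by (simp add: mult.commute)
  qed
  from d[of aff_0] d[of aff_inf 0] assms(4) show ?thesis
    by (cases x) (auto simp: log_d_def aff_0_def aff_inf_def)
qed

text \<open>In the respective charts the expression is \<open>f'\<close>,
  \<open>(z - t) * f'\<close>, or the derivative in \<open>w\<close>. The value 0 that
  \<open>log_d\<close> takes at a node is the one that makes the second formula hold there.\<close>

lemma log_d_regular:
  fixes \<omega> :: "p1 \<Rightarrow> complex^1^1"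
  assumes f: "regular_on U f" and U: "zariski_open U" and V: "(V, \<omega>) \<in> log_forms D"
  shows "regular_on (U \<inter> V) (\<lambda>x. \<omega> x $ 1 $ 1 * log_d D f x)"
proof (rule regular_on_chartI)
  fix x assume x: "x \<in> U \<inter> V"
  have aff: "\<exists>a p q. x = aff_0 a \<and> poly q a \<noteq> 0 \<and>
      (\<forall>w. aff_0 w \<in> U \<inter> V \<and> poly q w \<noteq> 0 \<longrightarrow> \<omega> (aff_0 w) $ 1 $ 1 * log_d D f (aff_0 w) = poly p w / poly q w)"
    if nI: "Infty \<notin> V" and r: "\<And>z. Pt z \<in> V \<Longrightarrow> \<omega> (Pt z) $ 1 $ 1 * log_d D f (Pt z) = poly r z * deriv (\<lambda>z. f (aff_0 z)) z"
    for r
  proof -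
    obtain a where a: "x = aff_0 a" using x nI by (cases x) (auto simp: aff_0_def)
    have c: "aff_0 \<in> {aff_0, aff_inf}" "aff_0 a \<in> U" using x a by auto
    obtain p q where pq: "poly q a \<noteq> 0"
      "\<And>w. aff_0 w \<in> U \<Longrightarrow> poly q w \<noteq> 0 \<Longrightarrow> ((\<lambda>w. f (aff_0 w)) has_field_derivative poly p w / poly q w) (at w)"
      by (rule regular_on_chart_deriv[OF f U c]) blast
    have "\<omega> (aff_0 w) $ 1 $ 1 * log_d D f (aff_0 w) = poly (r * p) w / poly q w"
      if "aff_0 w \<in> U \<inter> V" "poly q w \<noteq> 0" for w
      using that r[of w] DERIV_imp_deriv[OF pq(2)[of w]] by (simp add: aff_0_def)
    with a pq(1) show ?thesis by blast
  qed
  show "\<exists>c\<in>{aff_0, aff_inf}. \<exists>a p q. x = c a \<and> poly q a \<noteq> 0 \<and>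
      (\<forall>w. c w \<in> U \<inter> V \<and> poly q w \<noteq> 0 \<longrightarrow> \<omega> (c w) $ 1 $ 1 * log_d D f (c w) = poly p w / poly q w)"
    using V
  proof (cases rule: log_forms_cases)
    case affine
    have "\<exists>a p q. x = aff_0 a \<and> poly q a \<noteq> 0 \<and>
      (\<forall>w. aff_0 w \<in> U \<inter> V \<and> poly q w \<noteq> 0 \<longrightarrow> \<omega> (aff_0 w) $ 1 $ 1 * log_d D f (aff_0 w) = poly p w / poly q w)"
      by (rule aff[of 1]) (use affine in \<open>auto simp: log_d_def\<close>)
    then show ?thesis by (intro bexI[of _ aff_0]) auto
  next
    case (node t)
    have "\<exists>a p q. x = aff_0 a \<and> poly q a \<noteq> 0 \<and>
      (\<forall>w. aff_0 w \<in> U \<inter> V \<and> poly q w \<noteq> 0 \<longrightarrow> \<omega> (aff_0 w) $ 1 $ 1 * log_d D f (aff_0 w) = poly p w / poly q w)"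
      by (rule aff[of "[:-t, 1:]"]) (use node in \<open>auto simp: log_d_def residue_chart_def\<close>)
    then show ?thesis by (intro bexI[of _ aff_0]) auto
  next
    case infinity
    \<comment> \<open>The chain rule for \<open>w = 1/z\<close>: the chart factor
      \<open>- (z ^ 2)\<close> turns the derivative in \<open>z\<close> into the derivative in
      \<open>w\<close>.\<close>
    have val: "\<omega> (aff_inf w) $ 1 $ 1 * log_d D f (aff_inf w) = deriv (\<lambda>w. f (aff_inf w)) w"
      if w: "aff_inf w \<in> U \<inter> V" for w
    proof (cases "w = 0")
      case True
      then show ?thesis using infinity by (simp add: log_d_def aff_inf_def infinity_chart_def)
    next
      case False
      let ?z = "inverse w"
      have z: "aff_inf w = Pt ?z" using False by (simp add: aff_inf_def divide_inverse)
      have zD: "?z \<notin> D" using w infinity z by auto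
      have zU: "aff_0 ?z \<in> U" using w by (simp add: aff_0_def z)
      have d: "((\<lambda>z. f (aff_0 z)) has_field_derivative deriv (\<lambda>z. f (aff_0 z)) ?z) (at ?z)"
        using regular_on_differentiable[OF f U, of aff_0 ?z] zU by simp
      have i: "(inverse has_field_derivative - (inverse w ^ Suc (Suc 0))) (at w)"
        using DERIV_inverse[OF False] .
      have "((\<lambda>w. f (aff_0 (inverse w))) has_field_derivative
          deriv (\<lambda>z. f (aff_0 z)) ?z * - (inverse w ^ Suc (Suc 0))) (at w)"
        using DERIV_chain2[OF d i] .
      then have "((\<lambda>w. f (aff_inf w)) has_field_derivative
          deriv (\<lambda>z. f (aff_0 z)) ?z * - (inverse w ^ Suc (Suc 0))) (at w)"
        by (rule has_field_derivative_transform_within_open[of _ _ _ "- {0}"])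
          (use False in \<open>auto simp: aff_0_def aff_inf_def divide_inverse\<close>)
      from DERIV_imp_deriv[OF this] show ?thesis
        using infinity zD by (simp add: z log_d_def infinity_chart_def power2_eq_square)
    qed
    have "Pt 0 \<notin> V" using infinity by auto
    then obtain a where a: "x = aff_inf a"
    proof (cases x)
      case (Pt z)
      with x \<open>Pt 0 \<notin> V\<close> have "z \<noteq> 0" by auto
      then have "x = aff_inf (1 / z)" by (simp add: Pt aff_inf_def)
      with that show ?thesis by blast
    next
      case Infty
      then have "x = aff_inf 0" by (simp add: aff_inf_def)
      with that show ?thesis by blast
    qed
    have c: "aff_inf \<in> {aff_0, aff_inf}" "aff_inf a \<in> U" using x a by auto
    obtain p q where pq: "poly q a \<noteq> 0"
      "\<And>w. aff_inf w \<in> U \<Longrightarrow> poly q w \<noteq> 0 \<Longrightarrow> ((\<lambda>w. f (aff_inf w)) has_field_derivative poly p w / poly q w) (at w)"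
      by (rule regular_on_chart_deriv[OF f U c]) blast
    have "\<omega> (aff_inf w) $ 1 $ 1 * log_d D f (aff_inf w) = poly p w / poly q w"
      if "aff_inf w \<in> U \<inter> V" "poly q w \<noteq> 0" for w
      using that val DERIV_imp_deriv[OF pq(2)[of w]] by simp
    with a pq(1) show ?thesis by (intro bexI[of _ aff_inf]) auto
  qed
qed

text \<open>The frame depends on the point \<open>x\<close> of differentiation and not on the
  running point \<open>y\<close>, because a derivative at \<open>x\<close> needs coordinates that
  are regular in a whole neighbourhood of \<open>x\<close>.\<close>

definition split_coords :: "(p1 \<Rightarrow> complex^'n^'n) \<Rightarrow> ('n::finite \<Rightarrow> int) \<Rightarrow> p1 \<Rightarrow> (p1 \<Rightarrow> complex^'n) \<Rightarrow> 'n \<Rightarrow> p1 \<Rightarrow> complex" where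
  "split_coords F m x s j = (\<lambda>y. (matrix_inv (if x = Infty then F y ** twist m y else F y) *v s y) $ j)"

text \<open>The connection with matrix \<open>\<Theta>\<close> in the frame \<open>F\<close>; at \<open>Infty\<close>, \<open>\<Theta>\<close> is the value of the matrix in
  the frame \<open>F twist m\<close> regular there.\<close>

definition split_connection ::
    "complex set \<Rightarrow> (p1 \<Rightarrow> complex^'n^'n) \<Rightarrow> ('n::finite \<Rightarrow> int) \<Rightarrow> (p1 \<Rightarrow> complex^'n^'n) \<Rightarrow>
      p1 set \<Rightarrow> (p1 \<Rightarrow> complex^'n) \<Rightarrow> p1 \<Rightarrow> complex^'n" where
  "split_connection D F m \<Theta> U s x =
     F x *v ((\<chi> j. log_d D (split_coords F m x s j) x) + \<Theta> x *v (matrix_inv (F x) *v s x))"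

lemma log_d_zpow:
  assumes "z \<noteq> 0" "z \<notin> D"
  shows "log_d D (zpow k) (Pt z) = of_int k * z powi (k - 1)"
proof -
  have "((\<lambda>z. z powi k) has_field_derivative of_int k * z powi (k - 1) * 1) (at z)"
    by (rule DERIV_power_int[OF DERIV_ident]) (use assms in simp)
  from DERIV_imp_deriv[OF this] show ?thesis using assms by (simp add: log_d_def aff_0_def)
qed

context
  fixes E :: "('n::finite) vbundle" and m :: "'n \<Rightarrow> int" and F \<Theta> :: "p1 \<Rightarrow> complex^'n^'n" and D :: "complex set"
  assumes E: "vector_bundle E" and sp: "splitting E m F" and D: "finite D"
    and \<Theta>0: "\<And>V \<omega> i j. (V, \<omega>) \<in> log_forms D \<Longrightarrow> Infty \<notin> V \<Longrightarrow> regular_on V (\<lambda>x. \<omega> x $ 1 $ 1 * \<Theta> x $ i $ j)"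
    and \<Theta>1: "\<And>i j. regular_on (- (Pt ` insert 0 D)) (\<lambda>x. case x of Infty \<Rightarrow> \<Theta> Infty $ i $ j |
       Pt z \<Rightarrow> - (z ^ 2) * (z powi (m j - m i) * \<Theta> (Pt z) $ i $ j + (if i = j then of_int (m i) / z else 0)))"
begin

lemma split_coords_regular:
  assumes "is_section E U s"
  shows "regular_on (U \<inter> - {if x = Infty then Pt 0 else Infty}) (split_coords F m x s j)"
  using assms unfolding is_section_splitting[OF E sp] regular_vec_on_def split_coords_def by auto

lemma split_coords_nhd:
  assumes "zariski_open U" "x \<in> U"
  shows "zariski_open (U \<inter> - {if x = Infty then Pt 0 else Infty})" "x \<in> U \<inter> - {if x = Infty then Pt 0 else Infty}"
  using assms by (auto intro!: zariski_open_Int zariski_open_cofinite)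

lemma split_coords_self: "split_coords F m x s j x = (matrix_inv (F x) *v s x) $ j"
  by (simp add: split_coords_def)

text \<open>In the frame twisted by \<open>T = twist m\<close> the connection matrix becomes
  \<open>T^-1 \<Theta> T + T^-1 dT\<close>. Its entries are \<open>z powi (m j - m i)\<close> times
  those of \<Theta>, plus \<open>m i / z\<close> on the diagonal; the factor
  \<open>- (z ^ 2)\<close> expresses them in the generator \<open>dw\<close>. Hence the hypothesis
  \<open>\<Theta>1\<close>, while \<open>\<Theta>0\<close> takes care of the finite points.\<close>

lemma split_connection_regular:
  assumes U: "zariski_open U" and s: "is_section E U s"
  shows "is_section (tensor_line E (log_forms D)) U (split_connection D F m \<Theta> U s)"
proof (rule tensor_sectionI[OF D])
  note inv = splitting_invertible[OF sp]
  fix x assume x: "x \<in> U"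
  show "\<exists>V \<omega> W G. (V, \<omega>) \<in> log_forms D \<and> x \<in> V \<and> zariski_open W \<and> x \<in> W \<and> frame E W G \<and>
      regular_vec_on (U \<inter> W \<inter> V) (\<lambda>x. \<omega> x $ 1 $ 1 *s (matrix_inv (G x) *v split_connection D F m \<Theta> U s x))"
  proof (cases x)
    case (Pt z)
    obtain V \<omega> where V: "(V, \<omega>) \<in> log_forms D" "x \<in> V" "Infty \<notin> V"
    proof (cases "z \<in> D")
      case True
      show ?thesis by (rule that[OF log_forms_charts(2)[OF True]]) (auto simp: Pt)
    next
      case False
      then show ?thesis by (intro that[OF log_forms_charts(1)]) (auto simp: Pt)
    qed
    let ?y = "split_coords F m x s"
    let ?U = "U \<inter> - {Infty} \<inter> V"
    have y: "regular_on (U \<inter> - {Infty}) (?y j)" for j using split_coords_regular[OF s, of x] Pt by simp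
    have U': "zariski_open (U \<inter> - {Infty})" using U by (simp add: zariski_open_Int)
    have r: "regular_on ?U (\<lambda>x. \<omega> x $ 1 $ 1 * log_d D (?y j) x + (\<Sum>k\<in>UNIV. (\<omega> x $ 1 $ 1 * \<Theta> x $ j $ k) * ?y k x))" for j
    proof (rule regular_on_add[OF _ regular_on_sum[OF regular_on_mult]])
      show "regular_on ?U (\<lambda>x. \<omega> x $ 1 $ 1 * log_d D (?y j) x)" by (rule log_d_regular[OF y U' V(1)])
      show "regular_on ?U (\<lambda>x. \<omega> x $ 1 $ 1 * \<Theta> x $ j $ k)" for k
        by (rule regular_on_subset[OF \<Theta>0[OF V(1,3)]]) blast
      show "regular_on ?U (?y k)" for k by (rule regular_on_subset[OF y]) blast
    qed
    have cc: "(\<omega> y $ 1 $ 1 *s (matrix_inv (F y) *v split_connection D F m \<Theta> U s y)) $ j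
        = \<omega> y $ 1 $ 1 * log_d D (?y j) y + (\<Sum>k\<in>UNIV. (\<omega> y $ 1 $ 1 * \<Theta> y $ j $ k) * ?y k y)"
      if "y \<in> ?U" for y j
    proof -
      have c: "split_coords F m y s = ?y" using that Pt by (simp add: split_coords_def fun_eq_iff)
      have "(matrix_inv (F y) *v split_connection D F m \<Theta> U s y) $ j
        = log_d D (?y j) y + (\<Theta> y *v (matrix_inv (F y) *v s y)) $ j"
        by (simp add: split_connection_def matrix_inv_cancel_vec inv c)
      also have "(\<Theta> y *v (matrix_inv (F y) *v s y)) $ j = (\<Sum>k\<in>UNIV. \<Theta> y $ j $ k * ?y k y)"
        by (subst matrix_vector_mult_def) (simp add: split_coords_self[of y s, symmetric] c)
      finally show ?thesis by (simp add: distrib_left sum_distrib_left mult.assoc)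
    qed
    have "regular_vec_on ?U (\<lambda>x. \<omega> x $ 1 $ 1 *s (matrix_inv (F x) *v split_connection D F m \<Theta> U s x))"
      unfolding regular_vec_on_def
    proof (intro allI)
      fix j
      show "regular_on ?U (\<lambda>x. (\<omega> x $ 1 $ 1 *s (matrix_inv (F x) *v split_connection D F m \<Theta> U s x)) $ j)"
        using r[of j] by (subst regular_on_cong[OF cc])
    qed
    with V splitting_frame0[OF sp] Pt show ?thesis
      by (intro exI[of _ V] exI[of _ \<omega>] exI[of _ "- {Infty}"] exI[of _ F]) auto
  next
    case Infty
    define V where "V = - (Pt ` insert 0 D)"
    define \<omega> :: "p1 \<Rightarrow> complex^1^1" where "\<omega> x = mat (infinity_chart x)" for x
    have V: "(V, \<omega>) \<in> log_forms D" unfolding V_def \<omega>_def by (rule log_forms_charts)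
    have VI: "Infty \<in> V" and V0: "V \<subseteq> - {Pt 0}" by (auto simp: V_def)
    let ?u = "split_coords F m Infty s"
    let ?U = "U \<inter> - {Pt 0} \<inter> V"
    \<comment> \<open>The connection matrix in the twisted frame, with respect to
      \<open>dw\<close>.\<close>
    define T where "T i j x = (case x of Infty \<Rightarrow> \<Theta> Infty $ i $ j |
       Pt z \<Rightarrow> - (z ^ 2) * (z powi (m j - m i) * \<Theta> (Pt z) $ i $ j + (if i = j then of_int (m i) / z else 0)))" for i j x
    have u: "regular_on (U \<inter> - {Pt 0}) (?u j)" for j using split_coords_regular[OF s, of Infty] by simp
    have U': "zariski_open (U \<inter> - {Pt 0})" using U by (simp add: zariski_open_Int)
    have r: "regular_on ?U (\<lambda>x. \<omega> x $ 1 $ 1 * log_d D (?u j) x + (\<Sum>k\<in>UNIV. T j k x * ?u k x))" for j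
    proof (rule regular_on_add[OF _ regular_on_sum[OF regular_on_mult]])
      show "regular_on ?U (\<lambda>x. \<omega> x $ 1 $ 1 * log_d D (?u j) x)" by (rule log_d_regular[OF u U' V])
      have "regular_on V (T j k)" for k unfolding V_def T_def by (rule \<Theta>1)
      then show "regular_on ?U (T j k)" for k by (rule regular_on_subset) blast
      show "regular_on ?U (?u k)" for k by (rule regular_on_subset[OF u]) blast
    qed
    have cc: "(\<omega> y $ 1 $ 1 *s (matrix_inv (F y ** twist m y) *v split_connection D F m \<Theta> U s y)) $ j
        = \<omega> y $ 1 $ 1 * log_d D (?u j) y + (\<Sum>k\<in>UNIV. T j k y * ?u k y)"
      if y: "y \<in> ?U" for y j
    proof (cases y)
      case Infty
      have "(matrix_inv (F y) *v split_connection D F m \<Theta> U s y) $ j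
        = log_d D (?u j) y + (\<Theta> y *v (matrix_inv (F y) *v s y)) $ j"
        by (simp add: split_connection_def matrix_inv_cancel_vec inv Infty)
      also have "(\<Theta> y *v (matrix_inv (F y) *v s y)) $ j = (\<Sum>k\<in>UNIV. \<Theta> y $ j $ k * ?u k y)"
        by (subst matrix_vector_mult_def) (simp add: split_coords_self[of Infty s, symmetric] Infty)
      finally show ?thesis
        by (simp add: Infty T_def \<omega>_def infinity_chart_def)
    next
      case (Pt z)
      have z: "z \<noteq> 0" "z \<notin> D" using y by (auto simp: V_def Pt)
      let ?y = "split_coords F m y s"
      have c: "?y j \<eta> = zpow (m j) \<eta> * ?u j \<eta>" if "\<eta> \<in> - {Infty, Pt 0}" for \<eta> j
      proof -
        have "matrix_inv (F \<eta>) *v s \<eta> = twist m \<eta> *v (matrix_inv (F \<eta> ** twist m \<eta>) *v s \<eta>)"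
          using that inv
          by (simp add: matrix_inv_mult invertible_twist matrix_vector_mul_assoc[symmetric] matrix_inv_cancel_vec)
        then show ?thesis using Pt
          by (simp add: split_coords_def twist_zpow[of m] matrix_diagonal_mult_vec)
      qed
      have U2: "zariski_open (U \<inter> - {Infty, Pt 0})" "y \<in> U \<inter> - {Infty, Pt 0}"
        using U y by (auto intro!: zariski_open_Int zariski_open_cofinite simp: Pt)
      \<comment> \<open>The Leibniz rule for the factor \<open>zpow (m j)\<close> between the two
        systems of coordinates produces the term \<open>m j / z\<close>.\<close>
      have "log_d D (?y j) y = log_d D (\<lambda>\<eta>. zpow (m j) \<eta> * ?u j \<eta>) y"
        by (rule log_d_cong[OF U2]) (use c in auto)
      also have "\<dots> = zpow (m j) y * log_d D (?u j) y + log_d D (zpow (m j)) y * ?u j y"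
        by (rule log_d_mult[OF _ _ U2]) (use regular_on_subset[OF u] in \<open>auto intro!: regular_on_zpow\<close>)
      finally have ld: "log_d D (?y j) y = z powi m j * log_d D (?u j) y + of_int (m j) * z powi (m j - 1) * ?u j y"
        by (simp add: Pt log_d_zpow z)
      have e: "(matrix_inv (F y) *v s y) $ k = z powi m k * ?u k y" for k
        using c[of y k] U2(2) unfolding split_coords_self by (simp add: Pt)
      have "(matrix_inv (F y) *v split_connection D F m \<Theta> U s y) $ j
        = log_d D (?y j) y + (\<Theta> y *v (matrix_inv (F y) *v s y)) $ j"
        by (simp add: split_connection_def matrix_inv_cancel_vec inv)
      also have "(\<Theta> y *v (matrix_inv (F y) *v s y)) $ j = (\<Sum>k\<in>UNIV. \<Theta> y $ j $ k * (z powi m k * ?u k y))"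
        by (subst matrix_vector_mult_def) (simp add: e)
      finally have n: "(matrix_inv (F y) *v split_connection D F m \<Theta> U s y) $ j = log_d D (?y j) y
        + (\<Sum>k\<in>UNIV. \<Theta> y $ j $ k * (z powi m k * ?u k y))" .
      have "(matrix_inv (F y ** twist m y) *v split_connection D F m \<Theta> U s y) $ j
        = z powi (- m j) * (matrix_inv (F y) *v split_connection D F m \<Theta> U s y) $ j"
        using inv z
        by (simp add: matrix_inv_mult invertible_twist Pt matrix_inv_twist matrix_vector_mul_assoc[symmetric])
          (simp add: twist_zpow matrix_diagonal_mult_vec)
      also have "\<dots> = log_d D (?u j) y + of_int (m j) / z * ?u j y
          + (\<Sum>k\<in>UNIV. z powi (m k - m j) * \<Theta> y $ j $ k * ?u k y)"
      proof -
        have 1: "z powi (- m j) * (z powi m j * L) = L" for L using z by (simp add: power_int_minus)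
        have 2: "z powi (- m j) * (of_int (m j) * z powi (m j - 1) * a) = of_int (m j) / z * a" for a
          using z by (simp add: power_int_minus power_int_diff divide_inverse)
        have 3: "z powi (- m j) * (\<theta> * (z powi m k * a)) = z powi (m k - m j) * \<theta> * a" for k \<theta> a
          using z by (simp add: power_int_minus power_int_diff divide_inverse)
        show ?thesis
          unfolding n ld distrib_left sum_distrib_left by (simp only: 1 2 3)
      qed
      finally have k: "(matrix_inv (F y ** twist m y) *v split_connection D F m \<Theta> U s y) $ j
        = log_d D (?u j) y + of_int (m j) / z * ?u j y
          + (\<Sum>k\<in>UNIV. z powi (m k - m j) * \<Theta> y $ j $ k * ?u k y)" .
      have "(\<Sum>k\<in>UNIV. T j k y * ?u k y) = (\<Sum>k\<in>UNIV. - (z ^ 2) * (z powi (m k - m j) * \<Theta> y $ j $ k * ?u k y)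
          + (if j = k then - (z ^ 2) * (of_int (m j) / z * ?u j y) else 0))"
        by (rule sum.cong) (auto simp: T_def Pt algebra_simps)
      also have "\<dots> = - (z ^ 2) * (\<Sum>k\<in>UNIV. z powi (m k - m j) * \<Theta> y $ j $ k * ?u k y)
          + - (z ^ 2) * (of_int (m j) / z * ?u j y)"
        by (simp only: sum.distrib sum_distrib_left) simp
      finally have "(\<Sum>k\<in>UNIV. T j k y * ?u k y) = - (z ^ 2) * (\<Sum>k\<in>UNIV. z powi (m k - m j) * \<Theta> y $ j $ k * ?u k y)
          + - (z ^ 2) * (of_int (m j) / z * ?u j y)" .
      moreover have "\<omega> y $ 1 $ 1 = - (z ^ 2)" by (simp add: \<omega>_def infinity_chart_def Pt)
      ultimately show ?thesis unfolding vector_smult_component k by (simp only: distrib_left ac_simps)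
    qed
    have "regular_vec_on ?U (\<lambda>x. \<omega> x $ 1 $ 1 *s (matrix_inv (F x ** twist m x) *v split_connection D F m \<Theta> U s x))"
      unfolding regular_vec_on_def
    proof (intro allI)
      fix j
      show "regular_on ?U (\<lambda>x. (\<omega> x $ 1 $ 1 *s (matrix_inv (F x ** twist m x) *v split_connection D F m \<Theta> U s x)) $ j)"
        using r[of j] by (subst regular_on_cong[OF cc])
    qed
    with V VI splitting_frame1[OF sp] Infty show ?thesis
      by (intro exI[of _ V] exI[of _ \<omega>] exI[of _ "- {Pt 0}"] exI[of _ "\<lambda>x. F x ** twist m x"]) auto
  qed
qed

lemma log_connection_split_connection: "log_connection D E (split_connection D F m \<Theta>)"
proof -
  note inv = splitting_invertible[OF sp]
  have restrict: "split_connection D F m \<Theta> V s' x = split_connection D F m \<Theta> U s x"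
    if V: "zariski_open V" "x \<in> V" and eq: "\<forall>x\<in>V. s' x = s x" for U V s s' x
  proof -
    have "log_d D (split_coords F m x s' j) x = log_d D (split_coords F m x s j) x" for j
      by (rule log_d_cong[OF V]) (use eq in \<open>simp add: split_coords_def\<close>)
    with V(2) eq show ?thesis by (simp add: split_connection_def)
  qed
  have add: "split_connection D F m \<Theta> U (\<lambda>y. s y + s' y) x = split_connection D F m \<Theta> U s x + split_connection D F m \<Theta> U s' x"
    if U: "zariski_open U" "x \<in> U" and s: "is_section E U s" "is_section E U s'" for U s s' x
  proof -
    have "split_coords F m x (\<lambda>y. s y + s' y) j = (\<lambda>y. split_coords F m x s j y + split_coords F m x s' j y)" for j
      by (simp add: split_coords_def fun_eq_iff matrix_vector_right_distrib)
    then have "log_d D (split_coords F m x (\<lambda>y. s y + s' y) j) x =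
        log_d D (split_coords F m x s j) x + log_d D (split_coords F m x s' j) x" for j
      using log_d_add[OF split_coords_regular[OF s(1)] split_coords_regular[OF s(2)] split_coords_nhd[OF U]] by simp
    then have "(\<chi> j. log_d D (split_coords F m x (\<lambda>y. s y + s' y) j) x) =
        (\<chi> j. log_d D (split_coords F m x s j) x) + (\<chi> j. log_d D (split_coords F m x s' j) x)"
      by (simp add: vec_eq_iff)
    then show ?thesis by (simp add: split_connection_def matrix_vector_right_distrib)
  qed
  have leibniz: "split_connection D F m \<Theta> U (\<lambda>y. f y *s s y) x = f x *s split_connection D F m \<Theta> U s x + log_d D f x *s s x"
    if U: "zariski_open U" "x \<in> U" and f: "regular_on U f" and s: "is_section E U s" for U f s x
  proof -
    have "split_coords F m x (\<lambda>y. f y *s s y) j = (\<lambda>y. f y * split_coords F m x s j y)" for j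
      by (simp add: split_coords_def fun_eq_iff vector_scalar_commute)
    moreover have "regular_on (U \<inter> - {if x = Infty then Pt 0 else Infty}) f" by (rule regular_on_subset[OF f]) blast
    ultimately have "log_d D (split_coords F m x (\<lambda>y. f y *s s y) j) x =
        f x * log_d D (split_coords F m x s j) x + log_d D f x * (matrix_inv (F x) *v s x) $ j" for j
      using log_d_mult[OF _ split_coords_regular[OF s] split_coords_nhd[OF U]] by (simp add: split_coords_self)
    then have "(\<chi> j. log_d D (split_coords F m x (\<lambda>y. f y *s s y) j) x) =
        f x *s (\<chi> j. log_d D (split_coords F m x s j) x) + log_d D f x *s (matrix_inv (F x) *v s x)"
      by (simp add: vec_eq_iff)
    then show ?thesis
      by (simp add: split_connection_def matrix_vector_right_distrib vector_scalar_commute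
          matrix_inv_cancel_vec inv vector_add_ldistrib)
  qed
  show ?thesis
    unfolding log_connection_def
  proof (intro conjI allI impI ballI; (elim conjE)?)
    show "is_section (tensor_line E (log_forms D)) U (split_connection D F m \<Theta> U s)"
      if "zariski_open U" "is_section E U s" for U s using split_connection_regular that by blast
  qed (rule restrict add leibniz; assumption)+
qed

text \<open>At a node \<open>log_d\<close> vanishes, so only the matrix \<Theta>
  contributes.\<close>

lemma split_connection_residue:
  assumes "d \<in> D"
  shows "has_conn_residue E (split_connection D F m \<Theta>) (Pt d) (F (Pt d) ** \<Theta> (Pt d) ** matrix_inv (F (Pt d)))"
  unfolding has_conn_residue_def
  using assms by (simp add: split_connection_def log_d_def matrix_vector_mul_assoc matrix_mul_assoc zero_vec_def[symmetric])

end

text \<open>Failure of interpolation provides three finite indices whose rows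
  \<open>(1, t i, u i)\<close> are independent. The solution is supported on them, and so it
  vanishes at infinite coordinates.\<close>

lemma solve_moment_system:
  assumes t: "inj t" and ni: "\<not> interpolable t u"
  obtains n where "\<And>i. u i = Infty \<Longrightarrow> n i = 0" "(\<Sum>i\<in>UNIV. n i) = 0" "(\<Sum>i\<in>UNIV. t i * n i) = 0"
    "(\<Sum>i\<in>UNIV. (case u i of Pt c \<Rightarrow> c | Infty \<Rightarrow> 0) * n i) = (s::complex)"
proof -
  define c where "c i = (case u i of Pt c \<Rightarrow> c | Infty \<Rightarrow> 0)" for i
  have uc: "u i = Pt (c i)" if "u i \<noteq> Infty" for i using that by (cases "u i") (auto simp: c_def)
  have "\<exists>i j. i \<noteq> j \<and> u i \<noteq> Infty \<and> u j \<noteq> Infty"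
  proof (rule ccontr)
    assume no: "\<not> ?thesis"
    have "interpolable t u"
    proof (cases "\<exists>i. u i \<noteq> Infty")
      case True
      then obtain i where i: "u i \<noteq> Infty" by blast
      have "d = c i + 0 * t j" if "u j = Pt d" for j d
      proof -
        have "j = i" using no i that by (metis p1.distinct(1))
        with that show ?thesis by (simp add: c_def)
      qed
      then show ?thesis unfolding interpolable_def by blast
    qed (auto simp: interpolable_def)
    with ni show False by blast
  qed
  then obtain i j where ij: "i \<noteq> j" "u i \<noteq> Infty" "u j \<noteq> Infty" by blast
  have tij: "t j - t i \<noteq> 0" using ij t by (auto simp: inj_def)
  define \<gamma> where "\<gamma> = (c j - c i) / (t j - t i)"
  have \<gamma>: "\<gamma> * (t j - t i) = c j - c i" using tij by (simp add: \<gamma>_def)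
  \<comment> \<open>A point off the line through the points with indices \<open>i\<close> and
    \<open>j\<close>.\<close>
  have "\<exists>k. u k \<noteq> Infty \<and> c k \<noteq> c i + \<gamma> * (t k - t i)"
  proof (rule ccontr)
    assume no: "\<not> ?thesis"
    have "d = (c i - \<gamma> * t i) + \<gamma> * t k" if "u k = Pt d" for k d
    proof -
      have "c k = c i + \<gamma> * (t k - t i)" using no that by (metis p1.distinct(1))
      moreover have "c k = d" using that by (simp add: c_def)
      ultimately show ?thesis by (simp add: algebra_simps)
    qed
    with ni show False unfolding interpolable_def by blast
  qed
  then obtain k where k: "u k \<noteq> Infty" "c k \<noteq> c i + \<gamma> * (t k - t i)" by blast
  have ki: "k \<noteq> i" using k by auto
  have kj: "k \<noteq> j" using k \<gamma> by auto
  define \<delta> where "\<delta> = c k - (c i + \<gamma> * (t k - t i))"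
  have \<delta>: "\<delta> \<noteq> 0" using k by (simp add: \<delta>_def)
  define nk where "nk = s / \<delta>"
  define r where "r = (t k - t i) / (t j - t i)"
  have r: "r * (t j - t i) = t k - t i" using tij by (simp add: r_def)
  \<comment> \<open>With \<open>r\<close> the affine coordinate of \<open>t k\<close> relative to
    \<open>t i\<close> and \<open>t j\<close>, these weights cancel the first two moments for any
    \<open>nk\<close>. The third moment is then \<open>nk * \<delta>\<close>, where \<delta> is the
    height of point \<open>k\<close> above the line through the other two.\<close>
  define n where "n l = (if l = k then nk else if l = j then - nk * r else if l = i then - nk + nk * r else 0)" for l
  have sum: "(\<Sum>l\<in>UNIV. f l * n l) = f k * nk + f j * (- nk * r) + f i * (- nk + nk * r)" for f
  proof -
    have "(\<Sum>l\<in>UNIV. f l * n l) = (\<Sum>l\<in>{k, j, i}. f l * n l)"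
      by (rule sum.mono_neutral_right) (auto simp: n_def)
    also have "\<dots> = f k * n k + (f j * n j + f i * n i)" using ki kj ij by simp
    finally show ?thesis using ki kj ij by (simp add: n_def)
  qed
  show ?thesis
  proof (rule that[of n])
    show "n l = 0" if "u l = Infty" for l using that k ij by (auto simp: n_def)
    show "(\<Sum>i\<in>UNIV. n i) = 0" using sum[of "\<lambda>_. 1"] by simp
    have "(\<Sum>i\<in>UNIV. t i * n i) = nk * ((t k - t i) - r * (t j - t i))"
      unfolding sum by (simp add: algebra_simps)
    then show "(\<Sum>i\<in>UNIV. t i * n i) = 0" by (simp add: r)
    have "(\<Sum>i\<in>UNIV. c i * n i) = nk * (c k - c i - r * (c j - c i))"
      unfolding sum by (simp add: algebra_simps)
    also have "r * (c j - c i) = \<gamma> * (t k - t i)"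
      unfolding \<gamma>[symmetric] r[symmetric] by (simp add: algebra_simps)
    also have "nk * (c k - c i - \<gamma> * (t k - t i)) = nk * \<delta>" by (simp add: \<delta>_def algebra_simps)
    also have "\<dots> = s" using \<delta> by (simp add: nk_def)
    finally show "(\<Sum>i\<in>UNIV. (case u i of Pt c \<Rightarrow> c | Infty \<Rightarrow> 0) * n i) = s" by (simp add: c_def)
  qed
qed

text \<open>The form \<open>dz / (z - a)\<close> in the chosen bases of the fibres, so that its
  values at nodes are residues. It has a pole at infinity, and its value at \<open>Infty\<close> is
  a placeholder.\<close>

definition pole_form :: "complex set \<Rightarrow> complex \<Rightarrow> p1 \<Rightarrow> complex" where
  "pole_form D a x = (case x of Pt z \<Rightarrow> (if z = a then 1 else if z \<in> D then 0 else 1 / (z - a)) | Infty \<Rightarrow> 0)"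

lemma pole_form_regular:
  fixes \<omega> :: "p1 \<Rightarrow> complex^1^1"
  assumes V: "(V, \<omega>) \<in> log_forms D" "Infty \<notin> V" and a: "a \<in> D"
  shows "regular_on V (\<lambda>x. \<omega> x $ 1 $ 1 * pole_form D a x)"
  using V(1)
proof (cases rule: log_forms_cases)
  case affine
  have "regular_on V (\<lambda>x. 1 / (coord_0 x - a))"
    using affine a
    by (intro regular_on_divide regular_on_diff regular_on_coord_0 regular_on_const) (auto simp: coord_0_def split: p1.splits)
  also have "?this \<longleftrightarrow> ?thesis"
  proof (rule regular_on_cong)
    fix x assume "x \<in> V"
    then show "1 / (coord_0 x - a) = \<omega> x $ 1 $ 1 * pole_form D a x"
      using affine a by (cases x) (auto simp: pole_form_def)
  qed
  finally show ?thesis .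
next
  case (node b)
  show ?thesis
  proof (cases "a = b")
    case True
    have "regular_on V (\<lambda>x. 1 :: complex)" by simp
    also have "?this \<longleftrightarrow> ?thesis"
    proof (rule regular_on_cong)
      fix x assume "x \<in> V"
      then show "1 = \<omega> x $ 1 $ 1 * pole_form D a x"
        using node True by (cases x) (auto simp: pole_form_def residue_chart_def)
    qed
    finally show ?thesis .
  next
    case False
    have "regular_on V (\<lambda>x. (coord_0 x - b) / (coord_0 x - a))"
      using node a False
      by (intro regular_on_divide regular_on_diff regular_on_coord_0 regular_on_const) (auto simp: coord_0_def split: p1.splits)
    also have "?this \<longleftrightarrow> ?thesis"
    proof (rule regular_on_cong)
      fix x assume "x \<in> V"
      then show "(coord_0 x - b) / (coord_0 x - a) = \<omega> x $ 1 $ 1 * pole_form D a x"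
        using node a False by (cases x) (auto simp: pole_form_def residue_chart_def)
    qed
    finally show ?thesis .
  qed
next
  case infinity
  with V(2) have False by auto
  then show ?thesis ..
qed

text \<open>One step of the geometric series in \<open>1/z\<close>. It splits off the leading term,
  so each vanishing moment gains one order of decay at infinity.\<close>

lemma sum_geometric_expansion:
  assumes "z \<noteq> 0" "\<And>i. z \<noteq> t i"
  shows "(\<Sum>i\<in>UNIV. A i / (1 - t i * inverse z)) =
    (\<Sum>i\<in>UNIV. A i) + inverse z * (\<Sum>i\<in>UNIV. t i * A i / (1 - t i * inverse (z::complex)))"
proof -
  have "A i / (1 - t i * inverse z) = A i + inverse z * (t i * A i / (1 - t i * inverse z))" for i
  proof -
    let ?w = "1 - t i * inverse z"
    have w: "?w \<noteq> 0" using assms by (auto simp: field_simps)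
    have "A i / ?w = (A i * ?w + inverse z * (t i * A i)) / ?w" by (simp add: algebra_simps)
    then show ?thesis using w by (simp add: add_divide_distrib)
  qed
  then have "(\<Sum>i\<in>UNIV. A i / (1 - t i * inverse z)) = (\<Sum>i\<in>UNIV. A i + inverse z * (t i * A i / (1 - t i * inverse z)))"
    by (rule sum.cong[OF refl])
  then show ?thesis by (simp only: sum.distrib sum_distrib_left)
qed

text \<open>The connection is \<open>d + \<Sum>\<^sub>i R\<^sub>i dz/(z - t\<^sub>i)\<close> in the frame \<open>e, f\<close>.  The residue \<open>R\<^sub>i\<close> is determined by
  \<open>P\<^sub>i\<close> and the eigenvalues up to a parameter \<open>n\<^sub>i\<close> (irrelevant if \<open>u\<^sub>i = \<infinity>\<close>), and regularity at \<open>Infty\<close>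
  prescribes the three moments \<open>\<Sum> n\<^sub>i\<close>, \<open>\<Sum> t\<^sub>i n\<^sub>i\<close> and \<open>\<Sum> u\<^sub>i n\<^sub>i\<close>.\<close>

lemma generic_imp_connection:
  assumes E: "vector_bundle E" and t: "inj t" and res: "residues_N11 rp rm"
    and gen: "generic_coordinates t E P F u"
  shows "admits_connection t E P rp rm"
proof -
  have sp: "splitting E B_twists F" and P: "\<And>i. P i = vec.span {F (Pt (t i)) *v line_vec (u i)}"
    and ni: "\<not> interpolable t u" using gen unfolding generic_coordinates_def by auto
  note inv = splitting_invertible[OF sp]
  define D where "D = range t"
  have D: "finite D" and tD: "t i \<in> D" for i by (simp_all add: D_def)
  \<comment> \<open>The third moment that makes the upper left entries of the residues add up to
    0.\<close>
  define s where "s = (\<Sum>i\<in>UNIV. case u i of Pt c \<Rightarrow> rm i | Infty \<Rightarrow> rp i)"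
  obtain n where n0: "\<And>i. u i = Infty \<Longrightarrow> n i = 0" and n: "(\<Sum>i\<in>UNIV. n i) = 0" "(\<Sum>i\<in>UNIV. t i * n i) = 0"
    "(\<Sum>i\<in>UNIV. (case u i of Pt c \<Rightarrow> c | Infty \<Rightarrow> 0) * n i) = s"
    by (rule solve_moment_system[OF t ni, of s]) blast
  \<comment> \<open>For finite \<open>c\<close> this is the general matrix with eigenvector
    \<open>(1, c)\<close> of eigenvalue \<open>rm i\<close> and trace \<open>rp i + rm i\<close>;
    its free parameter is the upper right entry \<open>n i\<close>. For an infinite coordinate the
    lower left entry would be free and is set to 0.\<close>
  define R :: "4 \<Rightarrow> complex^2^2" where "R i = (case u i of
      Pt c \<Rightarrow> vector [vector [rm i - c * n i, n i], vector [c * (rm i - rp i) - c * c * n i, rp i + c * n i]]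
    | Infty \<Rightarrow> vector [vector [rp i, 0], vector [0, rm i]])" for i
  have R11: "(\<Sum>i\<in>UNIV. R i $ 1 $ 1) = 0"
  proof -
    have "R i $ 1 $ 1 = (case u i of Pt c \<Rightarrow> rm i | Infty \<Rightarrow> rp i) - (case u i of Pt c \<Rightarrow> c | Infty \<Rightarrow> 0) * n i" for i
      by (auto simp: R_def split: p1.splits)
    then show ?thesis using n(3) by (simp add: sum_subtractf s_def)
  qed
  have R12': "R i $ 1 $ 2 = n i" for i using n0[of i] by (auto simp: R_def split: p1.splits)
  have R12: "(\<Sum>i\<in>UNIV. R i $ 1 $ 2) = 0" "(\<Sum>i\<in>UNIV. t i * R i $ 1 $ 2) = 0" using n by (simp_all add: R12')
  \<comment> \<open>The Fuchs relation enters through the traces. The value -1 cancels the term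
    \<open>1 / z\<close> contributed by the twist of \<open>O(1)\<close>.\<close>
  have R22: "(\<Sum>i\<in>UNIV. R i $ 2 $ 2) = - 1"
  proof -
    have "R i $ 2 $ 2 = rp i + rm i - R i $ 1 $ 1" for i
      by (auto simp: R_def split: p1.splits)
    then have "(\<Sum>i\<in>UNIV. R i $ 2 $ 2) = (\<Sum>i\<in>UNIV. rp i + rm i)" using R11 by (simp add: sum_subtractf)
    then show ?thesis using res unfolding residues_N11_def by (simp add: eq_neg_iff_add_eq_0)
  qed
  \<comment> \<open>The values at \<open>w = 0\<close> of the regular expressions \<open>S'\<close>
    below.\<close>
  define \<Theta>I :: "complex^2^2" where "\<Theta>I =
    vector [vector [- (\<Sum>i\<in>UNIV. t i * R i $ 1 $ 1), - (\<Sum>i\<in>UNIV. t i * (t i * R i $ 1 $ 2))],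
            vector [- (\<Sum>i\<in>UNIV. R i $ 2 $ 1), - (\<Sum>i\<in>UNIV. t i * R i $ 2 $ 2)]]"
  define \<Theta> :: "p1 \<Rightarrow> complex^2^2" where "\<Theta> x = (case x of Pt z \<Rightarrow> (\<chi> a b. \<Sum>i\<in>UNIV. pole_form D (t i) x * R i $ a $ b)
     | Infty \<Rightarrow> \<Theta>I)" for x
  have \<Theta>0: "regular_on V (\<lambda>x. \<omega> x $ 1 $ 1 * \<Theta> x $ a $ b)"
    if V: "(V, \<omega>) \<in> log_forms D" "Infty \<notin> V" for V \<omega> a b
  proof -
    have "regular_on V (\<lambda>x. \<Sum>i\<in>UNIV. (\<omega> x $ 1 $ 1 * pole_form D (t i) x) * R i $ a $ b)"
      by (intro regular_on_sum regular_on_mult[OF _ regular_on_const] pole_form_regular V) (simp add: D_def)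
    also have "?this \<longleftrightarrow> ?thesis"
    proof (rule regular_on_cong)
      fix x assume "x \<in> V"
      then show "(\<Sum>i\<in>UNIV. (\<omega> x $ 1 $ 1 * pole_form D (t i) x) * R i $ a $ b) = \<omega> x $ 1 $ 1 * \<Theta> x $ a $ b"
        using V(2) by (cases x) (auto simp: \<Theta>_def sum_distrib_left mult.assoc)
    qed
    finally show ?thesis .
  qed
  define W where "W = - (Pt ` insert 0 D)"
  define S where "S A x = - (\<Sum>i\<in>UNIV. A i / (1 - t i * coord_inf x))" for A x
  have S: "regular_on W (S A)" for A
    unfolding S_def
  proof (intro regular_on_minus regular_on_sum regular_on_divide regular_on_diff regular_on_mult regular_on_coord_inf regular_on_const)
    show "Pt 0 \<notin> W" by (simp add: W_def)
    show "1 - t i * coord_inf x \<noteq> 0" if "x \<in> W" for i x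
      using that by (cases x) (auto simp: W_def D_def field_simps)
  qed
  \<comment> \<open>The power of \<open>t i\<close> in an entry counts the orders in
    \<open>1/z\<close> gained from vanishing moments: one on the diagonal, two in the upper right,
    none in the lower left.\<close>
  define S' where "S' a b = (if a = 1 then if b = 1 then S (\<lambda>i. t i * R i $ 1 $ 1) else S (\<lambda>i. t i * (t i * R i $ 1 $ 2))
     else if b = (1::2) then S (\<lambda>i. R i $ 2 $ 1) else S (\<lambda>i. t i * R i $ 2 $ 2))" for a b :: 2
  have \<Theta>1: "regular_on (- (Pt ` insert 0 D)) (\<lambda>x. case x of Infty \<Rightarrow> \<Theta> Infty $ a $ b |
       Pt z \<Rightarrow> - (z ^ 2) * (z powi (B_twists b - B_twists a) * \<Theta> (Pt z) $ a $ b + (if a = b then of_int (B_twists a) / z else 0)))" for a b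
  proof -
    have "regular_on W (S' a b)" using S by (auto simp: S'_def)
    also have "?this \<longleftrightarrow> ?thesis"
      unfolding W_def[symmetric]
    proof (rule regular_on_cong)
      fix x assume x: "x \<in> W"
      show "S' a b x = (case x of Infty \<Rightarrow> \<Theta> Infty $ a $ b |
       Pt z \<Rightarrow> - (z ^ 2) * (z powi (B_twists b - B_twists a) * \<Theta> (Pt z) $ a $ b + (if a = b then of_int (B_twists a) / z else 0)))"
      proof (cases x)
        case Infty
        then show ?thesis using exhaust_2[of a] exhaust_2[of b] by (auto simp: S'_def S_def \<Theta>_def \<Theta>I_def)
      next
        case (Pt z)
        have z: "z \<noteq> 0" "\<And>i. z \<noteq> t i" "z \<notin> D" using x by (auto simp: W_def D_def Pt)
        have \<Theta>z: "\<Theta> (Pt z) $ a $ b = - inverse z * S (\<lambda>i. R i $ a $ b) x" for a b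
        proof -
          have "pole_form D (t i) (Pt z) = inverse z * (1 / (1 - t i * inverse z))" for i
          proof -
            have "z * (1 - t i * inverse z) = z - t i" using z by (simp add: right_diff_distrib)
            then have "inverse z * (1 / (1 - t i * inverse z)) = 1 / (z - t i)" by (metis inverse_eq_divide inverse_mult_distrib)
            then show ?thesis using z by (simp add: pole_form_def)
          qed
          then have "\<Theta> (Pt z) $ a $ b = inverse z * (\<Sum>i\<in>UNIV. R i $ a $ b / (1 - t i * inverse z))"
            by (simp add: \<Theta>_def sum_distrib_left)
          then show ?thesis by (simp add: S_def Pt)
        qed
        have exp: "S A x = - (\<Sum>i\<in>UNIV. A i) + inverse z * S (\<lambda>i. t i * A i) x" for A
          using sum_geometric_expansion[OF z(1,2), of A] by (simp add: S_def Pt)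
        have zi: "z * (inverse z * y) = y" for y using z(1) by simp
        consider "a = 1" "b = 1" | "a = 1" "b = 2" | "a = 2" "b = 1" | "a = 2" "b = 2"
          using exhaust_2 by metis
        then show ?thesis
        proof cases
          case 1
          then show ?thesis using exp[of "\<lambda>i. R i $ 1 $ 1"] z R11
            by (simp add: zi Pt S'_def \<Theta>z power2_eq_square)
        next
          case 2
          then show ?thesis using exp[of "\<lambda>i. R i $ 1 $ 2"] exp[of "\<lambda>i. t i * R i $ 1 $ 2"] z R12
            by (simp add: zi Pt S'_def \<Theta>z power2_eq_square)
        next
          case 3
          then show ?thesis using z
            by (simp add: zi Pt S'_def \<Theta>z power2_eq_square power_int_minus)
        next
          case 4
          then show ?thesis using exp[of "\<lambda>i. R i $ 2 $ 2"] z R22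
            by (simp add: zi Pt S'_def \<Theta>z power2_eq_square distrib_left divide_inverse algebra_simps)
        qed
      qed
    qed
    finally show ?thesis .
  qed
  let ?nab = "split_connection D F B_twists \<Theta>"
  show ?thesis
    unfolding admits_connection_def D_def[symmetric]
  proof (intro exI[of _ ?nab] conjI allI)
    show "log_connection D E ?nab" by (rule log_connection_split_connection[OF E sp D \<Theta>0 \<Theta>1])
    fix i
    let ?F = "F (Pt (t i))" and ?b = "line_vec (u i)"
    have \<Theta>i: "\<Theta> (Pt (t i)) = R i"
    proof -
      have "pole_form D (t j) (Pt (t i)) * R j $ a $ b = (if j = i then R i $ a $ b else 0)" for j a b
        using t by (auto simp: pole_form_def D_def inj_def)
      then show ?thesis by (simp add: \<Theta>_def vec_eq_iff)
    qed
    have "has_conn_residue E ?nab (Pt (t i)) (?F ** \<Theta> (Pt (t i)) ** matrix_inv ?F)"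
      by (rule split_connection_residue[OF E sp D \<Theta>0 \<Theta>1 tD])
    then have residue: "has_conn_residue E ?nab (Pt (t i)) (?F ** R i ** matrix_inv ?F)" by (simp add: \<Theta>i)
    have Rb: "R i *v ?b = rm i *s ?b"
      by (cases "u i") (simp_all add: R_def vec_eq_iff forall_2 matrix_vector_mult_def sum_2 algebra_simps)
    have Rq: "\<exists>k. R i *v w - rp i *s w = k *s ?b" for w
    proof (cases "u i")
      case (Pt c)
      show ?thesis
        by (rule exI[of _ "(rm i - rp i - c * n i) * w $ 1 + n i * w $ 2"])
          (simp add: R_def Pt vec_eq_iff forall_2 matrix_vector_mult_def sum_2 algebra_simps)
    next
      case Infty
      show ?thesis
        by (rule exI[of _ "(rm i - rp i) * w $ 2"])
          (simp add: R_def Infty vec_eq_iff forall_2 matrix_vector_mult_def sum_2 algebra_simps)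
    qed
    have eig: "(?F ** R i ** matrix_inv ?F) *v v = rm i *s v" if v: "v \<in> P i" for v
    proof -
      obtain k where k: "v = k *s (?F *v ?b)" using v unfolding P span_singleton_eq by blast
      then show ?thesis
        by (simp add: matrix_vector_mul_assoc[symmetric] vector_scalar_commute matrix_inv_cancel_vec inv Rb mult.commute)
    qed
    have quot: "(?F ** R i ** matrix_inv ?F) *v v - rp i *s v \<in> P i" for v
    proof -
      obtain k where k: "R i *v (matrix_inv ?F *v v) - rp i *s (matrix_inv ?F *v v) = k *s ?b" using Rq by blast
      have "(?F ** R i ** matrix_inv ?F) *v v - rp i *s v = ?F *v (R i *v (matrix_inv ?F *v v) - rp i *s (matrix_inv ?F *v v))"
        by (simp add: matrix_vector_mul_assoc[symmetric] matrix_vector_mult_diff_distrib vector_scalar_commute matrix_inv_cancel_vec inv)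
      also have "\<dots> = k *s (?F *v ?b)" unfolding k by (simp add: vector_scalar_commute)
      finally show ?thesis unfolding P span_singleton_eq by blast
    qed
    have "induces_on_flag (?F ** R i ** matrix_inv ?F) (P i) (rm i) (rp i)"
      unfolding induces_on_flag_def
    proof (intro conjI ballI allI)
      show "(?F ** R i ** matrix_inv ?F) *v v \<in> P i" if "v \<in> P i" for v
        unfolding eig[OF that] using that unfolding P by (rule vec.span_scale)
    qed (rule eig quot; assumption?)+
    with residue show "\<exists>R. has_conn_residue E ?nab (Pt (t i)) R \<and> induces_on_flag R (P i) (rm i) (rp i)" by blast
  qed
qed

section \<open>The residue theorem and connections on decomposable bundles\<close>

lemma nodal_total_poly:
  fixes t :: "4 \<Rightarrow> complex"
  defines "\<Phi> \<equiv> (\<Prod>i\<in>UNIV. [:- t i, 1:])"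
  shows "degree \<Phi> = 4" "coeff \<Phi> 4 = 1" "poly \<Phi> z = (\<Prod>i\<in>UNIV. z - t i)" "\<Phi> \<noteq> 0"
proof -
  have "degree \<Phi> = (\<Sum>j\<in>UNIV. degree [:- t j, 1:])"
    unfolding \<Phi>_def by (rule degree_prod_sum_eq) simp
  then show d: "degree \<Phi> = 4" by simp
  have "lead_coeff \<Phi> = 1" unfolding \<Phi>_def by (simp add: lead_coeff_prod)
  with d show "coeff \<Phi> 4 = 1" by simp
  then show "\<Phi> \<noteq> 0" by auto
  show "poly \<Phi> z = (\<Prod>i\<in>UNIV. z - t i)" by (simp add: \<Phi>_def poly_prod)
qed

text \<open>The residue theorem for the form \<open>\<alpha> = G dz / \<Prod>(z - t\<^sub>i)\<close>: vanishing of \<open>z \<alpha> + k\<close> at \<open>Infty\<close> gives the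
  coefficient of \<open>z\<^sup>3\<close> in \<open>G\<close>, which by Lagrange interpolation is the sum of the residues.\<close>

lemma residue_sum:
  fixes t :: "4 \<Rightarrow> complex" and \<alpha> \<alpha>' :: "p1 \<Rightarrow> complex"
  assumes t: "inj t"
    and aff: "\<And>V \<omega>. (V, \<omega>) \<in> log_forms (range t) \<Longrightarrow> Infty \<notin> V \<Longrightarrow> regular_on V (\<lambda>x. \<omega> x $ 1 $ 1 * \<alpha> x)"
    and inf: "regular_on (- (Pt ` insert 0 (range t))) (\<lambda>x. infinity_chart x * \<alpha>' x)"
    and eq: "\<And>z. z \<noteq> 0 \<Longrightarrow> z \<notin> range t \<Longrightarrow> \<alpha>' (Pt z) = \<alpha> (Pt z) + of_int k / z"
  shows "(\<Sum>i\<in>UNIV. \<alpha> (Pt (t i))) = - of_int k"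
proof -
  \<comment> \<open>Multiplying by all residue charts clears the poles. Since
    \<open>residue_chart (t i)\<close> is 1 at its own node, \<open>g\<close> is regular there too
    and carries the residue in its value.\<close>
  define g where "g x = (\<Prod>i\<in>UNIV. residue_chart (t i) x) * \<alpha> x" for x
  have chart: "residue_chart (t i) x = coord_0 x - t i" if "x \<noteq> Infty" "x \<noteq> Pt (t i)" for i x
    using that by (cases x) (auto simp: residue_chart_def)
  have "regular_on (- {Infty}) g"
  proof (rule regular_on_local)
    fix x assume x: "x \<in> - {Infty}"
    show "\<exists>V. zariski_open V \<and> x \<in> V \<and> regular_on (- {Infty} \<inter> V) g"
    proof (cases "x \<in> range (\<lambda>i. Pt (t i))")
      case True
      then obtain k where k: "x = Pt (t k)" by blast
      define V where "V = - insert Infty (Pt ` (range t - {t k}))"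
      have V: "(V, \<lambda>x. mat (residue_chart (t k) x)) \<in> log_forms (range t)"
        unfolding V_def by (rule log_forms_charts) simp
      have VI: "Infty \<notin> V" by (simp add: V_def)
      have r: "regular_on V (\<lambda>x. residue_chart (t k) x * \<alpha> x)" using aff[OF V VI] by simp
      have "regular_on V (\<lambda>x. (\<Prod>i\<in>UNIV - {k}. coord_0 x - t i) * (residue_chart (t k) x * \<alpha> x))"
        using VI by (intro regular_on_mult[OF regular_on_prod r] regular_on_diff regular_on_coord_0 regular_on_const)
      also have "?this \<longleftrightarrow> regular_on V g"
      proof (rule regular_on_cong)
        fix y assume y: "y \<in> V"
        have "(\<Prod>i\<in>UNIV. residue_chart (t i) y) = residue_chart (t k) y * (\<Prod>i\<in>UNIV - {k}. residue_chart (t i) y)"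
          by (rule prod.remove) auto
        also have "(\<Prod>i\<in>UNIV - {k}. residue_chart (t i) y) = (\<Prod>i\<in>UNIV - {k}. coord_0 y - t i)"
        proof (rule prod.cong[OF refl])
          fix i assume "i \<in> UNIV - {k}"
          then have "t i \<in> range t - {t k}" using t by (auto simp: inj_def)
          with y show "residue_chart (t i) y = coord_0 y - t i" by (intro chart) (auto simp: V_def)
        qed
        finally show "(\<Prod>i\<in>UNIV - {k}. coord_0 y - t i) * (residue_chart (t k) y * \<alpha> y) = g y" by (simp add: g_def)
      qed
      finally have "regular_on (- {Infty} \<inter> V) g" by (rule regular_on_subset) blast
      moreover have "zariski_open V" "x \<in> V" by (auto simp: V_def k intro!: zariski_open_cofinite)
      ultimately show ?thesis by blast
    next
      case False
      define V where "V = - insert Infty (Pt ` range t)"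
      have V: "(V, \<lambda>_. mat 1) \<in> log_forms (range t)" unfolding V_def by (rule log_forms_charts)
      have VI: "Infty \<notin> V" by (simp add: V_def)
      have r: "regular_on V \<alpha>" using aff[OF V VI] by simp
      have "regular_on V (\<lambda>x. (\<Prod>i\<in>UNIV. coord_0 x - t i) * \<alpha> x)"
        using VI by (intro regular_on_mult[OF regular_on_prod r] regular_on_diff regular_on_coord_0 regular_on_const)
      also have "?this \<longleftrightarrow> regular_on V g"
      proof (rule regular_on_cong)
        fix y assume y: "y \<in> V"
        have "(\<Prod>i\<in>UNIV. residue_chart (t i) y) = (\<Prod>i\<in>UNIV. coord_0 y - t i)"
          by (rule prod.cong[OF refl], rule chart) (use y in \<open>auto simp: V_def\<close>)
        then show "(\<Prod>i\<in>UNIV. coord_0 y - t i) * \<alpha> y = g y" by (simp add: g_def)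
      qed
      finally have "regular_on (- {Infty} \<inter> V) g" by (rule regular_on_subset) blast
      moreover have "zariski_open V" "x \<in> V" using False x by (auto simp: V_def intro!: zariski_open_cofinite)
      ultimately show ?thesis by blast
    qed
  qed
  then obtain G where G: "\<And>z. g (Pt z) = poly G z" using regular_on_affine by blast
  define \<Phi> where "\<Phi> = (\<Prod>i\<in>UNIV. [:- t i, 1:])"
  note \<Phi> = nodal_total_poly[of t, folded \<Phi>_def]
  have \<alpha>: "\<alpha> (Pt z) = poly G z / poly \<Phi> z" if z: "z \<notin> range t" for z
  proof -
    have "(\<Prod>i\<in>UNIV. residue_chart (t i) (Pt z)) = (\<Prod>i\<in>UNIV. z - t i)"
      using z by (intro prod.cong) (auto simp: residue_chart_def)
    moreover have "(\<Prod>i\<in>UNIV. z - t i) \<noteq> 0" using z by auto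
    ultimately show ?thesis unfolding G[symmetric] g_def \<Phi> by simp
  qed
  \<comment> \<open>The numerator over \<Phi> of \<open>- (z ^ 2) * (\<alpha> + k / z)\<close>, the
    form at infinity in the generator \<open>dw\<close>.\<close>
  define Q where "Q = - (monom 1 2 * G + smult (of_int k) (monom 1 1 * \<Phi>))"
  have U: "zariski_open (- (Pt ` insert 0 (range t)))" "Infty \<in> - (Pt ` insert 0 (range t))"
    by (auto intro!: zariski_open_cofinite)
  have "degree Q \<le> degree \<Phi>"
  proof (rule regular_at_Infty_fraction(1)[OF inf U \<Phi>(4)])
    fix z assume "Pt z \<in> - (Pt ` insert 0 (range t))" "poly \<Phi> z \<noteq> 0"
    then have z: "z \<noteq> 0" "z \<notin> range t" "poly \<Phi> z \<noteq> 0" by auto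
    then show "infinity_chart (Pt z) * \<alpha>' (Pt z) = poly Q z / poly \<Phi> z"
      by (simp add: eq \<alpha> infinity_chart_def Q_def poly_monom power2_eq_square add_divide_distrib diff_divide_distrib algebra_simps)
  qed
  \<comment> \<open>Since \<open>Q\<close> has degree at most 4, its coefficients from degree 5 on
    vanish. Degree 5 determines the cubic coefficient of \<open>G\<close>, and the higher ones bound
    the degree of \<open>G\<close>.\<close>
  then have Q0: "coeff Q (l + 2) = 0" if "l \<ge> 3" for l using that \<Phi>(1) by (intro coeff_eq_0) simp
  have Qc: "coeff Q (l + 2) = - (coeff G l + of_int k * coeff \<Phi> (l + 1))" for l
    by (simp add: Q_def coeff_monom_mult)
  have "- (coeff G 3 + of_int k * coeff \<Phi> 4) = 0" using Q0[of 3] Qc[of 3] by simp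
  then have G3: "coeff G 3 = - of_int k"
    unfolding neg_equal_0_iff_equal by (simp add: \<Phi>(2) eq_neg_iff_add_eq_0)
  have degG: "degree G \<le> 3"
  proof (rule degree_le, intro allI impI)
    fix l :: nat assume l: "3 < l"
    then have "coeff \<Phi> (l + 1) = 0" using \<Phi>(1) by (intro coeff_eq_0) simp
    with Q0[of l] Qc[of l] l show "coeff G l = 0" by simp
  qed
  \<comment> \<open>The difference between \<open>G\<close> and its Lagrange interpolant: degree at
    most 3 with four distinct zeros.\<close>
  define H where "H = G - (\<Sum>i\<in>UNIV. smult (\<alpha> (Pt (t i))) (nodal_poly t i))"
  have "degree (\<Sum>i\<in>UNIV. smult (\<alpha> (Pt (t i))) (nodal_poly t i)) \<le> 3"
    by (intro degree_sum_le) (auto simp: nodal_poly_monic intro: order.trans[OF degree_smult_le])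
  then have degH: "degree H \<le> 3" unfolding H_def by (intro degree_diff_le degG)
  have root: "poly H (t j) = 0" for j
  proof -
    have "poly (\<Sum>i\<in>UNIV. smult (\<alpha> (Pt (t i))) (nodal_poly t i)) (t j)
       = (\<Sum>i\<in>UNIV. if i = j then \<alpha> (Pt (t j)) * poly (nodal_poly t j) (t j) else 0)"
      unfolding poly_sum by (rule sum.cong) (use poly_nodal_poly_node[OF t] in auto)
    moreover have "poly G (t j) = \<alpha> (Pt (t j)) * poly (nodal_poly t j) (t j)"
    proof -
      have "(\<Prod>i\<in>UNIV. residue_chart (t i) (Pt (t j))) =
          residue_chart (t j) (Pt (t j)) * (\<Prod>i\<in>UNIV - {j}. residue_chart (t i) (Pt (t j)))"
        by (rule prod.remove) auto
      also have "(\<Prod>i\<in>UNIV - {j}. residue_chart (t i) (Pt (t j))) = (\<Prod>i\<in>UNIV - {j}. t j - t i)"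
        using t by (intro prod.cong) (auto simp: residue_chart_def inj_def)
      finally show ?thesis unfolding G[symmetric] g_def poly_nodal_poly by (simp add: residue_chart_def)
    qed
    ultimately show ?thesis by (simp add: H_def)
  qed
  have "H = 0"
  proof (rule ccontr)
    assume "H \<noteq> 0"
    then have fin: "finite {z. poly H z = 0}" and "card {z. poly H z = 0} \<le> degree H"
      by (rule poly_roots_finite, rule card_poly_roots_bound)
    moreover have "card (range t) \<le> card {z. poly H z = 0}"
      using fin root by (intro card_mono) auto
    moreover have "card (range t) = 4" using t by (simp add: card_image)
    ultimately show False using degH by linarith
  qed
  then have "coeff G 3 = coeff (\<Sum>i\<in>UNIV. smult (\<alpha> (Pt (t i))) (nodal_poly t i)) 3" by (simp add: H_def)
  also have "\<dots> = (\<Sum>i\<in>UNIV. \<alpha> (Pt (t i)))" by (simp add: coeff_sum nodal_poly_monic)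
  finally show ?thesis using G3 by simp
qed

text \<open>Followed by the projection onto the \<open>j\<close>-th summand, the connection becomes
  one on \<open>O(m j)\<close>. Its connection forms \<alpha> and \<open>\<alpha>'\<close> in the
  generators at finite points and at infinity differ by \<open>m j dz / z\<close>, so the residue
  theorem gives minus the degree.\<close>

lemma connection_line_residues:
  fixes E :: "('n::finite) vbundle" and F :: "p1 \<Rightarrow> complex^'n^'n"
  assumes t: "inj (t :: 4 \<Rightarrow> complex)" and E: "vector_bundle E" and sp: "splitting E m F"
    and nab: "log_connection (range t) E nab"
    and res: "\<And>i. has_conn_residue E nab (Pt (t i)) (R i)"
  shows "(\<Sum>i\<in>UNIV. (matrix_inv (F (Pt (t i))) *v (R i *v column j (F (Pt (t i))))) $ j) = - of_int (m j)"
proof -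
  note inv = splitting_invertible[OF sp]
  let ?WA = "- {Infty}" and ?WB = "- {Pt 0}" and ?WC = "- {Infty, Pt 0}"
  define s0 where "s0 x = column j (F x)" for x
  define s1 where "s1 x = zpow (m j) x *s s0 x" for x
  have s1: "s1 x = column j (F x ** twist m x)" for x
    by (simp add: s1_def s0_def vec_eq_iff column_def twist_zpow matrix_mult_diagonal_nth mult.commute)
  have sec0: "is_section E ?WA s0" using splitting_frame0[OF sp] unfolding frame_columns s0_def by blast
  have sec1: "is_section E ?WB s1" using splitting_frame1[OF sp] unfolding frame_columns s1 by blast
  have W: "zariski_open ?WC" by (simp add: zariski_open_cofinite)
  have sec: "is_section E ?WC s0" "is_section E ?WC s1"
    by (rule is_section_subset[OF sec0], blast) (rule is_section_subset[OF sec1], blast)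
  note c = nab[unfolded log_connection_def]
  have ax1: "is_section (tensor_line E (log_forms (range t))) U (nab U s)" if "zariski_open U" "is_section E U s" for U s
    by (rule conjunct1[OF c, rule_format]) (simp add: that)
  have ax2: "nab V s' x = nab U s x"
    if "zariski_open U" "zariski_open V" "V \<subseteq> U" "is_section E U s" "is_section E V s'" "\<forall>x\<in>V. s' x = s x" "x \<in> V" for U V s s' x
    by (rule conjunct1[OF conjunct2[OF c], rule_format, OF _ that(7)]) (simp add: that)
  have ax4: "nab U (\<lambda>y. f y *s s y) x = f x *s nab U s x + log_d (range t) f x *s s x"
    if "zariski_open U" "regular_on U f" "is_section E U s" "x \<in> U" for U f s x
    by (rule conjunct2[OF conjunct2[OF conjunct2[OF c]], rule_format, OF _ that(4)]) (simp add: that)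
  define \<alpha> where "\<alpha> x = (matrix_inv (F x) *v nab ?WA s0 x) $ j" for x
  define \<alpha>' where "\<alpha>' x = (matrix_inv (F x ** twist m x) *v nab ?WB s1 x) $ j" for x
  have "(\<Sum>i\<in>UNIV. \<alpha> (Pt (t i))) = - of_int (m j)"
  proof (rule residue_sum[OF t])
    fix V \<omega> assume V: "(V, \<omega>) \<in> log_forms (range t)" "Infty \<notin> V"
    have "regular_vec_on (?WA \<inter> ?WA \<inter> V) (\<lambda>x. \<omega> x $ 1 $ 1 *s (matrix_inv (F x) *v nab ?WA s0 x))"
      by (rule tensor_section_frame[OF E ax1[OF _ sec0] splitting_frame0[OF sp] V(1)]) simp
    moreover have "?WA \<inter> ?WA \<inter> V = V" using V(2) by auto
    ultimately show "regular_on V (\<lambda>x. \<omega> x $ 1 $ 1 * \<alpha> x)" by (simp add: regular_vec_on_def \<alpha>_def)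
  next
    have "regular_vec_on (?WB \<inter> ?WB \<inter> - (Pt ` insert 0 (range t)))
        (\<lambda>x. (mat (infinity_chart x) :: complex^1^1) $ 1 $ 1 *s (matrix_inv (F x ** twist m x) *v nab ?WB s1 x))"
      by (rule tensor_section_frame[OF E ax1[OF _ sec1] splitting_frame1[OF sp] log_forms_charts(3)]) simp
    moreover have "?WB \<inter> ?WB \<inter> - (Pt ` insert 0 (range t)) = - (Pt ` insert 0 (range t))" by auto
    ultimately show "regular_on (- (Pt ` insert 0 (range t))) (\<lambda>x. infinity_chart x * \<alpha>' x)"
      by (simp add: regular_vec_on_def \<alpha>'_def)
  next
    fix z assume z: "z \<noteq> 0" "z \<notin> range t"
    let ?x = "Pt z"
    have x: "?x \<in> ?WC" using z by simp
    \<comment> \<open>The connection is a map of sheaves: the two generators live on different open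
      sets and are compared after restriction to the overlap.\<close>
    have "nab ?WB s1 ?x = nab ?WC s1 ?x"
      by (rule ax2[symmetric, OF _ W _ sec1 sec(2) _ x]) auto
    also have "\<dots> = nab ?WC (\<lambda>y. zpow (m j) y *s s0 y) ?x" by (simp add: s1_def[abs_def])
    also have "\<dots> = zpow (m j) ?x *s nab ?WC s0 ?x + log_d (range t) (zpow (m j)) ?x *s s0 ?x"
      by (rule ax4[OF W _ sec(1) x]) (rule regular_on_zpow; simp)
    also have "nab ?WC s0 ?x = nab ?WA s0 ?x"
      by (rule ax2[OF _ W _ sec0 sec(1) _ x]) auto
    finally have n: "nab ?WB s1 ?x = z powi m j *s nab ?WA s0 ?x + (of_int (m j) * z powi (m j - 1)) *s s0 ?x"
      using z by (simp add: log_d_zpow)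
    have e: "(matrix_inv (F ?x) *v s0 ?x) $ j = 1"
    proof -
      have "matrix_inv (F ?x) *v s0 ?x = column j (matrix_inv (F ?x) ** F ?x)" by (simp add: s0_def column_mult)
      then show ?thesis using inv by (simp add: matrix_inv_left column_def mat_def)
    qed
    have "\<alpha>' ?x = z powi (- m j) * (matrix_inv (F ?x) *v nab ?WB s1 ?x) $ j"
      using inv z
      by (simp add: \<alpha>'_def matrix_inv_mult invertible_twist matrix_inv_twist matrix_vector_mul_assoc[symmetric])
        (simp add: twist_zpow matrix_diagonal_mult_vec)
    also have "(matrix_inv (F ?x) *v nab ?WB s1 ?x) $ j = z powi m j * \<alpha> ?x + of_int (m j) * z powi (m j - 1)"
      unfolding n by (simp add: matrix_vector_right_distrib vector_scalar_commute e \<alpha>_def)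
    also have "z powi (- m j) * (z powi m j * \<alpha> ?x + of_int (m j) * z powi (m j - 1)) = \<alpha> ?x + of_int (m j) / z"
      using z by (simp add: power_int_minus power_int_diff field_simps)
    finally show "\<alpha>' ?x = \<alpha> ?x + of_int (m j) / z" .
  qed
  moreover have "\<alpha> (Pt (t i)) = (matrix_inv (F (Pt (t i))) *v (R i *v column j (F (Pt (t i))))) $ j" for i
  proof -
    have "nab ?WA s0 (Pt (t i)) = R i *v s0 (Pt (t i))"
      using res[of i] sec0 unfolding has_conn_residue_def by simp
    then show ?thesis by (simp add: \<alpha>_def s0_def)
  qed
  ultimately show ?thesis by simp
qed

lemma connection_imp_indecomposable:
  assumes E: "vector_bundle E" and t: "inj t" and ns: "nonspecial rp rm"
    and conn: "admits_connection t E P rp rm"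
  shows "\<not> decomposable_qp t E P"
proof
  assume "decomposable_qp t E P"
  then obtain m F where sp: "splitting E m F"
    and P: "\<And>i. P i = vec.span {column 1 (F (Pt (t i)))} \<or> P i = vec.span {column 2 (F (Pt (t i)))}"
    unfolding decomposable_iff_splitting[OF E] by blast
  note inv = splitting_invertible[OF sp]
  obtain nab where nab: "log_connection (range t) E nab"
    and "\<forall>i. \<exists>R. has_conn_residue E nab (Pt (t i)) R \<and> induces_on_flag R (P i) (rm i) (rp i)"
    using conn unfolding admits_connection_def by blast
  then obtain R where R: "\<And>i. has_conn_residue E nab (Pt (t i)) (R i)"
    and flag: "\<And>i. induces_on_flag (R i) (P i) (rm i) (rp i)" by metis
  \<comment> \<open>Where \<sigma> holds, \<open>P i\<close> is the second summand, so the first one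
    maps isomorphically onto the quotient by \<open>P i\<close> and carries the residue
    \<open>rp i\<close>; elsewhere it is \<open>P i\<close> itself and carries
    \<open>rm i\<close>.\<close>
  define \<sigma> where "\<sigma> i \<longleftrightarrow> P i \<noteq> vec.span {column 1 (F (Pt (t i)))}" for i
  have "(matrix_inv (F (Pt (t i))) *v (R i *v column 1 (F (Pt (t i))))) $ 1 = (if \<sigma> i then rp i else rm i)" for i
  proof -
    let ?F = "F (Pt (t i))"
    have col: "matrix_inv ?F *v column j ?F = column j (mat 1)" for j
      using inv by (simp add: column_mult[symmetric] matrix_inv_left)
    show ?thesis
    proof (cases "\<sigma> i")
      case True
      then have Pi: "P i = vec.span {column 2 ?F}" using P[of i] by (simp add: \<sigma>_def)
      have "R i *v column 1 ?F - rp i *s column 1 ?F \<in> P i" using flag[of i] unfolding induces_on_flag_def by blast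
      then obtain k where "R i *v column 1 ?F - rp i *s column 1 ?F = k *s column 2 ?F"
        unfolding Pi span_singleton_eq by blast
      then have "R i *v column 1 ?F = rp i *s column 1 ?F + k *s column 2 ?F" by (simp add: diff_eq_eq add.commute)
      then show ?thesis using True
        by (simp add: matrix_vector_right_distrib vector_scalar_commute col) (simp add: column_def mat_def)
    next
      case False
      then have "column 1 ?F \<in> P i" by (simp add: \<sigma>_def vec.span_base)
      then have "R i *v column 1 ?F = rm i *s column 1 ?F" using flag[of i] unfolding induces_on_flag_def by blast
      then show ?thesis using False
        by (simp add: vector_scalar_commute col) (simp add: column_def mat_def)
    qed
  qed
  then have "(\<Sum>i\<in>UNIV. if \<sigma> i then rp i else rm i) = - of_int (m 1)"
    using connection_line_residues[OF t E sp nab R, of 1] by simp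
  then have "(\<Sum>i\<in>UNIV. if \<sigma> i then rp i else rm i) \<in> \<int>" by simp
  with ns show False unfolding nonspecial_def by blast
qed

theorem lemma3p3:
  fixes t rp rm :: "4 \<Rightarrow> complex"
    and E :: "2 vbundle"
    and P :: "4 \<Rightarrow> (complex ^ 2) set"
  assumes "inj t"
    and "residues_N11 rp rm"
    and "nonspecial rp rm"
    and "quasiparabolic_bundle E P"
    and "bundle_degree E = 1"
  shows "(admits_connection t E P rp rm \<longleftrightarrow> \<not> decomposable_qp t E P) \<and>
         (\<not> decomposable_qp t E P \<longleftrightarrow> simple_qp t E P) \<and>
         (simple_qp t E P \<longleftrightarrow> not_in_single_O t E P) \<and>
         (not_in_single_O t E P \<longleftrightarrow> three_noncollinear t E P)"
proof -
  have E: "vector_bundle E" and P: "\<And>i. is_line (P i)"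
    using assms(4) unfolding quasiparabolic_bundle_def by auto
  let ?generic = "\<exists>F u. generic_coordinates t E P F u"
  have "\<not> decomposable_qp t E P \<Longrightarrow> ?generic"
    using indecomposable_imp_generic[where P = P, OF E assms(1) P assms(5)] by blast
  moreover have "?generic \<Longrightarrow> simple_qp t E P"
    using generic_imp_simple[OF E assms(1)] by blast
  moreover have "simple_qp t E P \<Longrightarrow> \<not> decomposable_qp t E P"
    by (rule simple_imp_indecomposable[OF E])
  moreover have "?generic \<Longrightarrow> admits_connection t E P rp rm"
    using generic_imp_connection[OF E assms(1,2)] by blast
  moreover have "admits_connection t E P rp rm \<Longrightarrow> \<not> decomposable_qp t E P"
    by (rule connection_imp_indecomposable[OF E assms(1,3)])
  ultimately show ?thesis
    using not_in_single_O_iff[OF E assms(1)] three_noncollinear_iff[where P = P, OF E assms(1) P] by blast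
qed

end
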